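(* Let $G$ be a copious graph on $[n]$ for which vertex $n$ is universal, and let $H=G\setminus n$ be the graph on $[n-1]$ obtained by deleting vertex $n$ and its incident edges. Then the chromatic polynomial $p_H(t)$ is divisible by $t-1$. Writing $\overline p_H(t)=p_H(t)/(t-1)$, the ML degree is $$\mu(G)=|\overline p_H(1)|.$$
   Context: Setup. $G\subseteq\binom{[n]}{2}$ is a simple graph, $n\ge4$, and $G_i$ is the set of neighbours of $i$. Vertex $n$ universal means it is adjacent to all other vertices. The chromatic polynomial $p_H(t)$ counts proper colourings of $H$ with $t$ colours. The kinematic space $\mathcal K_G\subseteq\mathbb P^{|G|-1}$ is defined by $\sum_{j\in G_i}s_{ij}=0$ for $i\in[n]$. $\mathcal H=\bigcup_{i<j}\{x_i=x_j\}$. Scattering correspondence. $$\mathcal V_G=\{(s,x)\in\mathbb P^{|G|-1}\times(\mathbb P^{n-1}\setminus\mathcal H): s\in\mathcal K_G,\ \textstyle\sum_{j\in G_i}s_{ij}/(x_i-x_j)=0\ \forall i\}.$$ Its $x$-solutions come in $\mathrm{PGL}(2)$-orbits (action $x_i\mapsto(ax_i+b)/(cx_i+d)$), i.e. points of the moduli space $\mathcal M_{0,n}$ of $n$ distinct points on $\mathbb P^1$. Copious and ML degree. $G$ is copious if $\mathcal V_G\to\mathcal M_{0,n}$ is dominant and the generic fiber of $\mathcal V_G\to\mathcal K_G$ has dimension two in $\mathbb P^{n-1}$. The ML degree $\mu(G)$ of a copious graph is the number of points of $\mathcal M_{0,n}$ in the fiber over a generic $s\in\mathcal K_G$, i.e.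 the number of critical points in $\mathcal M_{0,n}$ of $L_G=\sum_{ij\in G}s_{ij}\log(x_i-x_j)$. *)

theory Defs
  imports Complex_Main "HOL-Computational_Algebra.Polynomial" "HOL-Library.FuncSet"
begin

inductive_set polyfun :: "(('v \<Rightarrow> complex) \<Rightarrow> complex) set" where
  pf_const: "(\<lambda>_. c) \<in> polyfun"
| pf_var:   "(\<lambda>x. x v) \<in> polyfun"
| pf_add:   "f \<in> polyfun \<Longrightarrow> g \<in> polyfun \<Longrightarrow> (\<lambda>x. f x + g x) \<in> polyfun"
| pf_mult:  "f \<in> polyfun \<Longrightarrow> g \<in> polyfun \<Longrightarrow> (\<lambda>x. f x * g x) \<in> polyfun"

text \<open>A property holds for generic points of the (irreducible) set V: it holds on
  the nonzero points of a nonempty Zariski-open subset of V.\<close>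
definition generic_on :: "('v \<Rightarrow> complex) set \<Rightarrow> (('v \<Rightarrow> complex) \<Rightarrow> bool) \<Rightarrow> bool" where
  "generic_on V P \<longleftrightarrow> (\<exists>f\<in>polyfun. (\<exists>s\<in>V. f s \<noteq> 0) \<and> (\<forall>s\<in>V. (\<exists>v. s v \<noteq> 0) \<and> f s \<noteq> 0 \<longrightarrow> P s))"

definition simple_graph :: "nat \<Rightarrow> nat set set \<Rightarrow> bool" where
  "simple_graph n G \<longleftrightarrow> G \<subseteq> {{i, j} | i j. i \<in> {1..n} \<and> j \<in> {1..n} \<and> i \<noteq> j}"

definition nbrs :: "nat set set \<Rightarrow> nat \<Rightarrow> nat set" where
  "nbrs G i = {j. {i, j} \<in> G}"

definition kin_space :: "nat \<Rightarrow> nat set set \<Rightarrow> (nat set \<Rightarrow> complex) set" where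
  "kin_space n G = {s. (\<forall>e. e \<notin> G \<longrightarrow> s e = 0) \<and>
                        (\<forall>i\<in>{1..n}. (\<Sum>j\<in>nbrs G i. s {i, j}) = 0)}"

text \<open>Affine representatives of n distinct points (outside [n] the values are 0).\<close>
definition config_space :: "nat \<Rightarrow> (nat \<Rightarrow> complex) set" where
  "config_space n = {x. (\<forall>i\<in>{1..n}. \<forall>j\<in>{1..n}. i \<noteq> j \<longrightarrow> x i \<noteq> x j) \<and>
                        (\<forall>i. i \<notin> {1..n} \<longrightarrow> x i = 0)}"

definition scat_eqs :: "nat \<Rightarrow> nat set set \<Rightarrow> (nat set \<Rightarrow> complex) \<Rightarrow> (nat \<Rightarrow> complex) \<Rightarrow> bool" where
  "scat_eqs n G s x \<longleftrightarrow> (\<forall>i\<in>{1..n}. (\<Sum>j\<in>nbrs G i. s {i, j} / (x i - x j)) = 0)"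

definition fiber :: "nat \<Rightarrow> nat set set \<Rightarrow> (nat set \<Rightarrow> complex) \<Rightarrow> (nat \<Rightarrow> complex) set" where
  "fiber n G s = {x \<in> config_space n. scat_eqs n G s x}"

definition moebius_equiv :: "nat \<Rightarrow> ((nat \<Rightarrow> complex) \<times> (nat \<Rightarrow> complex)) set" where
  "moebius_equiv n = {(x, y). x \<in> config_space n \<and> y \<in> config_space n \<and>
     (\<exists>a b c d. a * d - b * c \<noteq> 0 \<and>
        (\<forall>i\<in>{1..n}. c * x i + d \<noteq> 0 \<and> y i = (a * x i + b) / (c * x i + d)))}"

definition fiber_M0n :: "nat \<Rightarrow> nat set set \<Rightarrow> (nat set \<Rightarrow> complex) \<Rightarrow> (nat \<Rightarrow> complex) set set" where
  "fiber_M0n n G s = fiber n G s // moebius_equiv n"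

text \<open>Dominance of V_G \<rightarrow> M_{0,n}: the image is Zariski dense.\<close>
definition scat_dominant :: "nat \<Rightarrow> nat set set \<Rightarrow> bool" where
  "scat_dominant n G \<longleftrightarrow> (\<forall>f\<in>polyfun.
     (\<forall>x\<in>config_space n. (\<exists>s\<in>kin_space n G. (\<exists>e. s e \<noteq> 0) \<and> scat_eqs n G s x) \<longrightarrow> f x = 0)
       \<longrightarrow> (\<forall>x\<in>config_space n. f x = 0))"

definition copious :: "nat \<Rightarrow> nat set set \<Rightarrow> bool" where
  "copious n G \<longleftrightarrow> scat_dominant n G \<and>
     generic_on (kin_space n G) (\<lambda>s. fiber n G s \<noteq> {} \<and> finite (fiber_M0n n G s))"

definition ml_degree :: "nat \<Rightarrow> nat set set \<Rightarrow> nat" where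
  "ml_degree n G = (THE N. generic_on (kin_space n G) (\<lambda>s. card (fiber_M0n n G s) = N))"

definition chrom_count :: "nat set \<Rightarrow> nat set set \<Rightarrow> nat \<Rightarrow> nat" where
  "chrom_count V H t = card {c \<in> V \<rightarrow>\<^sub>E {0..<t}. \<forall>e\<in>H. \<forall>i\<in>e. \<forall>j\<in>e. i \<noteq> j \<longrightarrow> c i \<noteq> c j}"

definition chrom_poly :: "nat set \<Rightarrow> nat set set \<Rightarrow> int poly" where
  "chrom_poly V H = (THE p. \<forall>t::nat. poly p (int t) = int (chrom_count V H t))"

end

theory Submission
  imports Defs "HOL-Computational_Algebra.Fundamental_Theorem_Algebra"
begin

text \<open>
  Sending \<open>x n\<close> to infinity and \<open>x a\<close>, \<open>x b\<close> to 0 and 1, for an edge \<open>ab\<close> of \<open>H\<close>, turns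
  the points of the fiber into the critical points of the master function of the graphic arrangement
  of \<open>H\<close>. If the weights of the edges other than \<open>ab\<close> are positive reals, then all critical points
  are real, and there is exactly one in each bounded chamber. These chambers correspond to the acyclic
  orientations of \<open>H\<close> with unique source \<open>a\<close> and unique sink \<open>b\<close>, whose number is the absolute value
  of the reduced chromatic polynomial at 1. For suitable positive weights no critical point has two
  equal coordinates, since a coincidence at a non-edge can be removed by a small perturbation. By
  quantifier elimination over the complex numbers, the property of having exactly \<open>N\<close> critical points
  holds generically or fails generically, so the count for positive weights, which are Zariski dense, is the
  generic count. Copiousness enters only through the connectedness of \<open>H\<close> (otherwise one component
  can be translated freely, and the fibers are infinite) and through the kinematic space being nonzero.
\<close>

section \<open>Polynomial functions, constructible sets and quantifier elimination\<close>

text \<open>A count at positive real weights is not yet a count at generic ones: these weights are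
  Zariski dense but not open. Once the count is expressed by finitely many polynomial conditions,
  one good real point decides the generic value.

  The edge \<open>ab\<close> is exempt from positivity because the kinematic equations, after
  elimination of the weights at \<open>n\<close>, leave one relation: the total weight of
  \<open>H\<close> is zero. It determines the weight of \<open>ab\<close>, which becomes negative.
  With \<open>x a\<close> and \<open>x b\<close> pinned, this weight occurs only in the equations at
  \<open>a\<close> and \<open>b\<close>.

  A chamber separates only adjacent vertices, whereas a configuration separates all; hence the
  perturbation argument, run at a weight with the fewest coincidences.

  The chromatic side avoids deletion and contraction. Only vertices are removed, with
  \<open>H\<close> fixed: the class of the top color and a set of sources of an acyclic orientation
  are both stable sets, and removing them gives parallel recursions (a shift of t to t - 1 on one
  side, alternating signs on the other).\<close>

lemma polyfun_sum: "(\<And>i. i \<in> I \<Longrightarrow> f i \<in> polyfun) \<Longrightarrow> (\<lambda>x. \<Sum>i\<in>I. f i x) \<in> polyfun"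
proof (induction I rule: infinite_finite_induct)
  case (insert i I)
  then show ?case using polyfun.pf_add[of "f i" "\<lambda>x. \<Sum>i\<in>I. f i x"] by simp
qed (auto intro: polyfun.intros)

lemma polyfun_prod: "(\<And>i. i \<in> I \<Longrightarrow> f i \<in> polyfun) \<Longrightarrow> (\<lambda>x. \<Prod>i\<in>I. f i x) \<in> polyfun"
proof (induction I rule: infinite_finite_induct)
  case (insert i I)
  then show ?case using polyfun.pf_mult[of "f i" "\<lambda>x. \<Prod>i\<in>I. f i x"] by simp
qed (auto intro: polyfun.intros)

lemma polyfun_uminus: "f \<in> polyfun \<Longrightarrow> (\<lambda>x. - f x) \<in> polyfun"
  using polyfun.pf_mult[OF polyfun.pf_const[of "-1"], of f] by simp

lemma polyfun_diff: "f \<in> polyfun \<Longrightarrow> g \<in> polyfun \<Longrightarrow> (\<lambda>x. f x - g x) \<in> polyfun"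
  using polyfun.pf_add[OF _ polyfun_uminus, of f g] by simp

lemma polyfun_subst:
  assumes "f \<in> polyfun" "\<And>v. (\<lambda>x. \<sigma> x v) \<in> polyfun"
  shows "(\<lambda>x. f (\<sigma> x)) \<in> polyfun"
  using assms(1) by induction (auto intro: polyfun.intros assms(2))

lemmas polyfun_intros = polyfun.intros polyfun_sum polyfun_prod polyfun_uminus polyfun_diff

lemma polyfun_line:
  assumes "f \<in> polyfun"
  shows "\<exists>p. \<forall>t. f (\<lambda>v. u v + t * w v) = poly p t"
  using assms
proof induction
  case (pf_const c)
  show ?case by (rule exI[of _ "[:c:]"]) simp
next
  case (pf_var v)
  show ?case by (rule exI[of _ "[:u v, w v:]"]) simp
next
  case (pf_add f g)
  then show ?case by (metis poly_add)
next
  case (pf_mult f g)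
  then show ?case by (metis poly_mult)
qed

text \<open>Stands in for irreducibility: it is all that is needed for two nonempty Zariski open
  subsets to meet, and it holds for linear subspaces such as the kinematic space.\<close>

definition line_closed :: "('v \<Rightarrow> complex) set \<Rightarrow> bool" where
  "line_closed K \<longleftrightarrow> (\<forall>u\<in>K. \<forall>w\<in>K. \<forall>t. (\<lambda>v. u v + t * (w v - u v)) \<in> K)"

text \<open>On the line that is \<open>u\<close> at t = 0 and \<open>w\<close> at t = 1, both
  functions become nonzero univariate polynomials, and their product has a non-root.\<close>

lemma line_closed_mult_nonzero:
  assumes "line_closed K" "f \<in> polyfun" "g \<in> polyfun" "u \<in> K" "f u \<noteq> 0" "w \<in> K" "g w \<noteq> 0"
  shows "\<exists>s\<in>K. f s * g s \<noteq> 0"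
proof -
  obtain p where p: "\<And>t. f (\<lambda>v. u v + t * (w v - u v)) = poly p t"
    using polyfun_line[OF assms(2), of u "\<lambda>v. w v - u v"] by blast
  obtain q where q: "\<And>t. g (\<lambda>v. u v + t * (w v - u v)) = poly q t"
    using polyfun_line[OF assms(3), of u "\<lambda>v. w v - u v"] by blast
  have "poly p 0 \<noteq> 0" "poly q 1 \<noteq> 0"
    using assms p[of 0] q[of 1] by auto
  then have "p * q \<noteq> 0" by auto
  then obtain t where "poly (p * q) t \<noteq> 0"
    using poly_all_0_iff_0 by blast
  moreover have "(\<lambda>v. u v + t * (w v - u v)) \<in> K"
    using assms(1,4,6) unfolding line_closed_def by blast
  ultimately show ?thesis unfolding poly_mult p[symmetric] q[symmetric] by blast
qed

text \<open>No rule for negation: inductions then meet only literals, conjunctions and disjunctions.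
  Negated properties are treated one level up, by \<open>generically_decided_not\<close>.\<close>

inductive_set constructible :: "(('v \<Rightarrow> complex) \<Rightarrow> bool) set" where
  con_eq: "f \<in> polyfun \<Longrightarrow> (\<lambda>x. f x = 0) \<in> constructible"
| con_neq: "f \<in> polyfun \<Longrightarrow> (\<lambda>x. f x \<noteq> 0) \<in> constructible"
| con_conj: "P \<in> constructible \<Longrightarrow> Q \<in> constructible \<Longrightarrow> (\<lambda>x. P x \<and> Q x) \<in> constructible"
| con_disj: "P \<in> constructible \<Longrightarrow> Q \<in> constructible \<Longrightarrow> (\<lambda>x. P x \<or> Q x) \<in> constructible"

lemma con_const: "(\<lambda>x. c) \<in> constructible"
proof (cases c)
  case True
  then show ?thesis using con_eq[OF polyfun.pf_const[of 0]] by simp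
next
  case False
  then show ?thesis using con_neq[OF polyfun.pf_const[of 0]] by simp
qed

lemma con_ball: "finite I \<Longrightarrow> (\<And>i. i \<in> I \<Longrightarrow> P i \<in> constructible) \<Longrightarrow> (\<lambda>x. \<forall>i\<in>I. P i x) \<in> constructible"
proof (induction I rule: finite_induct)
  case (insert i I)
  then show ?case using con_conj[of "P i" "\<lambda>x. \<forall>i\<in>I. P i x"] by simp
qed (auto intro: con_const)

lemma con_bex: "finite I \<Longrightarrow> (\<And>i. i \<in> I \<Longrightarrow> P i \<in> constructible) \<Longrightarrow> (\<lambda>x. \<exists>i\<in>I. P i x) \<in> constructible"
proof (induction I rule: finite_induct)
  case (insert i I)
  then show ?case using con_disj[of "P i" "\<lambda>x. \<exists>i\<in>I. P i x"] by simp
qed (auto intro: con_const)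

text \<open>Truth and falsity enter symmetrically, unlike in \<open>generic_on\<close>: the property
  has one truth value off the zero set of \<open>f\<close>, and evaluation at a single point there
  reveals which.\<close>

definition generically_decided :: "('v \<Rightarrow> complex) set \<Rightarrow> (('v \<Rightarrow> complex) \<Rightarrow> bool) \<Rightarrow> bool" where
  "generically_decided K P \<longleftrightarrow> (\<exists>f\<in>polyfun. (\<exists>s\<in>K. f s \<noteq> 0) \<and>
     ((\<forall>s\<in>K. f s \<noteq> 0 \<longrightarrow> P s) \<or> (\<forall>s\<in>K. f s \<noteq> 0 \<longrightarrow> \<not> P s)))"

lemma generically_decided_not: "generically_decided K P \<Longrightarrow> generically_decided K (\<lambda>s. \<not> P s)"
  unfolding generically_decided_def by auto

lemma generically_decided_conj:
  assumes "line_closed K" "generically_decided K P" "generically_decided K Q"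
  shows "generically_decided K (\<lambda>s. P s \<and> Q s)"
proof -
  obtain f u where f: "f \<in> polyfun" "u \<in> K" "f u \<noteq> 0"
    "(\<forall>s\<in>K. f s \<noteq> 0 \<longrightarrow> P s) \<or> (\<forall>s\<in>K. f s \<noteq> 0 \<longrightarrow> \<not> P s)"
    using assms(2) unfolding generically_decided_def by blast
  obtain g w where g: "g \<in> polyfun" "w \<in> K" "g w \<noteq> 0"
    "(\<forall>s\<in>K. g s \<noteq> 0 \<longrightarrow> Q s) \<or> (\<forall>s\<in>K. g s \<noteq> 0 \<longrightarrow> \<not> Q s)"
    using assms(3) unfolding generically_decided_def by blast
  have "\<exists>s\<in>K. f s * g s \<noteq> 0"
    using line_closed_mult_nonzero assms(1) f(1-3) g(1-3) by blast
  moreover have "(\<forall>s\<in>K. f s * g s \<noteq> 0 \<longrightarrow> P s \<and> Q s) \<or> (\<forall>s\<in>K. f s * g s \<noteq> 0 \<longrightarrow> \<not> (P s \<and> Q s))"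
    using f(4) g(4) unfolding mult_eq_0_iff by blast
  ultimately show ?thesis unfolding generically_decided_def
    by (intro bexI[OF conjI polyfun.pf_mult[OF f(1) g(1)]])
qed

lemma generically_decided_disj:
  assumes "line_closed K" "generically_decided K P" "generically_decided K Q"
  shows "generically_decided K (\<lambda>s. P s \<or> Q s)"
  using generically_decided_not[OF generically_decided_conj[OF assms(1) generically_decided_not[OF assms(2)] generically_decided_not[OF assms(3)]]]
  by simp

lemma constructible_generically_decided:
  assumes "P \<in> constructible" "line_closed K" "K \<noteq> {}"
  shows "generically_decided K P"
proof -
  \<comment> \<open>An equation either holds identically on \<open>K\<close>, certified by the
    constant 1, or fails wherever \<open>f\<close> itself is nonzero.\<close>
  have eq: "generically_decided K (\<lambda>x. f x = 0)" if f: "f \<in> polyfun" for f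
  proof (cases "\<forall>s\<in>K. f s = 0")
    case True
    then show ?thesis unfolding generically_decided_def using assms(3)
      by (intro bexI[of _ "\<lambda>_. 1"]) (auto intro: polyfun.intros)
  next
    case False
    then show ?thesis unfolding generically_decided_def using f by blast
  qed
  from assms(1) show ?thesis
  proof induction
    case (con_eq f)
    then show ?case by (rule eq)
  next
    case (con_neq f)
    then show ?case using generically_decided_not[OF eq] by blast
  qed (use assms(2) generically_decided_conj generically_decided_disj in blast)+
qed

text \<open>Univariate polynomials whose coefficients are polynomial in the remaining variables. The
  bound \<open>d\<close> is strict, so \<open>d = 0\<close> forces the zero polynomial, and the
  coefficient of index \<open>d\<close> in a family of bound \<open>Suc d\<close> is a formal
  leading coefficient that may vanish at some points.\<close>

definition poly_family :: "nat \<Rightarrow> (('v \<Rightarrow> complex) \<Rightarrow> complex poly) \<Rightarrow> bool" where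
  "poly_family d F \<longleftrightarrow> (\<forall>k. (\<lambda>x. coeff (F x) k) \<in> polyfun) \<and> (\<forall>x k. k \<ge> d \<longrightarrow> coeff (F x) k = 0)"

lemma poly_family_coeff: "poly_family d F \<Longrightarrow> (\<lambda>x. coeff (F x) k) \<in> polyfun"
  unfolding poly_family_def by blast

lemma poly_family_zero: "poly_family 0 F \<Longrightarrow> F x = 0"
  unfolding poly_family_def by (simp add: poly_eq_iff)

lemma poly_family_degree:
  assumes "poly_family (Suc d) F" "coeff (F x) d \<noteq> 0"
  shows "degree (F x) = d"
proof (rule antisym)
  show "degree (F x) \<le> d"
    using assms(1) unfolding poly_family_def by (intro degree_le) auto
qed (use assms(2) in \<open>rule le_degree\<close>)

lemma poly_family_mono: "poly_family d F \<Longrightarrow> d \<le> e \<Longrightarrow> poly_family e F"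
  unfolding poly_family_def by auto

lemma poly_family_add:
  assumes "poly_family d F" "poly_family e G"
  shows "poly_family (max d e) (\<lambda>x. F x + G x)"
  using assms unfolding poly_family_def by (auto intro: polyfun_intros)

lemma poly_family_mult:
  assumes "poly_family d F" "poly_family e G"
  shows "poly_family (d + e) (\<lambda>x. F x * G x)"
proof -
  have "coeff (F x) i * coeff (G x) (k - i) = 0" if "k \<ge> d + e" for x k i
    using assms that unfolding poly_family_def by (cases "i \<ge> d") auto
  then show ?thesis using assms unfolding poly_family_def coeff_mult
    by (auto intro!: polyfun_intros sum.neutral)
qed

lemma poly_family_power:
  assumes "poly_family d F"
  shows "\<exists>e. poly_family e (\<lambda>x. F x ^ k)"
proof (induction k)
  case 0
  have "poly_family 1 (\<lambda>x. 1 :: complex poly)"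
    unfolding poly_family_def by (auto simp: coeff_1 intro: polyfun_intros)
  then show ?case by auto
next
  case (Suc k)
  then obtain e where "poly_family e (\<lambda>x. F x ^ k)" by (elim exE)
  from poly_family_mult[OF assms this] show ?case by (intro exI[of _ "d + e"]) simp
qed

lemma polyfun_poly_family:
  assumes "f \<in> polyfun"
  shows "\<exists>d F. poly_family d F \<and> (\<forall>x y. f (x(v := y)) = poly (F x) y)"
  using assms
proof induction
  case (pf_const c)
  have "poly_family 1 (\<lambda>x. [:c:])"
    unfolding poly_family_def by (auto simp: coeff_pCons split: nat.splits intro: polyfun_intros)
  then show ?case by (intro exI[of _ 1] exI[of _ "\<lambda>x. [:c:]"]) simp
next
  case (pf_var w)
  show ?case
  proof (cases "w = v")
    case True
    have "poly_family 2 (\<lambda>x. [:0, 1:])"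
      unfolding poly_family_def by (auto intro: polyfun.pf_const coeff_eq_0)
    then show ?thesis using True by (intro exI[of _ 2] exI[of _ "\<lambda>x. [:0, 1:]"]) simp
  next
    case False
    have "(\<lambda>x. coeff [:x w:] k) \<in> polyfun" for k
      by (cases k) (auto intro: polyfun_intros)
    then have "poly_family 1 (\<lambda>x. [:x w:])"
      unfolding poly_family_def by (auto simp: coeff_pCons split: nat.splits)
    then show ?thesis using False by (intro exI[of _ 1] exI[of _ "\<lambda>x. [:x w:]"]) simp
  qed
next
  case (pf_add f g)
  then obtain d F e G where "poly_family d F" "\<forall>x y. f (x(v := y)) = poly (F x) y"
    "poly_family e G" "\<forall>x y. g (x(v := y)) = poly (G x) y" by blast
  then show ?case using poly_family_add[of d F e G]
    by (intro exI[of _ "max d e"] exI[of _ "\<lambda>x. F x + G x"]) (simp del: fun_upd_apply)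
next
  case (pf_mult f g)
  then obtain d F e G where "poly_family d F" "\<forall>x y. f (x(v := y)) = poly (F x) y"
    "poly_family e G" "\<forall>x y. g (x(v := y)) = poly (G x) y" by blast
  then show ?case using poly_family_mult[of d F e G]
    by (intro exI[of _ "d + e"] exI[of _ "\<lambda>x. F x * G x"]) (simp del: fun_upd_apply)
qed

lemma poly_family_neq_0:
  assumes "poly_family d F"
  shows "(\<lambda>x. F x \<noteq> 0) \<in> constructible"
proof -
  have "(\<lambda>x. F x \<noteq> 0) = (\<lambda>x. \<exists>k\<in>{..<d}. coeff (F x) k \<noteq> 0)"
    using assms unfolding poly_family_def poly_eq_iff by (auto simp: fun_eq_iff not_less) (meson lessThan_iff not_less)+
  also have "\<dots> \<in> constructible"
    using assms by (intro con_bex con_neq) (auto simp: poly_family_coeff)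
  finally show ?thesis .
qed

text \<open>For the branch where the formal leading coefficient vanishes: there the polynomial is
  unchanged and the bound drops.\<close>

lemma poly_family_truncate:
  assumes "poly_family (Suc d) F"
  shows "poly_family d (\<lambda>x. F x - monom (coeff (F x) d) d)"
  unfolding poly_family_def
proof (intro conjI allI impI)
  fix k show "(\<lambda>x. coeff (F x - monom (coeff (F x) d) d) k) \<in> polyfun"
    using assms by (cases "k = d") (auto simp: poly_family_coeff intro: polyfun_intros)
next
  fix x k assume "k \<ge> d"
  then show "coeff (F x - monom (coeff (F x) d) d) k = 0"
    using assms unfolding poly_family_def by (cases "k = d") auto
qed

text \<open>One step of pseudo-division. Multiplying \<open>G x\<close> by the leading coefficient
  of \<open>F x\<close>, instead of dividing, keeps all coefficients polynomial in the parameters;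
  the coefficient of index \<open>e\<close> cancels.\<close>

lemma poly_family_reduce:
  assumes F: "poly_family (Suc d) F" and G: "poly_family (Suc e) G" and "d \<le> e"
  shows "poly_family e (\<lambda>x. smult (coeff (F x) d) (G x) - monom (coeff (G x) e) (e - d) * F x)"
  unfolding poly_family_def
proof (intro conjI allI impI)
  fix k 
  have "(\<lambda>x. coeff (G x) e * coeff (F x) (k - (e - d))) \<in> polyfun"
    using F G by (auto simp: poly_family_coeff intro: polyfun_intros)
  then have "(\<lambda>x. coeff (monom (coeff (G x) e) (e - d) * F x) k) \<in> polyfun"
    by (cases "k < e - d") (auto simp: coeff_monom_mult intro: polyfun_intros)
  moreover have "(\<lambda>x. coeff (F x) d * coeff (G x) k) \<in> polyfun"
    using F G by (auto simp: poly_family_coeff intro: polyfun.pf_mult)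
  ultimately show "(\<lambda>x. coeff (smult (coeff (F x) d) (G x) - monom (coeff (G x) e) (e - d) * F x) k) \<in> polyfun"
    using polyfun_diff by fastforce
next
  fix x k assume k: "k \<ge> e"
  then show "coeff (smult (coeff (F x) d) (G x) - monom (coeff (G x) e) (e - d) * F x) k = 0"
    using assms unfolding poly_family_def by (cases "k = e") (auto simp: coeff_monom_mult)
qed

text \<open>Repeated pseudo-division brings \<open>G\<close> below the degree of \<open>F\<close>
  without changing divisibility by \<open>F\<close> where its leading coefficient is nonzero; below
  that degree only 0 is divisible.\<close>

lemma poly_family_pseudo_mod:
  assumes F: "poly_family (Suc d) F" and G: "poly_family e G"
  shows "\<exists>R. poly_family d R \<and> (\<forall>x. coeff (F x) d \<noteq> 0 \<longrightarrow> (F x dvd G x \<longleftrightarrow> R x = 0))"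
  using G
proof (induction e arbitrary: G)
  case 0
  then show ?case
    using poly_family_zero[OF 0] poly_family_mono[OF 0, of d]
    by (intro exI[of _ G]) simp
next
  case (Suc e)
  show ?case
  proof (cases "d \<le> e")
    case True
    obtain R where R: "poly_family d R" "\<forall>x. coeff (F x) d \<noteq> 0 \<longrightarrow>
        (F x dvd smult (coeff (F x) d) (G x) - monom (coeff (G x) e) (e - d) * F x \<longleftrightarrow> R x = 0)"
      using Suc.IH[OF poly_family_reduce[OF F Suc.prems True]] by blast
    have "F x dvd G x \<longleftrightarrow> F x dvd smult (coeff (F x) d) (G x) - monom (coeff (G x) e) (e - d) * F x"
      if "coeff (F x) d \<noteq> 0" for x
      using that by (simp add: dvd_diff_left_iff dvd_smult_iff)
    with R show ?thesis by blast
  next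
    case False
    have deg: "F x dvd G x \<longleftrightarrow> G x = 0" if "coeff (F x) d \<noteq> 0" for x
    proof
      assume dv: "F x dvd G x"
      show "G x = 0"
      proof (rule ccontr)
        assume nz: "G x \<noteq> 0"
        have "d \<le> degree (F x)" using that by (rule le_degree)
        also have "\<dots> \<le> degree (G x)" using dv nz by (rule dvd_imp_degree_le)
        finally have "lead_coeff (G x) = 0" 
          using Suc.prems False unfolding poly_family_def by auto
        with nz show False by simp
      qed
    qed auto
    have "poly_family d G" using False Suc.prems poly_family_mono by (metis not_less_eq_eq)
    with deg show ?thesis by blast
  qed
qed

text \<open>Euclid's algorithm with parameters. Two equations are reduced against each other,
  splitting on whether a leading coefficient vanishes, until at most one equation is left. The
  measure adds \<open>Suc d\<close> rather than \<open>d\<close> so that deleting a trivial equation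
  of bound 0 also decreases it.\<close>

lemma con_ex_common_root:
  assumes "\<forall>(d, F)\<in>set L. poly_family d F" "poly_family e G"
  shows "(\<lambda>x. \<exists>y. (\<forall>(d, F)\<in>set L. poly (F x) y = 0) \<and> poly (G x) y \<noteq> 0) \<in> constructible"
  using assms(1)
proof (induction "sum_list (map (\<lambda>(d, F). Suc d) L)" arbitrary: L rule: less_induct)
  case less
  let ?goal = "\<lambda>L. (\<lambda>x. \<exists>y. (\<forall>(d, F)\<in>set L. poly (F x) y = 0) \<and> poly (G x) y \<noteq> 0)"
  let ?m = "\<lambda>L. sum_list (map (\<lambda>(d, F). Suc d) L)"
  have perm: "?goal L' = ?goal L" if "set L' = set L" for L L' :: "(nat \<times> (('a \<Rightarrow> complex) \<Rightarrow> complex poly)) list"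
    using that by simp
  consider (Nil) "L = []" | (zero) F where "(0, F) \<in> set L"
    | (one) d F where "L = [(Suc d, F)]"
    | (two) d F e' F' L' where "L = (d, F) # (e', F') # L'" "\<forall>(d,F) \<in> set L. d \<noteq> 0"
  proof -
    show ?thesis
    proof (cases "\<exists>F. (0, F) \<in> set L")
      case True
      then show ?thesis using that(2) by blast
    next
      case False
      then have nz: "\<forall>(d,F) \<in> set L. d \<noteq> 0" by (metis (mono_tags, lifting) case_prodI2)
      show ?thesis
      proof (cases L)
        case Nil
        then show ?thesis using that(1) by blast
      next
        case (Cons p M)
        show ?thesis
        proof (cases M)
          case Nil
          then show ?thesis using Cons nz that(3)[of "fst p - 1" "snd p"] by (cases p) auto
        next
          case (Cons q M')
          then show ?thesis using \<open>L = p # M\<close> nz that(4) by (cases p; cases q) auto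
        qed
      qed
    qed
  qed
  then show ?case
  proof cases
    case Nil
    have "?goal L = (\<lambda>x. G x \<noteq> 0)"
      using Nil by (auto simp: fun_eq_iff) (metis poly_all_0_iff_0)
    then show ?thesis using poly_family_neq_0[OF assms(2)] by simp
  next
    case zero
    then obtain L1 L2 where L: "L = L1 @ (0, F) # L2" using split_list by metis
    have "?goal (L1 @ L2) \<in> constructible"
      using less.prems by (intro less.hyps) (auto simp: L)
    moreover have "?goal (L1 @ L2) = ?goal L"
      using poly_family_zero[of F] less.prems by (auto simp: L)
    ultimately show ?thesis by simp
  next
    case one
    then have F: "poly_family (Suc d) F" using less.prems by auto
    \<comment> \<open>Roots of a polynomial of degree \<open>d\<close> have multiplicity at most
      \<open>d\<close>, so all of them are roots of \<open>G x\<close> exactly when it divides the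
      \<open>d\<close>-th power of \<open>G x\<close>.\<close>
    obtain k where k: "poly_family k (\<lambda>x. G x ^ d)" using poly_family_power[OF assms(2)] by blast
    obtain R where R: "poly_family d R" "\<And>x. coeff (F x) d \<noteq> 0 \<Longrightarrow> (F x dvd G x ^ d \<longleftrightarrow> R x = 0)"
      using poly_family_pseudo_mod[OF F k] by blast
    let ?F = "\<lambda>x. F x - monom (coeff (F x) d) d"
    have IH: "?goal [(d, ?F)] \<in> constructible"
      using poly_family_truncate[OF F] by (intro less.hyps) (auto simp: one)
    have main: "(\<exists>y. poly (F x) y = 0 \<and> poly (G x) y \<noteq> 0) \<longleftrightarrow> R x \<noteq> 0" if c: "coeff (F x) d \<noteq> 0" for x
    proof -
      have "degree (F x) = d"
        using F c by (rule poly_family_degree)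
      moreover have "F x \<noteq> 0" using c by auto
      ultimately show ?thesis using nullstellensatz_univariate[of "F x" "G x"] R(2)[OF c] by auto
    qed
    have "?goal L = (\<lambda>x. (coeff (F x) d = 0 \<and> ?goal [(d, ?F)] x) \<or> (coeff (F x) d \<noteq> 0 \<and> R x \<noteq> 0))"
    proof (rule ext)
      fix x
      show "?goal L x = ((coeff (F x) d = 0 \<and> ?goal [(d, ?F)] x) \<or> (coeff (F x) d \<noteq> 0 \<and> R x \<noteq> 0))"
        using main[of x] by (cases "coeff (F x) d = 0") (simp_all add: one)
    qed
    also have "\<dots> \<in> constructible"
      by (intro con_disj con_conj con_eq con_neq IH poly_family_neq_0[OF R(1)] poly_family_coeff[OF F])
    finally show ?thesis .
  next
    case two
    have key: "?goal ((Suc d, F) # (Suc e, F') # L') \<in> constructible"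
      if prem: "poly_family (Suc d) F" "poly_family (Suc e) F'" "\<forall>(d, F)\<in>set L'. poly_family d F" "d \<le> e"
        and m: "?m ((Suc d, F) # (Suc e, F') # L') = ?m L" for d F e F' L'
    proof -
      let ?F = "\<lambda>x. F x - monom (coeff (F x) d) d"
      let ?F' = "\<lambda>x. smult (coeff (F x) d) (F' x) - monom (coeff (F' x) e) (e - d) * F x"
      have IH1: "?goal ((d, ?F) # (Suc e, F') # L') \<in> constructible"
        using poly_family_truncate[OF prem(1)] prem m by (intro less.hyps) auto
      have IH2: "?goal ((Suc d, F) # (e, ?F') # L') \<in> constructible"
        using poly_family_reduce[OF prem(1,2,4)] prem m by (intro less.hyps) auto
      have "?goal ((Suc d, F) # (Suc e, F') # L') = 
        (\<lambda>x. (coeff (F x) d = 0 \<and> ?goal ((d, ?F) # (Suc e, F') # L') x) \<or>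
             (coeff (F x) d \<noteq> 0 \<and> ?goal ((Suc d, F) # (e, ?F') # L') x))"
      proof (rule ext)
        fix x
        show "?goal ((Suc d, F) # (Suc e, F') # L') x = 
          ((coeff (F x) d = 0 \<and> ?goal ((d, ?F) # (Suc e, F') # L') x) \<or>
             (coeff (F x) d \<noteq> 0 \<and> ?goal ((Suc d, F) # (e, ?F') # L') x))"
        proof (cases "coeff (F x) d = 0")
          case False
          then have "(poly (F x) y = 0 \<and> poly (F' x) y = 0) \<longleftrightarrow> (poly (F x) y = 0 \<and> poly (?F' x) y = 0)" for y
            by auto
          then have iff: "(\<forall>(d, F)\<in>set ((Suc d, F) # (Suc e, F') # L'). poly (F x) y = 0) \<longleftrightarrow>
            (\<forall>(d, F)\<in>set ((Suc d, F) # (e, ?F') # L'). poly (F x) y = 0)" for y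
            unfolding list.set ball_simps prod.case by blast
          show ?thesis using False by (simp only: iff simp_thms)
        qed simp
      qed
      also have "\<dots> \<in> constructible"
        by (intro con_disj con_conj con_eq con_neq IH1 IH2 poly_family_coeff[OF prem(1)])
      finally show ?thesis .
    qed
    obtain d0 e0 where de: "d = Suc d0" "e' = Suc e0" using two by (auto simp: gr0_conv_Suc)
    have prem: "poly_family (Suc d0) F" "poly_family (Suc e0) F'" "\<forall>(d, F)\<in>set L'. poly_family d F"
      using less.prems two de by auto
    show ?thesis
    proof (cases "d0 \<le> e0")
      case True
      then show ?thesis using key[OF prem] two(1) de by simp
    next
      case False
      then have "?goal ((Suc e0, F') # (Suc d0, F) # L') \<in> constructible"
        using key[OF prem(2,1,3)] two(1) de by simp
      moreover have "?goal ((Suc e0, F') # (Suc d0, F) # L') = ?goal L"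
        using two(1) de by (intro perm) auto
      ultimately show ?thesis by simp
    qed
  qed
qed

text \<open>One inequation per disjunct suffices, because several can be multiplied
  together.\<close>

lemma con_dnf:
  assumes "P \<in> constructible"
  shows "\<exists>L. (\<forall>(S, g)\<in>set L. set S \<subseteq> polyfun \<and> g \<in> polyfun) \<and>
             P = (\<lambda>x. \<exists>(S, g)\<in>set L. (\<forall>f\<in>set S. f x = 0) \<and> g x \<noteq> 0)"
  using assms
proof induction
  case (con_eq f)
  then show ?case
    by (intro exI[of _ "[([f], \<lambda>_. 1)]"]) (auto intro: polyfun_intros)
next
  case (con_neq f)
  then show ?case by (intro exI[of _ "[([], f)]"]) auto
next
  case (con_conj P Q)
  then obtain L M where L: "\<forall>(S, g)\<in>set L. set S \<subseteq> polyfun \<and> g \<in> polyfun"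
      "P = (\<lambda>x. \<exists>(S, g)\<in>set L. (\<forall>f\<in>set S. f x = 0) \<and> g x \<noteq> 0)"
    and M: "\<forall>(S, g)\<in>set M. set S \<subseteq> polyfun \<and> g \<in> polyfun"
      "Q = (\<lambda>x. \<exists>(S, g)\<in>set M. (\<forall>f\<in>set S. f x = 0) \<and> g x \<noteq> 0)" by blast
  let ?N = "map (\<lambda>p. (fst (fst p) @ fst (snd p), \<lambda>x. snd (fst p) x * snd (snd p) x)) (List.product L M)"
  have "\<forall>(S, g)\<in>set ?N. set S \<subseteq> polyfun \<and> g \<in> polyfun"
    using L(1) M(1) by (auto simp: case_prod_beta intro!: polyfun.pf_mult)
  moreover have "(\<exists>(S, g)\<in>set ?N. (\<forall>f\<in>set S. f x = 0) \<and> g x \<noteq> 0) = (P x \<and> Q x)" for x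
    unfolding L(2) M(2) by (auto simp: case_prod_beta ball_Un)
  ultimately show ?case by (intro exI[of _ ?N]) (simp add: fun_eq_iff)
next
  case (con_disj P Q)
  then obtain L M where L: "\<forall>(S, g)\<in>set L. set S \<subseteq> polyfun \<and> g \<in> polyfun"
      "P = (\<lambda>x. \<exists>(S, g)\<in>set L. (\<forall>f\<in>set S. f x = 0) \<and> g x \<noteq> 0)"
    and M: "\<forall>(S, g)\<in>set M. set S \<subseteq> polyfun \<and> g \<in> polyfun"
      "Q = (\<lambda>x. \<exists>(S, g)\<in>set M. (\<forall>f\<in>set S. f x = 0) \<and> g x \<noteq> 0)" by blast
  then show ?case
    by (intro exI[of _ "L @ M"]) (simp add: fun_eq_iff ball_Un bex_Un)
qed

text \<open>Chevalley's theorem for a projection along one coordinate: the quantifier passes through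
  the disjunction, and each disjunct is a parametrised system in one unknown.\<close>

lemma con_ex_var:
  assumes "P \<in> constructible"
  shows "(\<lambda>x. \<exists>y. P (x(v := y))) \<in> constructible"
proof -
  obtain L where L: "\<forall>(S, g)\<in>set L. set S \<subseteq> polyfun \<and> g \<in> polyfun"
    "P = (\<lambda>x. \<exists>(S, g)\<in>set L. (\<forall>f\<in>set S. f x = 0) \<and> g x \<noteq> 0)"
    using con_dnf[OF assms] by blast
  have basic: "(\<lambda>x. \<exists>y. (\<forall>f\<in>set S. f (x(v := y)) = 0) \<and> g (x(v := y)) \<noteq> 0) \<in> constructible"
    if S: "set S \<subseteq> polyfun" and g: "g \<in> polyfun" for S g
  proof -
    obtain e G where G: "poly_family e G" "\<And>x y. g (x(v := y)) = poly (G x) y"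
      using polyfun_poly_family[OF g] by blast
    have "\<forall>f\<in>set S. \<exists>dF. poly_family (fst dF) (snd dF) \<and> (\<forall>x y. f (x(v := y)) = poly (snd dF x) y)"
      using S polyfun_poly_family by fastforce
    then obtain \<phi> where \<phi>: "\<And>f. f \<in> set S \<Longrightarrow> poly_family (fst (\<phi> f)) (snd (\<phi> f))"
        "\<And>f x y. f \<in> set S \<Longrightarrow> f (x(v := y)) = poly (snd (\<phi> f) x) y" by metis
    have "(\<lambda>x. \<exists>y. (\<forall>(d, F)\<in>set (map \<phi> S). poly (F x) y = 0) \<and> poly (G x) y \<noteq> 0) \<in> constructible"
      using \<phi>(1) G(1) by (intro con_ex_common_root) (auto simp: case_prod_beta)
    also have "(\<lambda>x. \<exists>y. (\<forall>(d, F)\<in>set (map \<phi> S). poly (F x) y = 0) \<and> poly (G x) y \<noteq> 0) =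
      (\<lambda>x. \<exists>y. (\<forall>f\<in>set S. f (x(v := y)) = 0) \<and> g (x(v := y)) \<noteq> 0)"
      using \<phi>(2) G(2) by (simp add: case_prod_beta)
    finally show ?thesis .
  qed
  have swap: "(\<exists>y. \<exists>p\<in>A. R y p) \<longleftrightarrow> (\<exists>p\<in>A. \<exists>y. R y p)"
    for A :: "'b set" and R :: "complex \<Rightarrow> 'b \<Rightarrow> bool" by blast
  have "(\<lambda>x. \<exists>y. P (x(v := y))) =
    (\<lambda>x. \<exists>p\<in>set L. \<exists>y. (\<forall>f\<in>set (fst p). f (x(v := y)) = 0) \<and> snd p (x(v := y)) \<noteq> 0)"
    unfolding L(2) case_prod_beta by (intro ext swap)
  also have "\<dots> \<in> constructible"
    using L(1) by (intro con_bex basic) (auto simp: case_prod_beta)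
  finally show ?thesis .
qed

lemma con_ex_vars:
  assumes "finite W" "P \<in> constructible"
  shows "(\<lambda>x. \<exists>z. P (\<lambda>v. if v \<in> W then z v else x v)) \<in> constructible"
  using assms
proof (induction W arbitrary: P rule: finite_induct)
  case empty
  then show ?case by simp
next
  case (insert w W)
  have fwd: "(\<lambda>v. if v \<in> insert w W then z v else x v) = (\<lambda>v. if v \<in> W then z v else x v)(w := z w)" 
    for x z :: "'a \<Rightarrow> complex" by (rule ext) simp
  have bwd: "(\<lambda>v. if v \<in> insert w W then (z(w := y)) v else x v) = (\<lambda>v. if v \<in> W then z v else x v)(w := y)"
    for x z :: "'a \<Rightarrow> complex" and y using insert.hyps by (intro ext) simp
  have "(\<exists>z. P (\<lambda>v. if v \<in> insert w W then z v else x v)) \<longleftrightarrow>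
        (\<exists>z. \<exists>y. P ((\<lambda>v. if v \<in> W then z v else x v)(w := y)))" (is "?l \<longleftrightarrow> ?r") for x
  proof
    assume ?l
    then show ?r unfolding fwd by blast
  next
    assume ?r
    then show ?l unfolding bwd[symmetric] by blast
  qed
  then have "(\<lambda>x. \<exists>z. P (\<lambda>v. if v \<in> insert w W then z v else x v)) =
        (\<lambda>x. \<exists>z. \<exists>y. P ((\<lambda>v. if v \<in> W then z v else x v)(w := y)))"
    by (rule ext)
  then show ?case using insert.IH[OF con_ex_var[OF insert.prems, of w]] by (simp only:)
qed

section \<open>Chromatic polynomials and bipolar orientations\<close>

text \<open>The recursions below express the count with \<open>Suc t\<close> colors through counts
  with \<open>t\<close> colors, so only positive arguments are compared.\<close>

lemma poly_eqI_nat: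
  fixes p q :: "int poly"
  assumes "\<And>t. poly p (int (Suc t)) = poly q (int (Suc t))"
  shows "p = q"
proof (rule ccontr)
  assume "p \<noteq> q"
  then have "finite {x. poly (p - q) x = 0}" by (intro poly_roots_finite) simp
  moreover have "range (\<lambda>t. int (Suc t)) \<subseteq> {x. poly (p - q) x = 0}" using assms by auto
  moreover have "infinite (range (\<lambda>t. int (Suc t)))"
    by (intro range_inj_infinite) (auto simp: inj_def)
  ultimately show False using finite_subset by blast
qed

text \<open>Adding or removing a fixed element \<open>x\<close> pairs off the subsets with opposite
  signs.\<close>

lemma sum_alternating_Pow:
  assumes "finite S" "S \<noteq> {}"
  shows "(\<Sum>A\<in>Pow S. (-1::int) ^ card A) = 0"
proof -
  obtain x where x: "x \<in> S" using assms(2) by blast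
  define T where "T = S - {x}"
  have S: "S = insert x T" "x \<notin> T" "finite T" using x assms T_def by auto
  have "(\<Sum>A\<in>Pow S. (-1::int) ^ card A) = (\<Sum>A\<in>Pow T. (-1) ^ card A) + (\<Sum>A\<in>insert x ` Pow T. (-1) ^ card A)"
    unfolding S(1) Pow_insert using S by (intro sum.union_disjoint) auto
  also have "(\<Sum>A\<in>insert x ` Pow T. (-1::int) ^ card A) = (\<Sum>A\<in>Pow T. (-1) ^ card (insert x A))"
    using S by (intro sum.reindex[unfolded comp_def]) (auto simp: inj_on_def)
  also have "\<dots> = (\<Sum>A\<in>Pow T. - ((-1) ^ card A))"
  proof (intro sum.cong refl)
    fix A assume "A \<in> Pow T"
    then have "x \<notin> A" "finite A" using S finite_subset by auto
    then show "(-1::int) ^ card (insert x A) = - ((-1) ^ card A)" by simp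
  qed
  finally show ?thesis by (simp add: sum_negf)
qed

section \<open>Colorings of induced subgraphs, with \<open>H\<close> fixed and the vertex set
  varying\<close>

locale finite_graph =
  fixes V :: "nat set" and H :: "nat set set"
  assumes finite_V: "finite V"
    and edges: "H \<subseteq> {{i, j} | i j. i \<in> V \<and> j \<in> V \<and> i \<noteq> j}"
begin

lemma adjD: "{i, j} \<in> H \<Longrightarrow> i \<in> V \<and> j \<in> V \<and> i \<noteq> j"
  using edges by (force simp: doubleton_eq_iff)

lemma adj_sym: "{i, j} \<in> H \<longleftrightarrow> {j, i} \<in> H"
  by (simp add: insert_commute)

lemma not_loop [simp]: "{i} \<notin> H"
  using adjD[of i i] by auto

definition stable :: "nat set \<Rightarrow> bool" where
  "stable A \<longleftrightarrow> (\<forall>i\<in>A. \<forall>j\<in>A. {i, j} \<notin> H)"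

definition colorings :: "nat set \<Rightarrow> nat \<Rightarrow> (nat \<Rightarrow> nat) set" where
  "colorings U t = {c \<in> U \<rightarrow>\<^sub>E {0..<t}. \<forall>i\<in>U. \<forall>j\<in>U. {i, j} \<in> H \<longrightarrow> c i \<noteq> c j}"

lemma chrom_count_eq: "chrom_count V H t = card (colorings V t)"
proof -
  have "(\<forall>e\<in>H. \<forall>i\<in>e. \<forall>j\<in>e. i \<noteq> j \<longrightarrow> c i \<noteq> c j) \<longleftrightarrow>
        (\<forall>i\<in>V. \<forall>j\<in>V. {i, j} \<in> H \<longrightarrow> c i \<noteq> c j)" for c :: "nat \<Rightarrow> nat"
  proof
    assume L: "\<forall>e\<in>H. \<forall>i\<in>e. \<forall>j\<in>e. i \<noteq> j \<longrightarrow> c i \<noteq> c j"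
    show "\<forall>i\<in>V. \<forall>j\<in>V. {i, j} \<in> H \<longrightarrow> c i \<noteq> c j"
      using L adjD by (meson insertI1 insertI2)
  next
    assume R: "\<forall>i\<in>V. \<forall>j\<in>V. {i, j} \<in> H \<longrightarrow> c i \<noteq> c j"
    show "\<forall>e\<in>H. \<forall>i\<in>e. \<forall>j\<in>e. i \<noteq> j \<longrightarrow> c i \<noteq> c j"
    proof (intro ballI impI)
      fix e i j assume e: "e \<in> H" "i \<in> e" "j \<in> e" "i \<noteq> j"
      then obtain p q where "e = {p, q}" using edges by blast
      then have "e = {i, j}" using e by auto
      then show "c i \<noteq> c j" using R e adjD by blast
    qed
  qed
  then show ?thesis unfolding chrom_count_def colorings_def by simp
qed

lemma finite_colorings: "finite U \<Longrightarrow> finite (colorings U t)"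
  unfolding colorings_def by (rule finite_subset[OF _ finite_PiE[of U "\<lambda>_. {0..<t}"]]) auto

text \<open>Erasing the class \<open>A\<close> of the top color \<open>t\<close> leaves a coloring
  of \<open>U - A\<close> with \<open>t\<close> colors; stability of \<open>A\<close> allows the
  reverse step.\<close>

lemma card_colorings_fixed_class:
  assumes "A \<subseteq> U" "stable A"
  shows "card {c \<in> colorings U (Suc t). {i \<in> U. c i = t} = A} = card (colorings (U - A) t)"
proof -
  have "bij_betw (\<lambda>c. restrict c (U - A)) {c \<in> colorings U (Suc t). {i \<in> U. c i = t} = A}
          (colorings (U - A) t)"
  proof (rule bij_betw_byWitness[where f' = "\<lambda>c i. if i \<in> A then t else c i"])
    show "\<forall>c\<in>{c \<in> colorings U (Suc t). {i \<in> U. c i = t} = A}.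
            (\<lambda>i. if i \<in> A then t else restrict c (U - A) i) = c"
      unfolding colorings_def by (auto simp: fun_eq_iff PiE_def extensional_def)
    show "\<forall>c\<in>colorings (U - A) t. restrict (\<lambda>i. if i \<in> A then t else c i) (U - A) = c"
      unfolding colorings_def by (auto simp: fun_eq_iff PiE_def extensional_def)
    show "(\<lambda>c. restrict c (U - A)) ` {c \<in> colorings U (Suc t). {i \<in> U. c i = t} = A} \<subseteq> colorings (U - A) t"
      unfolding colorings_def by (auto simp: PiE_def Pi_def less_Suc_eq)
    show "(\<lambda>c i. if i \<in> A then t else c i) ` colorings (U - A) t
            \<subseteq> {c \<in> colorings U (Suc t). {i \<in> U. c i = t} = A}"
    proof (rule image_subsetI)
      fix c assume c: "c \<in> colorings (U - A) t"
      let ?d = "\<lambda>i. if i \<in> A then t else c i"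
      have lt: "c i < t" if "i \<in> U" "i \<notin> A" for i
        using c that unfolding colorings_def by (auto simp: PiE_def Pi_def)
      have "?d i \<noteq> ?d j" if "i \<in> U" "j \<in> U" "{i, j} \<in> H" for i j
        using c lt[of i] lt[of j] that assms(2) unfolding colorings_def stable_def by auto
      moreover have "?d \<in> U \<rightarrow>\<^sub>E {0..<Suc t}"
        using c assms(1) lt unfolding colorings_def
        by (auto simp: PiE_def Pi_def extensional_def less_Suc_eq)
      moreover have "{i \<in> U. ?d i = t} = A"
        using assms(1) lt by force
      ultimately show "?d \<in> {c \<in> colorings U (Suc t). {i \<in> U. c i = t} = A}"
        unfolding colorings_def by simp
    qed
  qed
  then show ?thesis by (rule bij_betw_same_card)
qed

lemma stable_color_class:
  "c \<in> colorings U t \<Longrightarrow> stable {i \<in> U. c i = k}"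
  unfolding colorings_def stable_def by clarsimp metis

text \<open>\<open>Q\<close> serves two recursions: over all stable sets, and over those containing
  a given vertex.\<close>

lemma card_colorings_pred:
  assumes "finite U"
  shows "card {c \<in> colorings U (Suc t). Q {i \<in> U. c i = t}} =
    (\<Sum>A | A \<subseteq> U \<and> stable A \<and> Q A. card (colorings (U - A) t))"
proof -
  let ?S = "{c \<in> colorings U (Suc t). Q {i \<in> U. c i = t}}"
  let ?T = "{A. A \<subseteq> U \<and> stable A \<and> Q A}"
  have fin: "finite ?S" "finite ?T" using assms finite_colorings by auto
  have "(\<lambda>c. {i \<in> U. c i = t}) ` ?S \<subseteq> ?T" using stable_color_class by blast
  then have "card ?S = (\<Sum>A\<in>?T. \<Sum>c\<in>{c \<in> ?S. {i \<in> U. c i = t} = A}. 1)"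
    using sum.group[OF fin, of "\<lambda>c. {i \<in> U. c i = t}" "\<lambda>_. 1::nat"] by simp
  also have "\<dots> = (\<Sum>A\<in>?T. card (colorings (U - A) t))"
  proof (rule sum.cong[OF refl])
    fix A assume A: "A \<in> ?T"
    then have "{c \<in> ?S. {i \<in> U. c i = t} = A} = {c \<in> colorings U (Suc t). {i \<in> U. c i = t} = A}" by auto
    then show "(\<Sum>c\<in>{c \<in> ?S. {i \<in> U. c i = t} = A}. 1) = card (colorings (U - A) t)"
      using card_colorings_fixed_class A by simp
  qed
  finally show ?thesis .
qed

lemma card_colorings_Suc:
  "finite U \<Longrightarrow> card (colorings U (Suc t)) = (\<Sum>A | A \<subseteq> U \<and> stable A. card (colorings (U - A) t))"
  using card_colorings_pred[of U t "\<lambda>_. True"] by simp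

text \<open>Exchanging the colors \<open>k\<close> and \<open>t\<close> is a bijection.\<close>

lemma card_colorings_fixed_color:
  assumes "u \<in> U" "k \<le> t"
  shows "card {c \<in> colorings U (Suc t). c u = k} = card {c \<in> colorings U (Suc t). c u = t}"
proof -
  define \<tau> where "\<tau> x = (if x = k then t else if x = t then k else x)" for x
  have \<tau>: "\<tau> (\<tau> x) = x" "x < Suc t \<Longrightarrow> \<tau> x < Suc t" "\<tau> x = \<tau> y \<longleftrightarrow> x = y" for x y
    unfolding \<tau>_def using assms by auto
  have ev: "\<tau> k = t" "\<tau> t = k" unfolding \<tau>_def by auto
  let ?T = "\<lambda>c. restrict (\<lambda>i. \<tau> (c i)) U"
  have T: "?T c \<in> colorings U (Suc t)" "?T (?T c) = c" if "c \<in> colorings U (Suc t)" for c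
    using that \<tau> unfolding colorings_def by (auto simp: PiE_def Pi_def extensional_def fun_eq_iff)
  have "bij_betw ?T {c \<in> colorings U (Suc t). c u = k} {c \<in> colorings U (Suc t). c u = t}"
    by (rule bij_betw_byWitness[where f' = ?T]) (use T ev assms(1) in auto)
  then show ?thesis by (rule bij_betw_same_card)
qed

text \<open>Each of the \<open>Suc t\<close> colors occurs equally often at \<open>u\<close>, so
  \<open>u\<close> may be assumed to have the top color. The factor \<open>Suc t\<close> is what
  makes \<open>cpoly\<close> divisible by its variable.\<close>

lemma card_colorings_Suc_vertex:
  assumes "finite U" "u \<in> U"
  shows "card (colorings U (Suc t)) = Suc t * (\<Sum>A | A \<subseteq> U \<and> u \<in> A \<and> stable A. card (colorings (U - A) t))"
proof -
  have "(\<lambda>c. c u) ` colorings U (Suc t) \<subseteq> {..t}"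
    using assms(2) unfolding colorings_def by (auto simp: PiE_def Pi_def less_Suc_eq_le)
  then have "card (colorings U (Suc t)) = (\<Sum>k\<in>{..t}. \<Sum>c\<in>{c \<in> colorings U (Suc t). c u = k}. 1)"
    using sum.group[OF finite_colorings[OF assms(1)], of "{..t}" "\<lambda>c. c u" "Suc t" "\<lambda>_. 1::nat"]
    by simp
  also have "\<dots> = (\<Sum>k\<in>{..t}. card {c \<in> colorings U (Suc t). c u = t})"
    unfolding card_eq_sum[symmetric] by (intro sum.cong refl card_colorings_fixed_color assms(2)) simp
  also have "{c \<in> colorings U (Suc t). c u = t} = {c \<in> colorings U (Suc t). u \<in> {i \<in> U. c i = t}}"
    using assms(2) by auto
  finally show ?thesis
    using card_colorings_pred[OF assms(1), of t "\<lambda>A. u \<in> A"] by (simp add: conj_commute)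
qed

definition cpoly :: "nat set \<Rightarrow> int poly" where
  "cpoly U = (SOME p. \<forall>t. poly p (int t) = int (card (colorings U t)))"

text \<open>The vertex recursion produces the polynomial: \<open>[:0, 1:]\<close> accounts for the
  factor \<open>Suc t\<close>, and composition with \<open>[:-1, 1:]\<close> for having one color
  fewer. Every \<open>A\<close> contains \<open>u\<close>, so \<open>U - A\<close> is
  smaller.\<close>

lemma cpoly_exists:
  assumes "finite U"
  shows "\<exists>p. \<forall>t. poly p (int t) = int (card (colorings U t))"
  using assms
proof (induction "card U" arbitrary: U rule: less_induct)
  case less
  show ?case
  proof (cases "U = {}")
    case True
    then have "colorings U t = {\<lambda>_. undefined}" for t
      unfolding colorings_def by auto
    then show ?thesis by (intro exI[of _ 1]) simp
  next
    case False
    then obtain u where u: "u \<in> U" by blast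
    let ?S = "{A. A \<subseteq> U \<and> u \<in> A \<and> stable A}"
    have "\<forall>A\<in>?S. \<exists>p. \<forall>t. poly p (int t) = int (card (colorings (U - A) t))"
    proof
      fix A assume "A \<in> ?S"
      then have "U - A \<subset> U" using u by blast
      then show "\<exists>p. \<forall>t. poly p (int t) = int (card (colorings (U - A) t))"
        using less by (meson finite_Diff psubset_card_mono)
    qed
    then obtain q where q: "\<And>A t. A \<in> ?S \<Longrightarrow> poly (q A) (int t) = int (card (colorings (U - A) t))"
      by (metis (no_types, lifting))
    let ?p = "[:0, 1:] * (\<Sum>A\<in>?S. pcompose (q A) [:-1, 1:])"
    have "poly ?p (int t) = int (card (colorings U t))" for t
    proof (cases t)
      case 0
      have "colorings U 0 = {}" using u unfolding colorings_def by auto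
      then show ?thesis using 0 by simp
    next
      case (Suc t')
      have "poly ?p (int t) = int t * (\<Sum>A\<in>?S. poly (q A) (int t'))"
        using Suc by (simp add: poly_sum poly_pcompose)
      also have "(\<Sum>A\<in>?S. poly (q A) (int t')) = int (\<Sum>A\<in>?S. card (colorings (U - A) t'))"
        using q by simp
      finally show ?thesis
        unfolding Suc card_colorings_Suc_vertex[OF less.prems u] by (simp add: algebra_simps)
    qed
    then show ?thesis by blast
  qed
qed

lemma poly_cpoly: "finite U \<Longrightarrow> poly (cpoly U) (int t) = int (card (colorings U t))"
  using someI_ex[OF cpoly_exists] unfolding cpoly_def by blast

lemma chrom_poly_eq: "chrom_poly V H = cpoly V"
  unfolding chrom_poly_def
proof (rule the_equality)
  show "\<forall>t. poly (cpoly V) (int t) = int (chrom_count V H t)"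
    using poly_cpoly[OF finite_V] chrom_count_eq by simp
  fix p assume "\<forall>t. poly p (int t) = int (chrom_count V H t)"
  then show "p = cpoly V"
    using poly_cpoly[OF finite_V] chrom_count_eq by (intro poly_eqI_nat) (simp del: of_nat_Suc)
qed

text \<open>The chromatic polynomial divided by its variable; it counts the colorings in which \<^term>\<open>b\<close> has a prescribed color.\<close>
definition rpoly :: "nat \<Rightarrow> nat set \<Rightarrow> int poly" where
  "rpoly b U = (\<Sum>A | A \<subseteq> U \<and> b \<in> A \<and> stable A. pcompose (cpoly (U - A)) [:-1, 1:])"

lemma cpoly_rpoly:
  assumes "finite U" "b \<in> U"
  shows "cpoly U = [:0, 1:] * rpoly b U"
proof (rule poly_eqI_nat)
  fix t
  have "poly (rpoly b U) (int (Suc t)) = (\<Sum>A | A \<subseteq> U \<and> b \<in> A \<and> stable A. poly (cpoly (U - A)) (int t))"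
    unfolding rpoly_def by (simp add: poly_sum poly_pcompose)
  also have "\<dots> = int (\<Sum>A | A \<subseteq> U \<and> b \<in> A \<and> stable A. card (colorings (U - A) t))"
    using poly_cpoly assms(1) by simp
  finally show "poly (cpoly U) (int (Suc t)) = poly ([:0, 1:] * rpoly b U) (int (Suc t))"
    unfolding poly_cpoly[OF assms(1)] card_colorings_Suc_vertex[OF assms] by (simp add: algebra_simps)
qed

lemma cpoly_rec:
  assumes "finite U"
  shows "cpoly U = (\<Sum>A | A \<subseteq> U \<and> stable A. pcompose (cpoly (U - A)) [:-1, 1:])"
proof (rule poly_eqI_nat)
  fix t
  have "poly (\<Sum>A | A \<subseteq> U \<and> stable A. pcompose (cpoly (U - A)) [:-1, 1:]) (int (Suc t)) =
      (\<Sum>A | A \<subseteq> U \<and> stable A. poly (cpoly (U - A)) (int t))"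
    by (simp add: poly_sum poly_pcompose)
  also have "\<dots> = int (\<Sum>A | A \<subseteq> U \<and> stable A. card (colorings (U - A) t))"
    using poly_cpoly assms(1) by simp
  finally show "poly (cpoly U) (int (Suc t)) =
      poly (\<Sum>A | A \<subseteq> U \<and> stable A. pcompose (cpoly (U - A)) [:-1, 1:]) (int (Suc t))"
    unfolding poly_cpoly[OF assms] card_colorings_Suc[OF assms] by simp
qed

lemma pcompose_cpoly:
  "finite U \<Longrightarrow> b \<in> U \<Longrightarrow> pcompose (cpoly U) [:-1, 1:] = [:-1, 1:] * pcompose (rpoly b U) [:-1, 1:]"
  unfolding cpoly_rpoly pcompose_mult by (simp add: pcompose_pCons)

text \<open>In \<open>cpoly_rec\<close> the classes containing \<open>b\<close> sum to
  \<open>rpoly b U\<close>. Moving them to the left leaves (t - 1) times \<open>rpoly b U\<close>;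
  each remaining summand also has the factor t - 1, which cancels.\<close>

lemma rpoly_rec:
  assumes "finite U" "b \<in> U"
  shows "rpoly b U = (\<Sum>A | A \<subseteq> U - {b} \<and> stable A. pcompose (rpoly b (U - A)) [:-1, 1:])"
proof -
  let ?f = "\<lambda>A. pcompose (cpoly (U - A)) [:-1, 1:]"
  have "cpoly U = (\<Sum>A \<in> {A. A \<subseteq> U \<and> b \<in> A \<and> stable A} \<union> {A. A \<subseteq> U - {b} \<and> stable A}. ?f A)"
    unfolding cpoly_rec[OF assms(1)] by (rule sum.cong) auto
  also have "\<dots> = rpoly b U + (\<Sum>A | A \<subseteq> U - {b} \<and> stable A. ?f A)"
    unfolding rpoly_def using assms by (intro sum.union_disjoint) auto
  also have "(\<Sum>A | A \<subseteq> U - {b} \<and> stable A. ?f A) =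
      (\<Sum>A | A \<subseteq> U - {b} \<and> stable A. [:-1, 1:] * pcompose (rpoly b (U - A)) [:-1, 1:])"
    using assms by (intro sum.cong refl pcompose_cpoly) auto
  finally have "[:0, 1:] * rpoly b U - rpoly b U = 
      [:-1, 1:] * (\<Sum>A | A \<subseteq> U - {b} \<and> stable A. pcompose (rpoly b (U - A)) [:-1, 1:])"
    unfolding cpoly_rpoly[OF assms] by (simp add: sum_distrib_left)
  moreover have "[:0, 1:] * rpoly b U - rpoly b U = [:-1, 1:] * rpoly b U"
    by (simp add: poly_eq_poly_eq_iff[symmetric] fun_eq_iff algebra_simps)
  ultimately have "[:-1, 1:] * rpoly b U = [:-1, 1:] * (\<Sum>A | A \<subseteq> U - {b} \<and> stable A. pcompose (rpoly b (U - A)) [:-1, 1:])"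
    by simp
  then show ?thesis by (subst (asm) mult_cancel_left) simp
qed

text \<open>The recursion at t = 1: every summand is evaluated at 0, and \<open>rpoly\<close> agrees
  at 1 with \<open>cpoly\<close>, which there counts colorings with one color.\<close>

lemma sum_rpoly_0:
  assumes "finite U" "b \<in> U"
  shows "(\<Sum>A | A \<subseteq> U - {b} \<and> stable A. poly (rpoly b (U - A)) 0) = (if stable U then 1 else 0)"
proof -
  have "(\<Sum>A | A \<subseteq> U - {b} \<and> stable A. poly (rpoly b (U - A)) 0) = poly (rpoly b U) 1"
    by (subst rpoly_rec[OF assms]) (simp add: poly_sum poly_pcompose)
  also have "\<dots> = poly (cpoly U) (int 1)"
    unfolding cpoly_rpoly[OF assms] by simp
  also have "\<dots> = int (card (colorings U 1))" using poly_cpoly[OF assms(1)] by blast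
  also have "colorings U 1 = (if stable U then {restrict (\<lambda>_. 0) U} else {})"
  proof -
    have "c \<in> U \<rightarrow>\<^sub>E {0..<1} \<longleftrightarrow> c = restrict (\<lambda>_. 0) U" for c :: "nat \<Rightarrow> nat"
      by (auto simp: PiE_def Pi_def extensional_def fun_eq_iff)
    then show ?thesis unfolding colorings_def stable_def by auto
  qed
  finally show ?thesis by simp
qed

section \<open>Acyclic orientations, sources and sinks\<close>

definition arcs :: "nat set \<Rightarrow> (nat \<Rightarrow> real) \<Rightarrow> (nat \<times> nat) set" where
  "arcs U h = {(i, j). i \<in> U \<and> j \<in> U \<and> {i, j} \<in> H \<and> h i < h j}"

text \<open>Acyclic orientations, each given by a height function.\<close>
definition orients :: "nat set \<Rightarrow> (nat \<times> nat) set set" where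
  "orients U = {arcs U h | h. \<forall>i\<in>U. \<forall>j\<in>U. {i, j} \<in> H \<longrightarrow> h i \<noteq> h j}"

definition sources :: "nat set \<Rightarrow> (nat \<times> nat) set \<Rightarrow> nat set" where
  "sources U ori = {v \<in> U. \<forall>u. (u, v) \<notin> ori}"

text \<open>Only \<open>b\<close> is allowed to be a sink. As an acyclic orientation of a finite
  nonempty set has a sink, \<open>b\<close> is then the unique one; the same applies to the source
  \<open>a\<close> in \<open>bipolar\<close>.\<close>

definition sink_orients :: "nat \<Rightarrow> nat set \<Rightarrow> (nat \<times> nat) set set" where
  "sink_orients b U = {ori \<in> orients U. \<forall>v\<in>U - {b}. \<exists>w. (v, w) \<in> ori}"

definition bipolar :: "nat \<Rightarrow> nat \<Rightarrow> (nat \<times> nat) set set" where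
  "bipolar a b = {ori \<in> sink_orients b V. \<forall>v\<in>V - {a}. \<exists>u. (u, v) \<in> ori}"

lemma finite_orients: "finite U \<Longrightarrow> finite (orients U)"
  by (rule finite_subset[of _ "Pow (U \<times> U)"]) (auto simp: orients_def arcs_def)

lemma finite_sink_orients: "finite U \<Longrightarrow> finite (sink_orients b U)"
  using finite_orients unfolding sink_orients_def by simp

lemma stable_sources:
  assumes "ori \<in> orients U"
  shows "stable (sources U ori)"
  unfolding stable_def
proof (intro ballI notI)
  fix i j assume ij: "i \<in> sources U ori" "j \<in> sources U ori" "{i, j} \<in> H"
  obtain h where h: "ori = arcs U h" "\<forall>i\<in>U. \<forall>j\<in>U. {i, j} \<in> H \<longrightarrow> h i \<noteq> h j"
    using assms unfolding orients_def by blast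
  have "i \<in> U" "j \<in> U" using ij unfolding sources_def by auto
  then have "(i, j) \<in> ori \<or> (j, i) \<in> ori"
    using h ij(3) adj_sym[of i j] unfolding arcs_def by (auto simp: not_less_iff_gr_or_eq)
  then show False using ij unfolding sources_def by blast
qed

lemma ex_source:
  assumes "finite U" "U \<noteq> {}" "ori \<in> orients U"
  shows "sources U ori \<noteq> {}"
proof -
  obtain h where h: "ori = arcs U h" using assms(3) unfolding orients_def by blast
  have "arg_min_on h U \<in> U" "\<not> (\<exists>x\<in>U. h x < h (arg_min_on h U))"
    using arg_min_if_finite[OF assms(1,2)] by blast+
  then have "arg_min_on h U \<in> sources U ori"
    unfolding sources_def h arcs_def by auto
  then show ?thesis by blast
qed

text \<open>The highest vertex other than \<open>b\<close> has an outgoing arc, which can only end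
  in \<open>b\<close>.\<close>

lemma sink_not_source:
  assumes "finite U" "b \<in> U" "U \<noteq> {b}" "ori \<in> sink_orients b U"
  shows "b \<notin> sources U ori"
proof -
  obtain h where h: "ori = arcs U h" using assms(4) unfolding sink_orients_def orients_def by blast
  have "finite (U - {b})" "U - {b} \<noteq> {}" using assms by auto
  note am = arg_min_if_finite[OF this, of "\<lambda>v. - h v"]
  define v where "v = arg_min_on (\<lambda>v. - h v) (U - {b})"
  have v: "v \<in> U - {b}" "\<not> (\<exists>x\<in>U - {b}. h v < h x)" using am v_def by auto
  obtain w where w: "(v, w) \<in> ori" using assms(4) v(1) unfolding sink_orients_def by blast
  then have "w \<in> U" "h v < h w" unfolding h arcs_def by auto
  with v(2) have "w = b" by blast
  then show ?thesis using w unfolding sources_def by blast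
qed

text \<open>Sources are removed by restriction and put back by directing all edges at
  \<open>A\<close> outward. Stability makes this consistent, and \<open>iso\<close> gives every
  vertex of \<open>A\<close> an outgoing arc, so that no second sink appears.\<close>

lemma card_sink_orients_remove:
  assumes U: "finite U" "A \<subseteq> U - {b}" "stable A" and iso: "\<forall>v\<in>U - {b}. \<exists>u\<in>U. {v, u} \<in> H"
  shows "card {ori \<in> sink_orients b U. A \<subseteq> sources U ori} = card (sink_orients b (U - A))"
proof -
  let ?W = "U - A"
  let ?f = "\<lambda>ori. ori \<inter> (?W \<times> ?W)"
  let ?N = "{(v, w). v \<in> A \<and> w \<in> ?W \<and> {v, w} \<in> H}"
  let ?X = "{ori \<in> sink_orients b U. A \<subseteq> sources U ori}"
  have "bij_betw ?f ?X (sink_orients b ?W)"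
  proof (rule bij_betw_byWitness[where f' = "\<lambda>ori. ori \<union> ?N"])
    show "\<forall>ori\<in>?X. ?f ori \<union> ?N = ori"
    proof
      fix ori assume "ori \<in> ?X"
      then have ori: "ori \<in> sink_orients b U" "A \<subseteq> sources U ori" by auto
      then obtain h where h: "ori = arcs U h" "\<forall>i\<in>U. \<forall>j\<in>U. {i, j} \<in> H \<longrightarrow> h i \<noteq> h j"
        unfolding sink_orients_def orients_def by blast
      have "(v, w) \<in> ori" if "v \<in> A" "w \<in> ?W" "{v, w} \<in> H" for v w
      proof -
        have "(w, v) \<notin> ori" using ori(2) that unfolding sources_def by blast
        moreover have "v \<in> U" "w \<in> U" using that U(2) by auto
        moreover have "{w, v} \<in> H" using that(3) adj_sym by blast
        ultimately show ?thesis using h that(3) unfolding arcs_def by (auto simp: not_less_iff_gr_or_eq)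
      qed
      moreover have "(v, w) \<in> ?f ori \<union> ?N" if "(v, w) \<in> ori" for v w
      proof -
        have "w \<notin> A" using ori(2) that unfolding sources_def by blast
        then show ?thesis using that unfolding h arcs_def by auto
      qed
      ultimately show "?f ori \<union> ?N = ori" by auto
    qed
    show "\<forall>ori\<in>sink_orients b ?W. ?f (ori \<union> ?N) = ori"
      unfolding sink_orients_def orients_def arcs_def by auto
    show "?f ` ?X \<subseteq> sink_orients b ?W"
    proof (rule image_subsetI)
      fix ori assume "ori \<in> ?X"
      then have ori: "ori \<in> sink_orients b U" "A \<subseteq> sources U ori" by auto
      then obtain h where h: "ori = arcs U h" "\<forall>i\<in>U. \<forall>j\<in>U. {i, j} \<in> H \<longrightarrow> h i \<noteq> h j"
        unfolding sink_orients_def orients_def by blast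
      have eq: "?f ori = arcs ?W h" unfolding h arcs_def by auto
      have "\<exists>w. (v, w) \<in> ?f ori" if "v \<in> ?W - {b}" for v
      proof -
        obtain w where w: "(v, w) \<in> ori" using ori(1) \<open>v \<in> ?W - {b}\<close> unfolding sink_orients_def by blast
        then have "w \<notin> A" "w \<in> U" using ori(2) unfolding sources_def h arcs_def by auto
        then show ?thesis using w that by blast
      qed
      then show "?f ori \<in> sink_orients b ?W"
        using h(2) eq unfolding sink_orients_def orients_def by auto
    qed
    show "(\<lambda>ori. ori \<union> ?N) ` sink_orients b ?W \<subseteq> ?X"
    proof (rule image_subsetI)
      fix ori assume ori: "ori \<in> sink_orients b ?W"
      then obtain h where h: "ori = arcs ?W h" "\<forall>i\<in>?W. \<forall>j\<in>?W. {i, j} \<in> H \<longrightarrow> h i \<noteq> h j"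
        unfolding sink_orients_def orients_def by blast
      \<comment> \<open>A height below all others puts \<open>A\<close> at the bottom, which keeps
        the orientation acyclic.\<close>
      obtain m where m: "\<forall>i\<in>U. m < h i"
      proof -
        have "Min (insert 0 (h ` U)) - 1 < h i" if "i \<in> U" for i
        proof -
          have "Min (insert 0 (h ` U)) \<le> h i" using U(1) that by (intro Min_le) auto
          then show ?thesis by linarith
        qed
        then show thesis using that by blast
      qed
      define h' where "h' i = (if i \<in> A then m else h i)" for i
      have AU: "A \<subseteq> U" using U(2) by blast
      have nA: "{i, j} \<notin> H" if "i \<in> A" "j \<in> A" for i j
        using U(3) that unfolding stable_def by blast
      have "ori \<union> ?N = arcs U h'"
      proof (intro set_eqI, clarify)
        fix i j
        show "(i, j) \<in> ori \<union> ?N \<longleftrightarrow> (i, j) \<in> arcs U h'"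
          using AU nA[of i j] m unfolding h(1) arcs_def h'_def by (cases "i \<in> A"; cases "j \<in> A") (auto dest: less_asym)
      qed
      moreover have "h' i \<noteq> h' j" if "i \<in> U" "j \<in> U" "{i, j} \<in> H" for i j
        using h(2) m nA[of i j] that unfolding h'_def by (cases "i \<in> A"; cases "j \<in> A") force+
      ultimately have "ori \<union> ?N \<in> orients U" unfolding orients_def by blast
      moreover have "\<exists>w. (v, w) \<in> ori \<union> ?N" if v: "v \<in> U - {b}" for v
      proof (cases "v \<in> A")
        case True
        obtain u where "u \<in> U" "{v, u} \<in> H" using iso v by blast
        then show ?thesis using True nA[of v u] by auto
      next
        case False
        then show ?thesis using ori v unfolding sink_orients_def by blast
      qed
      moreover have "A \<subseteq> sources U (ori \<union> ?N)"
        using AU unfolding sources_def h(1) arcs_def by auto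
      ultimately show "ori \<union> ?N \<in> ?X" unfolding sink_orients_def by blast
    qed
  qed
  then show ?thesis by (rule bij_betw_same_card)
qed

text \<open>Double counting of pairs of an orientation and a set of its sources. Every such set is
  stable and avoids \<open>b\<close>, so apart from \<open>Q\<close> the inner sum is
  unrestricted.\<close>

lemma sum_sink_orients:
  assumes U: "finite U" "b \<in> U" "U \<noteq> {b}" and iso: "\<forall>v\<in>U - {b}. \<exists>u\<in>U. {v, u} \<in> H"
  shows "(\<Sum>A | A \<subseteq> U - {b} \<and> stable A \<and> Q A. (-1::int) ^ card A * int (card (sink_orients b (U - A)))) =
    (\<Sum>ori\<in>sink_orients b U. \<Sum>A | A \<subseteq> sources U ori \<and> Q A. (-1) ^ card A)"
proof -
  let ?T = "{A. A \<subseteq> U - {b} \<and> stable A \<and> Q A}"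
  have finT: "finite ?T" using U by simp
  have "(\<Sum>A\<in>?T. (-1::int) ^ card A * int (card (sink_orients b (U - A)))) =
    (\<Sum>A\<in>?T. \<Sum>ori\<in>{ori \<in> sink_orients b U. A \<subseteq> sources U ori}. (-1) ^ card A)"
    using card_sink_orients_remove[OF U(1) _ _ iso] by (intro sum.cong) auto
  also have "\<dots> = (\<Sum>ori\<in>sink_orients b U. \<Sum>A\<in>{A \<in> ?T. A \<subseteq> sources U ori}. (-1) ^ card A)"
    by (rule sum.swap_restrict[OF finT finite_sink_orients[OF U(1)]])
  also have "\<dots> = (\<Sum>ori\<in>sink_orients b U. \<Sum>A | A \<subseteq> sources U ori \<and> Q A. (-1) ^ card A)"
  proof (intro sum.cong refl)
    fix ori A assume ori: "ori \<in> sink_orients b U"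
    have "stable (sources U ori)" using ori stable_sources unfolding sink_orients_def by blast
    moreover have "sources U ori \<subseteq> U - {b}" using sink_not_source[OF U ori] unfolding sources_def by auto
    ultimately show "{A \<in> ?T. A \<subseteq> sources U ori} = {A. A \<subseteq> sources U ori \<and> Q A}"
      unfolding stable_def by blast
  qed
  finally show ?thesis .
qed

lemma finite_sources: "finite U \<Longrightarrow> finite (sources U ori)"
  unfolding sources_def by simp

lemma alternating_sum_sink_orients:
  assumes U: "finite U" "b \<in> U" "U \<noteq> {b}" and iso: "\<forall>v\<in>U - {b}. \<exists>u\<in>U. {v, u} \<in> H"
  shows "(\<Sum>A | A \<subseteq> U - {b} \<and> stable A. (-1::int) ^ card A * int (card (sink_orients b (U - A)))) = 0"
proof -
  have "(\<Sum>A | A \<subseteq> sources U ori. (-1::int) ^ card A) = 0" if "ori \<in> sink_orients b U" for ori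
    using sum_alternating_Pow[OF finite_sources[OF U(1)] ex_source[OF U(1)]] that U
    unfolding sink_orients_def Pow_def by blast
  then show ?thesis using sum_sink_orients[OF assms, of "\<lambda>_. True"] by simp
qed

text \<open>Among the subsets of the sources that contain \<open>a\<close>, the signs cancel unless
  \<open>a\<close> is the only source, where the single set \<open>{a}\<close> contributes
  -1.\<close>

lemma alternating_sum_bipolar:
  assumes "a \<in> V" "b \<in> V" "a \<noteq> b" and iso: "\<forall>v\<in>V - {b}. \<exists>u\<in>V. {v, u} \<in> H"
  shows "(\<Sum>A | A \<subseteq> V - {b} \<and> stable A \<and> a \<in> A. (-1::int) ^ card A * int (card (sink_orients b (V - A)))) =
    - int (card (bipolar a b))"
proof -
  have "(\<Sum>A | A \<subseteq> sources V ori \<and> a \<in> A. (-1::int) ^ card A) = (if ori \<in> bipolar a b then -1 else 0)"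
    if ori: "ori \<in> sink_orients b V" for ori
  proof -
    let ?S = "sources V ori - {a}"
    have fin: "finite ?S" using finite_sources[OF finite_V] by simp
    have ne: "sources V ori \<noteq> {}" using ori ex_source[OF finite_V] assms(1) unfolding sink_orients_def by blast
    have bip: "ori \<in> bipolar a b \<longleftrightarrow> ?S = {}"
      using ori unfolding bipolar_def sources_def by auto
    show ?thesis
    proof (cases "a \<in> sources V ori")
      case False
      then have "{A. A \<subseteq> sources V ori \<and> a \<in> A} = {}" by blast
      moreover have "?S \<noteq> {}" using False ne by blast
      ultimately show ?thesis using bip by (simp only: sum.empty if_False simp_thms)
    next
      case True
      have "{A. A \<subseteq> sources V ori \<and> a \<in> A} = insert a ` Pow ?S"
      proof (intro set_eqI iffI)
        fix A assume "A \<in> {A. A \<subseteq> sources V ori \<and> a \<in> A}"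
        then show "A \<in> insert a ` Pow ?S" by (intro image_eqI[of _ _ "A - {a}"]) auto
      qed (use True in auto)
      moreover have "inj_on (insert a) (Pow ?S)" unfolding inj_on_def by blast
      ultimately have "(\<Sum>A | A \<subseteq> sources V ori \<and> a \<in> A. (-1::int) ^ card A) = (\<Sum>A\<in>Pow ?S. (-1) ^ card (insert a A))"
        by (simp only: sum.reindex comp_def)
      also have "\<dots> = (\<Sum>A\<in>Pow ?S. - ((-1) ^ card A))"
      proof (intro sum.cong refl)
        fix A assume "A \<in> Pow ?S"
        then have "a \<notin> A" "finite A" using fin finite_subset by auto
        then show "(-1::int) ^ card (insert a A) = - ((-1) ^ card A)" by simp
      qed
      also have "\<dots> = (if ?S = {} then -1 else 0)"
        using sum_alternating_Pow[OF fin] by (cases "?S = {}") (simp_all only: sum_negf, simp_all)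
      finally show ?thesis using bip by simp
    qed
  qed
  then have "(\<Sum>A | A \<subseteq> V - {b} \<and> stable A \<and> a \<in> A. (-1::int) ^ card A * int (card (sink_orients b (V - A)))) =
      (\<Sum>ori\<in>sink_orients b V. if ori \<in> bipolar a b then -1 else 0)"
    using sum_sink_orients[OF finite_V assms(2) _ iso, of "\<lambda>A. a \<in> A"] assms by auto
  also have "\<dots> = (\<Sum>ori\<in>sink_orients b V \<inter> bipolar a b. -1)"
    by (rule sum.inter_restrict[symmetric, OF finite_sink_orients[OF finite_V]])
  also have "sink_orients b V \<inter> bipolar a b = bipolar a b" unfolding bipolar_def by auto
  finally show ?thesis by simp
qed

text \<open>An isolated vertex other than \<open>b\<close> can be colored freely, so a second factor
  t remains after one is removed. The proof uses \<open>sum_rpoly_0\<close>: the sets containing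
  \<open>v\<close> already sum to its right-hand side, so the others sum to 0, and by induction all
  of those but the empty set contribute 0.\<close>

lemma rpoly_0_isolated:
  assumes "finite U" "b \<in> U" "v \<in> U" "v \<noteq> b" "\<forall>u\<in>U. {v, u} \<notin> H"
  shows "poly (rpoly b U) 0 = 0"
  using assms
proof (induction "card U" arbitrary: U rule: less_induct)
  case less
  let ?S = "{A. A \<subseteq> U - {b} \<and> stable A}"
  let ?S' = "{A. A \<subseteq> (U - {v}) - {b} \<and> stable A}"
  let ?f = "\<lambda>A. poly (rpoly b (U - A)) 0"
  have fin: "finite ?S'" using less.prems by simp
  have v: "{v, u} \<notin> H" "{u, v} \<notin> H" if "u \<in> U" for u
    using less.prems(5) that adj_sym by auto
  have st: "stable (insert v A) \<longleftrightarrow> stable A" if "A \<subseteq> U" for A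
    using v that unfolding stable_def by (auto simp: subset_iff)
  have "?S = ?S' \<union> insert v ` ?S'"
  proof (intro set_eqI iffI)
    fix A assume A: "A \<in> ?S"
    show "A \<in> ?S' \<union> insert v ` ?S'"
    proof (cases "v \<in> A")
      case True
      then have "A = insert v (A - {v})" by blast
      moreover have "stable (A - {v})" using A unfolding stable_def by blast
      ultimately show ?thesis using A by blast
    qed (use A in auto)
  next
    fix A assume A: "A \<in> ?S' \<union> insert v ` ?S'"
    then consider "A \<in> ?S'" | B where "B \<in> ?S'" "A = insert v B" by blast
    then show "A \<in> ?S"
    proof cases
      case 2
      then have "B \<subseteq> U" by blast
      with 2 show ?thesis using st[of B] less.prems by auto
    qed auto
  qed
  then have "(\<Sum>A\<in>?S. ?f A) = (\<Sum>A\<in>?S'. ?f A) + (\<Sum>A\<in>insert v ` ?S'. ?f A)"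
    using fin by (simp only:) (intro sum.union_disjoint; auto)
  also have "(\<Sum>A\<in>insert v ` ?S'. ?f A) = (\<Sum>A\<in>?S'. ?f (insert v A))"
    by (intro sum.reindex[unfolded comp_def]) (auto simp: inj_on_def)
  also have "\<dots> = (\<Sum>A\<in>?S'. poly (rpoly b ((U - {v}) - A)) 0)"
    by (simp add: Diff_insert2[symmetric])
  also have "\<dots> = (if stable (U - {v}) then 1 else 0)"
    using less.prems by (intro sum_rpoly_0) auto
  also have "stable (U - {v}) \<longleftrightarrow> stable U"
    using st[of "U - {v}"] less.prems by (simp add: insert_absorb)
  finally have "(\<Sum>A\<in>?S'. ?f A) = 0"
    using sum_rpoly_0[OF less.prems(1,2)] by simp
  moreover have "(\<Sum>A\<in>?S'. ?f A) = ?f {} + (\<Sum>A\<in>?S' - {{}}. ?f A)"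
    using fin by (intro sum.remove) (auto simp: stable_def)
  moreover have "(\<Sum>A\<in>?S' - {{}}. ?f A) = 0"
  proof (intro sum.neutral ballI)
    fix A assume A: "A \<in> ?S' - {{}}"
    then have "U - A \<subset> U" by blast
    then have "card (U - A) < card U" using less.prems(1) psubset_card_mono by blast
    then show "?f A = 0" using less.prems A by (intro less.hyps) auto
  qed
  ultimately show ?case by simp
qed

text \<open>A theorem of Greene and Zaslavsky: the linear coefficient of the chromatic polynomial
  counts, up to sign, the acyclic orientations with unique sink \<open>b\<close>. If
  \<open>U\<close> is not \<open>{b}\<close> and no vertex other than \<open>b\<close> is isolated,
  both sides have vanishing sums over the stable sets avoiding \<open>b\<close>, and all terms but
  that of the empty set are known by induction.\<close>

lemma rpoly_0_sink_orients:
  assumes "finite U" "b \<in> U"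
  shows "poly (rpoly b U) 0 = (-1) ^ (card U + 1) * int (card (sink_orients b U))"
  using assms
proof (induction "card U" arbitrary: U rule: less_induct)
  case less
  show ?case
  proof (cases "U = {b}")
    case True
    have sub: "A \<subseteq> U - {b} \<longleftrightarrow> A = {}" for A using True by auto
    have st: "stable U" "stable {}" using True by (auto simp: stable_def)
    have "poly (rpoly b U) 0 = 1"
      using sum_rpoly_0[OF less.prems] st unfolding sub by (simp add: conj_commute cong: conj_cong)
    moreover have "sink_orients b U = {{}}"
      unfolding sink_orients_def orients_def arcs_def True by auto
    ultimately show ?thesis using True by simp
  next
    case nb: False
    show ?thesis
    proof (cases "\<forall>v\<in>U - {b}. \<exists>u\<in>U. {v, u} \<in> H")
      case False
      then obtain v where v: "v \<in> U" "v \<noteq> b" "\<forall>u\<in>U. {v, u} \<notin> H" by blast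
      then have "sink_orients b U = {}"
        unfolding sink_orients_def orients_def arcs_def by auto
      then show ?thesis using rpoly_0_isolated[OF less.prems v] by simp
    next
      case True
      let ?S = "{A. A \<subseteq> U - {b} \<and> stable A}"
      let ?f = "\<lambda>A. poly (rpoly b (U - A)) 0"
      let ?g = "\<lambda>A. (-1::int) ^ card A * int (card (sink_orients b (U - A)))"
      have fin: "finite ?S" and em: "{} \<in> ?S" using less.prems by (auto simp: stable_def)
      have "\<not> stable U" using True nb less.prems unfolding stable_def by blast
      then have "0 = (\<Sum>A\<in>?S. ?f A)" using sum_rpoly_0[OF less.prems] by simp
      also have "\<dots> = ?f {} + (\<Sum>A\<in>?S - {{}}. ?f A)" by (rule sum.remove[OF fin em])
      also have "(\<Sum>A\<in>?S - {{}}. ?f A) = (\<Sum>A\<in>?S - {{}}. (-1) ^ (card U + 1) * ?g A)"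
      proof (intro sum.cong refl)
        fix A assume A: "A \<in> ?S - {{}}"
        then have "U - A \<subset> U" by blast
        then have "card (U - A) < card U" using less.prems(1) psubset_card_mono by blast
        then have f: "?f A = (-1) ^ (card (U - A) + 1) * int (card (sink_orients b (U - A)))"
          using less.prems A by (intro less.hyps) auto
        have "A \<subseteq> U" using A by blast
        then have "card U = card (U - A) + card A"
          using less.prems(1) by (metis card_Diff_subset card_mono finite_subset le_add_diff_inverse2)
        then have "(-1::int) ^ (card U + 1) * (-1) ^ card A = (-1) ^ (card (U - A) + 1)"
          by (simp add: power_add flip: power_mult_distrib)
        then show "?f A = (-1) ^ (card U + 1) * ?g A" using f by (metis mult.assoc)
      qed
      also have "\<dots> = (-1) ^ (card U + 1) * ((\<Sum>A\<in>?S. ?g A) - ?g {})"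
        by (simp only: sum_distrib_left[symmetric] sum.remove[OF fin em]) simp
      also have "(\<Sum>A\<in>?S. ?g A) = 0"
        by (rule alternating_sum_sink_orients[OF less.prems nb True])
      finally show ?thesis by simp
    qed
  qed
qed

text \<open>Expand at \<open>a\<close>: a stable set containing \<open>a\<close> misses the adjacent
  vertex \<open>b\<close>, so each summand keeps \<open>b\<close> and has a factor t - 1 by
  \<open>pcompose_cpoly\<close>. At t = 1 the quotient is a sum of values at 0, known from
  orientations with sink \<open>b\<close>. Up to sign this is Crapo's beta invariant.\<close>

theorem chrom_poly_bipolar:
  assumes "{a, b} \<in> H" and iso: "\<forall>v\<in>V - {b}. \<exists>u\<in>V. {v, u} \<in> H"
  shows "[:-1, 1:] dvd chrom_poly V H"
    and "\<bar>poly (chrom_poly V H div [:-1, 1:]) 1\<bar> = int (card (bipolar a b))"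
proof -
  have ab: "a \<in> V" "b \<in> V" "a \<noteq> b" using adjD[OF assms(1)] by auto
  let ?S = "{A. A \<subseteq> V \<and> a \<in> A \<and> stable A}"
  have S: "?S = {A. A \<subseteq> V - {b} \<and> stable A \<and> a \<in> A}"
    using assms(1) unfolding stable_def by blast
  have "rpoly a V = (\<Sum>A\<in>?S. [:-1, 1:] * pcompose (rpoly b (V - A)) [:-1, 1:])"
    unfolding rpoly_def[of a] using finite_V ab S by (intro sum.cong refl pcompose_cpoly) auto
  then have eq: "chrom_poly V H = [:-1, 1:] * ([:0, 1:] * (\<Sum>A\<in>?S. pcompose (rpoly b (V - A)) [:-1, 1:]))"
    unfolding chrom_poly_eq cpoly_rpoly[OF finite_V ab(1)]
    by (simp only: sum_distrib_left[symmetric] mult.left_commute)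
  then show "[:-1, 1:] dvd chrom_poly V H" by (simp only: dvd_triv_left)
  have "chrom_poly V H div [:-1, 1:] = [:0, 1:] * (\<Sum>A\<in>?S. pcompose (rpoly b (V - A)) [:-1, 1:])"
    unfolding eq by (rule nonzero_mult_div_cancel_left) simp
  then have "poly (chrom_poly V H div [:-1, 1:]) 1 = (\<Sum>A\<in>?S. poly (rpoly b (V - A)) 0)"
    by (simp add: poly_sum poly_pcompose)
  also have "\<dots> = (\<Sum>A\<in>?S. (-1) ^ (card V + 1) * ((-1) ^ card A * int (card (sink_orients b (V - A)))))"
  proof (intro sum.cong refl)
    fix A assume A: "A \<in> ?S"
    then have "b \<in> V - A" using ab S by blast
    then have f: "poly (rpoly b (V - A)) 0 = (-1) ^ (card (V - A) + 1) * int (card (sink_orients b (V - A)))"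
      using finite_V by (intro rpoly_0_sink_orients) auto
    have "A \<subseteq> V" using A by blast
    then have "card V = card (V - A) + card A"
      using finite_V by (metis card_Diff_subset card_mono finite_subset le_add_diff_inverse2)
    then have "(-1::int) ^ (card V + 1) * (-1) ^ card A = (-1) ^ (card (V - A) + 1)"
      by (simp add: power_add flip: power_mult_distrib)
    then show "poly (rpoly b (V - A)) 0 = (-1) ^ (card V + 1) * ((-1) ^ card A * int (card (sink_orients b (V - A))))"
      using f by (metis mult.assoc)
  qed
  also have "\<dots> = (-1) ^ (card V + 1) * - int (card (bipolar a b))"
    unfolding S sum_distrib_left[symmetric] alternating_sum_bipolar[OF ab iso] ..
  finally show "\<bar>poly (chrom_poly V H div [:-1, 1:]) 1\<bar> = int (card (bipolar a b))"
    by (simp only: abs_mult power_abs) simp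
qed

end

section \<open>Critical points for positive weights\<close>

lemma convergent_subseq_finite:
  fixes X :: "nat \<Rightarrow> 'i \<Rightarrow> real"
  assumes "finite V" "\<And>k i. i \<in> V \<Longrightarrow> 0 \<le> X k i \<and> X k i \<le> 1"
  shows "\<exists>r. strict_mono r \<and> (\<exists>x. \<forall>i\<in>V. (\<lambda>k. X (r k) i) \<longlonglongrightarrow> x i)"
  using assms
proof (induction V rule: finite_induct)
  case empty
  then show ?case using strict_mono_id by auto
next
  case (insert v V)
  then obtain r x where r: "strict_mono r" "\<forall>i\<in>V. (\<lambda>k. X (r k) i) \<longlonglongrightarrow> x i" by auto
  obtain q where q: "strict_mono q" "monoseq (\<lambda>n. X (r (q n)) v)"
    using seq_monosub[of "\<lambda>n. X (r n) v"] by blast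
  have "Bseq (\<lambda>n. X (r (q n)) v)"
    using insert.prems[of v] by (intro BseqI'[of _ 1]) auto
  then obtain y where y: "(\<lambda>n. X (r (q n)) v) \<longlonglongrightarrow> y"
    using Bseq_monoseq_convergent[OF _ q(2)] unfolding convergent_def by blast
  have "(\<lambda>n. X (r (q n)) i) \<longlonglongrightarrow> (x(v := y)) i" if "i \<in> insert v V" for i
  proof (cases "i = v")
    case False
    then have "(\<lambda>k. X (r k) i) \<longlonglongrightarrow> x i" using r(2) that by auto
    from LIMSEQ_subseq_LIMSEQ[OF this q(1)] show ?thesis using False by (simp add: comp_def)
  qed (use y in simp)
  then have "\<forall>i\<in>insert v V. (\<lambda>k. X ((r \<circ> q) k) i) \<longlonglongrightarrow> (x(v := y)) i" by simp
  then show ?case using strict_mono_o[OF r(1) q(1)] by blast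
qed

lemma div_antisym: "c / (u - v) = - (c / (v - u))" for c u v :: "'a :: field"
  by (metis minus_diff_eq minus_divide_right)

context finite_graph
begin

lemma nbrs_subset: "nbrs H i \<subseteq> V"
  unfolding nbrs_def using adjD by auto

lemma finite_nbrs [simp]: "finite (nbrs H i)"
  using finite_subset[OF nbrs_subset finite_V] .

lemma sum_nbrs_swap:
  assumes "finite C"
  shows "(\<Sum>i\<in>C. \<Sum>j\<in>nbrs H i \<inter> C. G i j) = (\<Sum>i\<in>C. \<Sum>j\<in>nbrs H i \<inter> C. G j i)"
proof -
  have "(\<Sum>i\<in>C. \<Sum>j\<in>nbrs H i \<inter> C. G i j) = (\<Sum>i\<in>C. \<Sum>j | j \<in> C \<and> {i, j} \<in> H. G i j)"
    by (intro sum.cong refl) (auto simp: nbrs_def)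
  also have "\<dots> = (\<Sum>j\<in>C. \<Sum>i | i \<in> C \<and> {i, j} \<in> H. G i j)"
    by (rule sum.swap_restrict[OF assms assms])
  also have "\<dots> = (\<Sum>j\<in>C. \<Sum>i\<in>nbrs H j \<inter> C. G i j)"
    by (intro sum.cong refl) (auto simp: nbrs_def insert_commute)
  finally show ?thesis .
qed

text \<open>Both ends of an edge are summed over, and exchanging them turns \<open>y i\<close> into
  \<open>- y j\<close>. This converts equations paired with a test function \<open>y\<close> into an
  edge sum; a smaller \<open>C\<close> serves clusters of vertices.\<close>

lemma sum_antisym_nbrs:
  fixes F :: "nat \<Rightarrow> nat \<Rightarrow> 'c :: field_char_0"
  assumes "finite C" "\<And>i j. i \<in> C \<Longrightarrow> j \<in> C \<Longrightarrow> {i, j} \<in> H \<Longrightarrow> F j i = - F i j"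
  shows "2 * (\<Sum>i\<in>C. \<Sum>j\<in>nbrs H i \<inter> C. y i * F i j) = (\<Sum>i\<in>C. \<Sum>j\<in>nbrs H i \<inter> C. (y i - y j) * F i j)"
proof -
  have "(\<Sum>i\<in>C. \<Sum>j\<in>nbrs H i \<inter> C. y i * F i j) = (\<Sum>i\<in>C. \<Sum>j\<in>nbrs H i \<inter> C. y j * F j i)"
    by (rule sum_nbrs_swap[OF assms(1)])
  also have "\<dots> = (\<Sum>i\<in>C. \<Sum>j\<in>nbrs H i \<inter> C. - (y j * F i j))"
    using assms(2) by (intro sum.cong refl) (auto simp: nbrs_def)
  finally have "2 * (\<Sum>i\<in>C. \<Sum>j\<in>nbrs H i \<inter> C. y i * F i j) =
      (\<Sum>i\<in>C. \<Sum>j\<in>nbrs H i \<inter> C. y i * F i j) + (\<Sum>i\<in>C. \<Sum>j\<in>nbrs H i \<inter> C. - (y j * F i j))"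
    by simp
  then show ?thesis
    by (simp add: sum.distrib[symmetric] sum_negf[symmetric] algebra_simps)
qed

lemma nbrs_Int [simp]: "nbrs H i \<inter> V = nbrs H i"
  using nbrs_subset by blast

lemmas sum_antisym = sum_antisym_nbrs[OF finite_V, unfolded nbrs_Int]

text \<open>Fiber points normalised with \<open>x n\<close> at infinity. In contrast to
  \<open>crit\<close>, all coordinates on \<open>V\<close> are distinct and the equations at
  \<open>a\<close> and \<open>b\<close> are included.\<close>

definition solutions :: "nat \<Rightarrow> nat \<Rightarrow> (nat set \<Rightarrow> complex) \<Rightarrow> (nat \<Rightarrow> complex) set" where
  "solutions a b s = {z. z a = 0 \<and> z b = 1 \<and> (\<forall>i. i \<notin> V \<longrightarrow> z i = 0) \<and> inj_on z V \<and>
     (\<forall>i\<in>V. (\<Sum>j\<in>nbrs H i. s {i, j} / (z i - z j)) = 0)}"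

end

text \<open>Connectedness is stated for sets closed under adjacency: copiousness yields it in this
  form, and it applies directly to level sets of functions that are constant along edges.\<close>

locale connected_graph = finite_graph +
  fixes a b :: nat
  assumes ab: "{a, b} \<in> H"
    and connected: "\<And>C. C \<subseteq> V \<Longrightarrow> C \<noteq> {} \<Longrightarrow> (\<And>i j. i \<in> C \<Longrightarrow> {i, j} \<in> H \<Longrightarrow> j \<in> C) \<Longrightarrow> C = V"
begin

lemma ab_V: "a \<in> V" "b \<in> V" "a \<noteq> b"
  using adjD[OF ab] by auto

definition positive :: "(nat set \<Rightarrow> real) \<Rightarrow> bool" where
  "positive s \<longleftrightarrow> (\<forall>e\<in>H - {{a, b}}. s e > 0)"

lemma positiveD: "positive s \<Longrightarrow> {i, j} \<in> H \<Longrightarrow> {i, j} \<noteq> {a, b} \<Longrightarrow> s {i, j} > 0"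
  unfolding positive_def by blast

text \<open>Vertices that are not adjacent may coincide, and the equations at \<open>a\<close> and
  \<open>b\<close> are left out, so the weight of the edge \<open>ab\<close> does not occur.\<close>

definition crit :: "(nat set \<Rightarrow> real) \<Rightarrow> (nat \<Rightarrow> real) set" where
  "crit s = {x. x a = 0 \<and> x b = 1 \<and> (\<forall>i. i \<notin> V \<longrightarrow> x i = 0) \<and> (\<forall>i j. {i, j} \<in> H \<longrightarrow> x i \<noteq> x j) \<and>
     (\<forall>i\<in>V - {a, b}. (\<Sum>j\<in>nbrs H i. s {i, j} / (x i - x j)) = 0)}"

lemma critD:
  assumes "x \<in> crit s"
  shows "x a = 0" "x b = 1" "i \<notin> V \<Longrightarrow> x i = 0" "{i, j} \<in> H \<Longrightarrow> x i \<noteq> x j"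
    "i \<in> V \<Longrightarrow> i \<noteq> a \<Longrightarrow> i \<noteq> b \<Longrightarrow> (\<Sum>j\<in>nbrs H i. s {i, j} / (x i - x j)) = 0"
  using assms unfolding crit_def by auto

lemma const_on_edges:
  assumes "\<And>i j. {i, j} \<in> H \<Longrightarrow> f i = f j" "v \<in> V"
  shows "f v = f a"
proof -
  have "{i \<in> V. f i = f a} = V"
    using ab_V assms(1) adjD by (intro connected) auto
  then show ?thesis using assms(2) by blast
qed

lemma has_nbr: "v \<in> V \<Longrightarrow> \<exists>u. {v, u} \<in> H"
proof (rule ccontr)
  assume v: "v \<in> V" "\<nexists>u. {v, u} \<in> H"
  then have "{v} = V" by (intro connected) auto
  then show False using ab_V by auto
qed

text \<open>At a vertex above, or below, all its neighbours every summand would have the same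
  sign.\<close>

lemma crit_between:
  assumes "positive s" "x \<in> crit s" "i \<in> V" "i \<noteq> a" "i \<noteq> b"
  shows "\<exists>j. {i, j} \<in> H \<and> x j < x i" "\<exists>j. {i, j} \<in> H \<and> x i < x j"
proof -
  have ne: "nbrs H i \<noteq> {}" using has_nbr[OF assms(3)] by (auto simp: nbrs_def)
  have s: "s {i, j} > 0" if "j \<in> nbrs H i" for j
    using positiveD[OF assms(1), of i j] that assms(4,5) by (auto simp: nbrs_def doubleton_eq_iff)
  note eq = critD(5)[OF assms(2-5)]
  show "\<exists>j. {i, j} \<in> H \<and> x j < x i"
  proof (rule ccontr)
    assume "\<not> ?thesis"
    then have "x i < x j" if "j \<in> nbrs H i" for j
      using critD(4)[OF assms(2), of i j] that by (force simp: nbrs_def)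
    then have "s {i, j} / (x i - x j) < 0" if "j \<in> nbrs H i" for j
      using s[OF that] that by (simp add: divide_neg_neg divide_pos_neg)
    then have "(\<Sum>j\<in>nbrs H i. s {i, j} / (x i - x j)) < (\<Sum>j\<in>nbrs H i. 0)"
      using ne by (intro sum_strict_mono) auto
    then show False using eq by simp
  qed
  show "\<exists>j. {i, j} \<in> H \<and> x i < x j"
  proof (rule ccontr)
    assume "\<not> ?thesis"
    then have "x j < x i" if "j \<in> nbrs H i" for j
      using critD(4)[OF assms(2), of i j] that by (force simp: nbrs_def)
    then have "s {i, j} / (x i - x j) > 0" if "j \<in> nbrs H i" for j
      using s[OF that] that by simp
    then have "(\<Sum>j\<in>nbrs H i. s {i, j} / (x i - x j)) > (\<Sum>j\<in>nbrs H i. 0)"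
      using ne by (intro sum_strict_mono) auto
    then show False using eq by simp
  qed
qed

lemma arcs_orients:
  "(\<And>i j. {i, j} \<in> H \<Longrightarrow> x i \<noteq> x j) \<Longrightarrow> arcs U x \<in> orients U"
  unfolding orients_def by blast

lemma orient_total:
  assumes "ori \<in> orients V" "{i, j} \<in> H"
  shows "(i, j) \<in> ori \<or> (j, i) \<in> ori"
proof -
  obtain h where "ori = arcs V h" "\<forall>i\<in>V. \<forall>j\<in>V. {i, j} \<in> H \<longrightarrow> h i \<noteq> h j"
    using assms(1) unfolding orients_def by blast
  moreover have "i \<in> V" "j \<in> V" "{j, i} \<in> H" using assms(2) adjD adj_sym by auto
  ultimately show ?thesis using assms(2) unfolding arcs_def by (auto simp: not_less_iff_gr_or_eq)
qed

lemma orient_edge: "ori \<in> orients V \<Longrightarrow> (i, j) \<in> ori \<Longrightarrow> {i, j} \<in> H"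
  unfolding orients_def arcs_def by auto

lemma bipolar_orients: "ori \<in> bipolar a b \<Longrightarrow> ori \<in> orients V"
  unfolding bipolar_def sink_orients_def by auto

text \<open>Minimum and maximum of \<open>h\<close> are attained at a source and at a sink.\<close>

lemma bipolar_bounds:
  assumes "ori \<in> bipolar a b" "\<And>i j. (i, j) \<in> ori \<Longrightarrow> h i < (h j :: real)" "v \<in> V"
  shows "h a \<le> h v" "h v \<le> h b"
proof -
  have ne: "V \<noteq> {}" using assms(3) by blast
  define m where "m = arg_min_on h V"
  have m: "m \<in> V" "\<not> (\<exists>x\<in>V. h x < h m)"
    unfolding m_def using arg_min_if_finite[OF finite_V ne] by blast+
  have "m = a"
  proof (rule ccontr)
    assume "m \<noteq> a"
    then obtain u where u: "(u, m) \<in> ori" using assms(1) m(1) unfolding bipolar_def by blast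
    then have "u \<in> V" using orient_edge[OF bipolar_orients[OF assms(1)]] adjD by blast
    then show False using m(2) assms(2)[OF u] by blast
  qed
  then show "h a \<le> h v" using m(2) assms(3) by force
  define m' where "m' = arg_min_on (\<lambda>v. - h v) V"
  have m': "m' \<in> V" "\<not> (\<exists>x\<in>V. - h x < - h m')"
    unfolding m'_def using arg_min_if_finite[OF finite_V ne, of "\<lambda>v. - h v"] by blast+
  have "m' = b"
  proof (rule ccontr)
    assume "m' \<noteq> b"
    then obtain u where u: "(m', u) \<in> ori" using assms(1) m'(1) unfolding bipolar_def sink_orients_def by blast
    then have "u \<in> V" using orient_edge[OF bipolar_orients[OF assms(1)]] adjD by blast
    then show False using m'(2) assms(2)[OF u] by force
  qed
  then show "h v \<le> h b" using m'(2) assms(3) by force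
qed

lemma crit_bipolar:
  assumes "positive s" "x \<in> crit s"
  shows "arcs V x \<in> bipolar a b"
proof -
  have "a \<in> V" "b \<in> V" using ab_V by auto
  have lt: "x a < x b" using critD[OF assms(2)] by simp
  have "\<exists>w. (v, w) \<in> arcs V x" if v: "v \<in> V - {b}" for v
  proof (cases "v = a")
    case True
    then show ?thesis using ab ab_V lt unfolding arcs_def by auto
  next
    case False
    then obtain j where "{v, j} \<in> H" "x v < x j" using crit_between[OF assms, of v] v by blast
    then show ?thesis using adjD v unfolding arcs_def by blast
  qed
  moreover have "\<exists>w. (w, v) \<in> arcs V x" if v: "v \<in> V - {a}" for v
  proof (cases "v = b")
    case True
    then show ?thesis using ab ab_V lt unfolding arcs_def by auto
  next
    case False
    then obtain j where "{v, j} \<in> H" "x j < x v" using crit_between[OF assms, of v] v by blast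
    moreover from this have "{j, v} \<in> H" using adj_sym by blast
    ultimately show ?thesis using adjD v unfolding arcs_def by blast
  qed
  moreover have "arcs V x \<in> orients V" using critD(4)[OF assms(2)] by (rule arcs_orients)
  ultimately show ?thesis unfolding bipolar_def sink_orients_def by blast
qed

lemma crit_bounds:
  assumes "positive s" "x \<in> crit s" "v \<in> V"
  shows "0 \<le> x v \<and> x v \<le> 1"
proof -
  have "x a \<le> x v" "x v \<le> x b"
    using bipolar_bounds[OF crit_bipolar[OF assms(1,2)], of x] assms(3) by (auto simp: arcs_def)
  then show ?thesis using critD[OF assms(2)] by simp
qed

text \<open>Strict concavity of the master function on a chamber: the difference of the two
  gradients paired with \<open>x - y\<close> is a sum of nonpositive edge terms. All vanish, so
  \<open>x - y\<close> is constant along edges, hence 0 as it is 0 at \<open>a\<close>.\<close>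

lemma crit_unique:
  assumes "positive s" "x \<in> crit s" "y \<in> crit s" "arcs V x = arcs V y"
  shows "x = y"
proof -
  let ?d = "\<lambda>i. x i - y i"
  define F where "F i j = s {i, j} / (x i - x j) - s {i, j} / (y i - y j)" for i j
  have anti: "F j i = - F i j" for i j
    using div_antisym[of "s {i, j}" "x j" "x i"] div_antisym[of "s {i, j}" "y j" "y i"]
    unfolding F_def by (simp add: insert_commute)
  have eq: "(\<Sum>j\<in>nbrs H i. ?d i * F i j) = 0" if "i \<in> V" for i
  proof (cases "i = a \<or> i = b")
    case True
    then show ?thesis using critD(1,2)[OF assms(2)] critD(1,2)[OF assms(3)] by auto
  next
    case False
    then have "(\<Sum>j\<in>nbrs H i. F i j) = 0"
      unfolding F_def sum_subtractf using critD(5)[OF assms(2) that] critD(5)[OF assms(3) that] by simp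
    then show ?thesis unfolding sum_distrib_left[symmetric] by simp
  qed
  have key: "(?d i - ?d j) * F i j \<le> 0 \<and> ((?d i - ?d j) * F i j = 0 \<longrightarrow> ?d i = ?d j)" if e: "{i, j} \<in> H" for i j
  \<comment> \<open>The weight of \<open>ab\<close> may have any sign, but both points agree at
    \<open>a\<close> and \<open>b\<close>.\<close>
  proof (cases "{i, j} = {a, b}")
    case True
    then have "?d i = 0" "?d j = 0"
      using critD(1,2)[OF assms(2)] critD(1,2)[OF assms(3)] by (auto simp: doubleton_eq_iff)
    then show ?thesis by simp
  next
    case False
    define p q where "p = x i - x j" and "q = y i - y j"
    have s: "s {i, j} > 0" using positiveD[OF assms(1) e False] .
    have ne: "p \<noteq> 0" "q \<noteq> 0" using critD(4)[OF assms(2) e] critD(4)[OF assms(3) e] p_def q_def by auto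
    have "i \<in> V" "j \<in> V" using adjD[OF e] by auto
    then have "x i < x j \<longleftrightarrow> y i < y j"
      using assms(4) e unfolding arcs_def by blast
    \<comment> \<open>Equal orientations give both differences the same sign.\<close>
    then have pq: "p * q > 0" using ne unfolding p_def q_def
      by (auto simp: zero_less_mult_iff not_less)
    have "(?d i - ?d j) * F i j = (p - q) * (s {i, j} / p - s {i, j} / q)"
      unfolding F_def p_def q_def by (simp add: algebra_simps)
    also have "\<dots> = - (s {i, j} * (p - q)\<^sup>2 / (p * q))"
      using ne by (simp add: field_simps power2_eq_square)
    finally have *: "(?d i - ?d j) * F i j = - (s {i, j} * (p - q)\<^sup>2 / (p * q))" .
    have "?d i - ?d j = p - q" unfolding p_def q_def by simp
    then show ?thesis unfolding * using s pq ne by auto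
  qed
  have "(\<Sum>i\<in>V. \<Sum>j\<in>nbrs H i. (?d i - ?d j) * F i j) = 2 * (\<Sum>i\<in>V. \<Sum>j\<in>nbrs H i. ?d i * F i j)"
    by (rule sum_antisym[symmetric]) (rule anti)
  also have "\<dots> = 0" using eq by simp
  finally have "(\<Sum>i\<in>V. \<Sum>j\<in>nbrs H i. - ((?d i - ?d j) * F i j)) = 0"
    by (simp add: sum_negf)
  moreover have nn: "- ((?d i - ?d j) * F i j) \<ge> 0" if "j \<in> nbrs H i" for i j
    using key[of i j] that by (auto simp: nbrs_def)
  moreover have "(\<Sum>j\<in>nbrs H i. - ((?d i - ?d j) * F i j)) \<ge> 0" for i
    using nn by (intro sum_nonneg) auto
  ultimately have "\<forall>i\<in>V. (\<Sum>j\<in>nbrs H i. - ((?d i - ?d j) * F i j)) = 0"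
    by (subst (asm) sum_nonneg_eq_0_iff[OF finite_V]) auto
  then have "- ((?d i - ?d j) * F i j) = 0" if "i \<in> V" "j \<in> nbrs H i" for i j
    using that nn sum_nonneg_eq_0_iff[OF finite_nbrs, of i "\<lambda>j. - ((?d i - ?d j) * F i j)"] by blast
  then have "(?d i - ?d j) * F i j = 0" if "{i, j} \<in> H" for i j
    using that adjD[OF that] by (auto simp: nbrs_def)
  then have "?d i = ?d j" if "{i, j} \<in> H" for i j using key that by blast
  then have "?d v = ?d a" if "v \<in> V" for v using that by (rule const_on_edges)
  then have "?d v = 0" for v
    using critD(1,3)[OF assms(2)] critD(1,3)[OF assms(3)] by (cases "v \<in> V") auto
  then show ?thesis by (simp add: fun_eq_iff)
qed

text \<open>Pairing the equations with the imaginary parts of a solution gives a sum of terms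
  \<open>- t (Im z\<^sub>i - Im z\<^sub>j)\<^sup>2 / |z\<^sub>i - z\<^sub>j|\<^sup>2\<close>. The equations at \<open>a\<close> and \<open>b\<close>, absent from \<open>crit\<close>,
  follow from the others because the weights sum to zero.\<close>
lemma solutions_real:
  assumes "positive t" "\<And>e. e \<in> H - {{a, b}} \<Longrightarrow> s e = of_real (t e)"
    and tot: "(\<Sum>i\<in>V. \<Sum>j\<in>nbrs H i. s {i, j}) = 0"
    and inj: "\<And>x. x \<in> crit t \<Longrightarrow> inj_on x V"
  shows "solutions a b s = (\<lambda>x i. of_real (x i)) ` crit t"
proof (intro set_eqI iffI)
  fix z assume z: "z \<in> solutions a b s"
  then have zz: "z a = 0" "z b = 1" "\<And>i. i \<notin> V \<Longrightarrow> z i = 0" "inj_on z V"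
    and eq: "\<And>i. i \<in> V \<Longrightarrow> (\<Sum>j\<in>nbrs H i. s {i, j} / (z i - z j)) = 0"
    unfolding solutions_def by auto
  have ne: "z i \<noteq> z j" if "{i, j} \<in> H" for i j
    using adjD[OF that] zz(4) by (auto dest: inj_onD)
  define y where "y i = Im (z i)" for i
  define F where "F i j = s {i, j} / (z i - z j)" for i j
  have anti: "F j i = - F i j" for i j
    unfolding F_def by (simp add: insert_commute minus_divide_right)
  have key: "- Im ((of_real (y i) - of_real (y j)) * F i j) \<ge> 0 \<and>
      (Im ((of_real (y i) - of_real (y j)) * F i j) = 0 \<longrightarrow> y i = y j)" if e: "{i, j} \<in> H" for i j
  proof (cases "{i, j} = {a, b}")
    case True
    then have "y i = 0" "y j = 0" using zz unfolding y_def by (auto simp: doubleton_eq_iff)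
    then show ?thesis by simp
  next
    case False
    have t: "t {i, j} > 0" using positiveD[OF assms(1) e False] .
    have s: "s {i, j} = of_real (t {i, j})" using assms(2) e False by simp
    let ?w = "z i - z j"
    have "(Re ?w)\<^sup>2 + (Im ?w)\<^sup>2 > 0" using ne[OF e]
      by (metis complex_eq_iff eq_iff_diff_eq_0 sum_power2_gt_zero_iff zero_complex.sel)
    have alg: "p * t * (- p / D) = - (t * p\<^sup>2 / D)" for p t D :: real
      by (simp add: power2_eq_square)
    have g: "Im (of_real r * c) = r * Im c" for r c by simp
    have "(of_real (y i) - of_real (y j)) * F i j = of_real ((y i - y j) * t {i, j}) * (1 / ?w)"
      unfolding F_def s by simp
    then have "Im ((of_real (y i) - of_real (y j)) * F i j) = (y i - y j) * t {i, j} * Im (1 / ?w)"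
      by (simp only: g)
    also have "Im (1 / ?w) = - (y i - y j) / ((Re ?w)\<^sup>2 + (Im ?w)\<^sup>2)"
      unfolding y_def by (simp add: Im_divide)
    finally have *: "Im ((of_real (y i) - of_real (y j)) * F i j) = 
        - (t {i, j} * (y i - y j)\<^sup>2 / ((Re ?w)\<^sup>2 + (Im ?w)\<^sup>2))"
      by (simp only: alg)
    show ?thesis unfolding * using t \<open>(Re ?w)\<^sup>2 + (Im ?w)\<^sup>2 > 0\<close> by auto
  qed
  have "(\<Sum>i\<in>V. \<Sum>j\<in>nbrs H i. (of_real (y i) - of_real (y j)) * F i j) = 2 * (\<Sum>i\<in>V. \<Sum>j\<in>nbrs H i. of_real (y i) * F i j)"
    by (rule sum_antisym[symmetric]) (rule anti)
  also have "\<dots> = 0"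
    unfolding sum_distrib_left[symmetric] using eq unfolding F_def by simp
  finally have "Im (\<Sum>i\<in>V. \<Sum>j\<in>nbrs H i. (of_real (y i) - of_real (y j)) * F i j) = 0" by simp
  then have "(\<Sum>i\<in>V. \<Sum>j\<in>nbrs H i. - Im ((of_real (y i) - of_real (y j)) * F i j)) = 0"
    by (simp only: Im_sum sum_negf)
  moreover have nn: "- Im ((of_real (y i) - of_real (y j)) * F i j) \<ge> 0" if "j \<in> nbrs H i" for i j
    using key[of i j] that by (auto simp: nbrs_def)
  moreover have "(\<Sum>j\<in>nbrs H i. - Im ((of_real (y i) - of_real (y j)) * F i j)) \<ge> 0" for i
    using nn by (intro sum_nonneg) auto
  ultimately have "\<forall>i\<in>V. (\<Sum>j\<in>nbrs H i. - Im ((of_real (y i) - of_real (y j)) * F i j)) = 0"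
    by (subst (asm) sum_nonneg_eq_0_iff[OF finite_V]) auto
  then have "- Im ((of_real (y i) - of_real (y j)) * F i j) = 0" if "i \<in> V" "j \<in> nbrs H i" for i j
    using that nn sum_nonneg_eq_0_iff[OF finite_nbrs, of i "\<lambda>j. - Im ((of_real (y i) - of_real (y j)) * F i j)"] by blast
  then have "Im ((of_real (y i) - of_real (y j)) * F i j) = 0" if "{i, j} \<in> H" for i j
    using that adjD[OF that] by (auto simp: nbrs_def)
  then have "y i = y j" if "{i, j} \<in> H" for i j using key that by blast
  then have "y v = y a" if "v \<in> V" for v using that by (rule const_on_edges)
  then have "Im (z v) = 0" for v
    using zz unfolding y_def by (cases "v \<in> V") auto
  then have re: "z v = of_real (Re (z v))" for v by (simp add: complex_eq_iff)
  define x where "x v = Re (z v)" for v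
  have zx: "z = (\<lambda>i. of_real (x i))" using re unfolding x_def by auto
  have "(\<Sum>j\<in>nbrs H i. t {i, j} / (x i - x j)) = 0" if "i \<in> V - {a, b}" for i
  proof -
    have "s {i, j} = of_real (t {i, j})" if "j \<in> nbrs H i" for j
      using assms(2)[of "{i, j}"] that \<open>i \<in> V - {a, b}\<close> by (auto simp: nbrs_def doubleton_eq_iff)
    then have "of_real (\<Sum>j\<in>nbrs H i. t {i, j} / (x i - x j)) = (\<Sum>j\<in>nbrs H i. s {i, j} / (z i - z j))"
      unfolding zx by simp
    also have "\<dots> = 0" using eq that by blast
    finally show ?thesis by (simp only: of_real_eq_0_iff)
  qed
  moreover have "x a = 0" "x b = 1" "\<And>i. i \<notin> V \<Longrightarrow> x i = 0" using zz unfolding x_def by auto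
  moreover have "x i \<noteq> x j" if "{i, j} \<in> H" for i j
    using ne[OF that] zx by auto
  ultimately have "x \<in> crit t" unfolding crit_def by blast
  then show "z \<in> (\<lambda>x i. of_real (x i)) ` crit t" using zx by blast
next
  fix z assume "z \<in> (\<lambda>x i. complex_of_real (x i)) ` crit t"
  then obtain x where x: "x \<in> crit t" and z: "z = (\<lambda>i. of_real (x i))" by blast
  note xD = critD[OF x]
  define e where "e i = (\<Sum>j\<in>nbrs H i. s {i, j} / (z i - z j))" for i
  have e0: "e i = 0" if "i \<in> V - {a, b}" for i
  proof -
    have "s {i, j} = of_real (t {i, j})" if "j \<in> nbrs H i" for j
      using assms(2)[of "{i, j}"] that \<open>i \<in> V - {a, b}\<close> by (auto simp: nbrs_def doubleton_eq_iff)
    then have "e i = of_real (\<Sum>j\<in>nbrs H i. t {i, j} / (x i - x j))"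
      unfolding e_def z by simp
    moreover have "(\<Sum>j\<in>nbrs H i. t {i, j} / (x i - x j)) = 0" using xD(5)[of i] that by blast
    ultimately show ?thesis by (simp only: of_real_0)
  qed
  define F where "F i j = s {i, j} / (z i - z j)" for i j
  have anti: "F j i = - F i j" for i j
    unfolding F_def by (simp add: insert_commute minus_divide_right)
  \<comment> \<open>The test functions 1 and \<open>z\<close> express invariance under translation
    and scaling: they give \<open>e a + e b = 0\<close> and, as the total weight is zero,
    \<open>z a * e a + z b * e b = 0\<close>.\<close>
  have "2 * (\<Sum>i\<in>V. \<Sum>j\<in>nbrs H i. 1 * F i j) = (\<Sum>i\<in>V. \<Sum>j\<in>nbrs H i. (1 - 1) * F i j)"
    by (rule sum_antisym) (rule anti)
  then have s1: "(\<Sum>i\<in>V. e i) = 0" unfolding e_def F_def by simp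
  have "2 * (\<Sum>i\<in>V. \<Sum>j\<in>nbrs H i. z i * F i j) = (\<Sum>i\<in>V. \<Sum>j\<in>nbrs H i. (z i - z j) * F i j)"
    by (rule sum_antisym) (rule anti)
  also have "\<dots> = (\<Sum>i\<in>V. \<Sum>j\<in>nbrs H i. s {i, j})"
    using xD(4) unfolding F_def z by (intro sum.cong refl) (auto simp: nbrs_def)
  also have "\<dots> = 0" by (rule tot)
  finally have "(\<Sum>i\<in>V. \<Sum>j\<in>nbrs H i. z i * F i j) = 0" by simp
  then have s2: "(\<Sum>i\<in>V. z i * e i) = 0" unfolding e_def F_def sum_distrib_left .
  have "(\<Sum>i\<in>V. e i) = e a + e b"
    using ab_V e0 by (subst sum.mono_neutral_right[OF finite_V, of "{a, b}"]) auto
  moreover have "(\<Sum>i\<in>V. z i * e i) = z a * e a + z b * e b"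
    using ab_V e0 by (subst sum.mono_neutral_right[OF finite_V, of "{a, b}"]) auto
  ultimately have "e b = 0" "e a = 0" using s1 s2 xD(1,2) unfolding z by auto
  then have "e i = 0" if "i \<in> V" for i using e0 that by blast
  moreover have "inj_on z V" using inj[OF x] unfolding z by (auto simp: inj_on_def)
  ultimately show "z \<in> solutions a b s" unfolding solutions_def e_def using xD(1-3) z by auto
qed

text \<open>If a cluster of vertices collapsed in the limit, then summing the equations over the cluster,
  multiplied by the distances to one of its points, would give total internal weight zero.\<close>
lemma crit_limit:
  assumes pos: "\<And>k. positive (S k)" "positive s"
    and lim: "\<And>e. e \<in> H - {{a, b}} \<Longrightarrow> (\<lambda>k. S k e) \<longlonglongrightarrow> s e"
    and X: "\<And>k. X k \<in> crit (S k)"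
  shows "\<exists>r x. strict_mono r \<and> x \<in> crit s \<and> (\<forall>i. (\<lambda>k. X (r k) i) \<longlonglongrightarrow> x i)"
proof -
  obtain r x0 where r: "strict_mono r" "\<forall>i\<in>V. (\<lambda>k. X (r k) i) \<longlonglongrightarrow> x0 i"
    using convergent_subseq_finite[OF finite_V, of X] crit_bounds[OF pos(1) X] by blast
  define Y where "Y k = X (r k)" for k
  define T where "T k = S (r k)" for k
  define x where "x i = (if i \<in> V then x0 i else 0)" for i
  have Y: "Y k \<in> crit (T k)" for k unfolding Y_def T_def by (rule X)
  note YD = critD[OF Y]
  have T: "(\<lambda>k. T k e) \<longlonglongrightarrow> s e" if "e \<in> H - {{a, b}}" for e
    using LIMSEQ_subseq_LIMSEQ[OF lim[OF that] r(1)] unfolding T_def by (simp add: comp_def)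
  have lx: "(\<lambda>k. Y k i) \<longlonglongrightarrow> x i" for i
    using r(2) YD(3)[of i] unfolding x_def Y_def by (cases "i \<in> V") auto
  have xa: "x a = 0" using lx[of a] YD(1) by (simp add: LIMSEQ_const_iff)
  have xb: "x b = 1" using lx[of b] YD(2) by (simp add: LIMSEQ_const_iff)
  have ne: "x p \<noteq> x q" if pq: "{p, q} \<in> H" for p q
  proof
    assume eq: "x p = x q"
    define C where "C = {i \<in> V. x i = x p}"
    have finC: "finite C" using finite_V C_def by simp
    have pC: "p \<in> C" "q \<in> C" using adjD[OF pq] eq C_def by auto
    have nab: "\<not> (a \<in> C \<and> b \<in> C)" using xa xb C_def by auto
    \<comment> \<open>The reference point is \<open>a\<close> or \<open>b\<close> if the cluster
      contains one of them (never both, as their limits are 0 and 1): the factor \<open>?w\<close>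
      then kills the vertex at which no equation is available.\<close>
    define c where "c = (if a \<in> C then a else if b \<in> C then b else p)"
    have cC: "c \<in> C" using pC c_def by auto
    have notab: "{i, j} \<noteq> {a, b}" if "i \<in> C" "j \<in> C" for i j
      using nab that by (auto simp: doubleton_eq_iff)
    define F where "F k i j = T k {i, j} / (Y k i - Y k j)" for k i j
    have anti: "F k j i = - F k i j" for k i j
      unfolding F_def by (simp add: insert_commute minus_divide_right)
    let ?w = "\<lambda>k i. Y k i - Y k c"
    have zero: "(\<Sum>j\<in>nbrs H i. ?w k i * F k i j) = 0" if "i \<in> C" for k i
    proof (cases "i = c")
      case False
      then have "i \<noteq> a" "i \<noteq> b" "i \<in> V" using that nab unfolding c_def C_def by auto
      then show ?thesis using YD(5)[of i k] unfolding sum_distrib_left[symmetric] F_def by simp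
    qed simp
    have split: "(\<Sum>j\<in>nbrs H i. ?w k i * F k i j) =
        (\<Sum>j\<in>nbrs H i \<inter> C. ?w k i * F k i j) + (\<Sum>j\<in>nbrs H i - C. ?w k i * F k i j)" for i k
      by (subst sum.union_disjoint[symmetric]) (auto intro: sum.cong)
    have inner: "2 * (\<Sum>i\<in>C. \<Sum>j\<in>nbrs H i \<inter> C. ?w k i * F k i j) = (\<Sum>i\<in>C. \<Sum>j\<in>nbrs H i \<inter> C. T k {i, j})" for k
    proof -
      have "2 * (\<Sum>i\<in>C. \<Sum>j\<in>nbrs H i \<inter> C. ?w k i * F k i j) =
          (\<Sum>i\<in>C. \<Sum>j\<in>nbrs H i \<inter> C. (?w k i - ?w k j) * F k i j)"
        by (rule sum_antisym_nbrs[OF finC]) (rule anti)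
      also have "\<dots> = (\<Sum>i\<in>C. \<Sum>j\<in>nbrs H i \<inter> C. T k {i, j})"
        using YD(4)[of _ _ k] unfolding F_def by (intro sum.cong refl) (auto simp: nbrs_def)
      finally show ?thesis .
    qed
    \<comment> \<open>The factors \<open>?w\<close> tend to 0 and the denominators do not. If the
      edge \<open>ab\<close> leaves \<open>C\<close>, it starts at \<open>c\<close>, where the term
      is 0; this matters, as no limit is assumed for its weight.\<close>
    have "(\<lambda>k. ?w k i * F k i j) \<longlonglongrightarrow> 0" if ij: "i \<in> C" "j \<in> nbrs H i - C" for i j
    proof (cases "i = c")
      case False
      then have "{i, j} \<noteq> {a, b}" using ij nab unfolding c_def by (auto simp: doubleton_eq_iff split: if_splits)
      then have "(\<lambda>k. T k {i, j}) \<longlonglongrightarrow> s {i, j}" using ij by (intro T) (auto simp: nbrs_def)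
      moreover have "x i - x j \<noteq> 0" using ij nbrs_subset unfolding C_def by fastforce
      ultimately have "(\<lambda>k. ?w k i * F k i j) \<longlonglongrightarrow> (x i - x c) * (s {i, j} / (x i - x j))"
        unfolding F_def by (intro tendsto_mult tendsto_diff lx tendsto_divide)
      also have "(x i - x c) * (s {i, j} / (x i - x j)) = 0" using ij(1) cC unfolding C_def by simp
      finally show ?thesis .
    qed simp
    then have outer: "(\<lambda>k. \<Sum>i\<in>C. \<Sum>j\<in>nbrs H i - C. ?w k i * F k i j) \<longlonglongrightarrow> 0"
      by (intro tendsto_null_sum)
    have "(\<Sum>i\<in>C. \<Sum>j\<in>nbrs H i \<inter> C. T k {i, j}) = - 2 * (\<Sum>i\<in>C. \<Sum>j\<in>nbrs H i - C. ?w k i * F k i j)" for k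
    proof -
      have "(\<Sum>i\<in>C. \<Sum>j\<in>nbrs H i \<inter> C. ?w k i * F k i j) + (\<Sum>i\<in>C. \<Sum>j\<in>nbrs H i - C. ?w k i * F k i j) = 0"
        unfolding sum.distrib[symmetric] split[symmetric] using zero by simp
      then show ?thesis unfolding inner[symmetric] by simp
    qed
    then have "(\<lambda>k. \<Sum>i\<in>C. \<Sum>j\<in>nbrs H i \<inter> C. T k {i, j}) \<longlonglongrightarrow> - 2 * 0"
      using tendsto_mult[OF tendsto_const[of "-2"] outer] by simp
    moreover have "(\<lambda>k. \<Sum>i\<in>C. \<Sum>j\<in>nbrs H i \<inter> C. T k {i, j}) \<longlonglongrightarrow> (\<Sum>i\<in>C. \<Sum>j\<in>nbrs H i \<inter> C. s {i, j})"
      using notab by (intro tendsto_sum T) (auto simp: nbrs_def)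
    ultimately have z: "(\<Sum>i\<in>C. \<Sum>j\<in>nbrs H i \<inter> C. s {i, j}) = 0"
      using LIMSEQ_unique by fastforce
    have sp: "s {i, j} > 0" if "i \<in> C" "j \<in> nbrs H i \<inter> C" for i j
      using positiveD[OF pos(2), of i j] notab[of i j] that by (auto simp: nbrs_def)
    have qn: "q \<in> nbrs H p \<inter> C" using pC pq by (simp add: nbrs_def)
    have "s {p, q} \<le> (\<Sum>j\<in>nbrs H p \<inter> C. s {p, j})"
      using pC sp[of p] by (intro member_le_sum[OF qn]) (simp_all add: less_imp_le)
    also have "\<dots> \<le> (\<Sum>i\<in>C. \<Sum>j\<in>nbrs H i \<inter> C. s {i, j})"
      using pC sp finC by (intro member_le_sum[of p C "\<lambda>i. \<Sum>j\<in>nbrs H i \<inter> C. s {i, j}"] sum_nonneg) (simp_all add: less_imp_le)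
    finally show False using z sp[OF pC(1) qn] by simp
  qed
  have "(\<Sum>j\<in>nbrs H i. s {i, j} / (x i - x j)) = 0" if i: "i \<in> V - {a, b}" for i
  proof -
    have "(\<lambda>k. \<Sum>j\<in>nbrs H i. T k {i, j} / (Y k i - Y k j)) \<longlonglongrightarrow> (\<Sum>j\<in>nbrs H i. s {i, j} / (x i - x j))"
      using i ne[of i] by (intro tendsto_sum tendsto_divide tendsto_diff lx T) (auto simp: nbrs_def doubleton_eq_iff)
    moreover have "(\<Sum>j\<in>nbrs H i. T k {i, j} / (Y k i - Y k j)) = 0" for k
      using YD(5)[of i k] i by simp
    ultimately show ?thesis by (simp add: LIMSEQ_const_iff)
  qed
  then have "x \<in> crit s" unfolding crit_def using xa xb ne by (auto simp: x_def)
  then show ?thesis using r(1) lx unfolding Y_def by blast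
qed

text \<open>Strict inequalities become weak in the limit; adjacent coordinates stay distinct, so
  they become strict again.\<close>

lemma arcs_limit:
  assumes X: "\<And>k. arcs V (X k) = ori" and lim: "\<And>i. (\<lambda>k. X k i) \<longlonglongrightarrow> x i"
    and ori: "ori \<in> orients V" and ne: "\<And>i j. {i, j} \<in> H \<Longrightarrow> x i \<noteq> x j"
  shows "arcs V x = ori"
proof -
  have lt: "x i < x j" if "(i, j) \<in> ori" for i j
  proof -
    have "X k i < X k j" for k using that X[of k] unfolding arcs_def by auto
    then have "x i \<le> x j" using LIMSEQ_le[OF lim lim, of i j] by (auto intro: less_imp_le)
    moreover have "x i \<noteq> x j" using ne orient_edge[OF ori that] by blast
    ultimately show ?thesis by simp
  qed
  show ?thesis
  proof (intro set_eqI iffI; clarify)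
    fix i j assume "(i, j) \<in> arcs V x"
    then have "{i, j} \<in> H" "x i < x j" unfolding arcs_def by auto
    then show "(i, j) \<in> ori" using orient_total[OF ori] lt[of j i] by fastforce
  next
    fix i j assume "(i, j) \<in> ori"
    then show "(i, j) \<in> arcs V x"
      using lt orient_edge[OF ori] adjD unfolding arcs_def by blast
  qed
qed

text \<open>The gap of \<^term>\<open>x\<close> along an edge, defined on the edge as a set to avoid choosing an orientation.\<close>
definition sq_gap :: "(nat \<Rightarrow> real) \<Rightarrow> nat set \<Rightarrow> real" where
  "sq_gap x e = (Max (x ` e) - Min (x ` e))\<^sup>2"

lemma sq_gap_pair: "sq_gap x {p, q} = (x p - x q)\<^sup>2"
  unfolding sq_gap_def by (auto simp: max_def min_def power2_commute)

lemma edge_cases: "e \<in> H \<Longrightarrow> \<exists>i j. e = {i, j} \<and> i \<noteq> j \<and> i \<in> V \<and> j \<in> V"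
  using edges by blast

lemma finite_H: "finite H"
  by (rule finite_subset[of _ "Pow V"]) (use edges finite_V in auto)

text \<open>The critical point maximises the master function on its chamber.\<close>
lemma crit_exists:
  assumes pos: "positive s" and bip: "ori \<in> bipolar a b"
  shows "\<exists>x\<in>crit s. arcs V x = ori"
proof -
  define E where "E = H - {{a, b}}"
  have finE: "finite E" unfolding E_def using finite_H by simp
  have sE: "s e > 0" if "e \<in> E" for e using pos that unfolding positive_def E_def by blast
  note oo = bipolar_orients[OF bip]
  obtain h where h: "ori = arcs V h" "\<forall>i\<in>V. \<forall>j\<in>V. {i, j} \<in> H \<longrightarrow> h i \<noteq> h j"
    using oo unfolding orients_def by blast
  define Ch where "Ch = {x::nat \<Rightarrow> real. x a = 0 \<and> x b = 1 \<and> (\<forall>i. i \<notin> V \<longrightarrow> x i = 0) \<and> (\<forall>(i, j)\<in>ori. x i < x j)}"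
  have hb: "h a \<le> h v" "h v \<le> h b" if "v \<in> V" for v
    using bipolar_bounds[OF bip, of h] that unfolding h arcs_def by auto
  have "h a < h b" using hb[of b] h(2) ab ab_V by force
  \<comment> \<open>The heights, rescaled affinely to be 0 at \<open>a\<close> and 1 at
    \<open>b\<close>, give a point of the chamber.\<close>
  then have "(\<lambda>i. if i \<in> V then (h i - h a) / (h b - h a) else 0) \<in> Ch"
    unfolding Ch_def h(1) arcs_def using ab_V by (auto simp: divide_strict_right_mono)
  then have Chne: "Ch \<noteq> {}" by blast
  have Ch_lt: "x i < x j" if "x \<in> Ch" "(i, j) \<in> ori" for x i j
    using that unfolding Ch_def by blast
  have Ch_arcs: "arcs V x = ori" if "x \<in> Ch" for x
  proof (intro set_eqI iffI; clarify)
    fix i j assume "(i, j) \<in> arcs V x"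
    then have "{i, j} \<in> H" "x i < x j" unfolding arcs_def by auto
    then show "(i, j) \<in> ori" using orient_total[OF oo] Ch_lt[OF that, of j i] by fastforce
  next
    fix i j assume "(i, j) \<in> ori"
    then show "(i, j) \<in> arcs V x"
      using Ch_lt[OF that] orient_edge[OF oo] adjD unfolding arcs_def by blast
  qed
  have Ch_ne: "x i \<noteq> x j" if "x \<in> Ch" "{i, j} \<in> H" for x i j
    using orient_total[OF oo that(2)] Ch_lt[OF that(1)] by force
  have Ch_bounds: "0 \<le> x i \<and> x i \<le> 1" if "x \<in> Ch" "i \<in> V" for x i
    using bipolar_bounds[of ori x, OF bip Ch_lt[OF that(1)] that(2)] that(1) unfolding Ch_def by auto
  have gap: "0 < sq_gap x e" "sq_gap x e \<le> 1" if xe: "x \<in> Ch" "e \<in> E" for x e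
  proof -
    obtain i j where e: "e = {i, j}" "i \<in> V" "j \<in> V" using edge_cases[of e] xe(2) E_def by blast
    have "x i - x j \<noteq> 0" using Ch_ne[OF xe(1), of i j] xe(2) e E_def by auto
    moreover have "\<bar>x i - x j\<bar> \<le> 1" using Ch_bounds[OF xe(1)] e(2,3) by (smt (verit))
    ultimately show "0 < sq_gap x e" "sq_gap x e \<le> 1" unfolding e sq_gap_pair
      by (simp_all add: abs_square_le_1)
  qed
  define \<Phi> where "\<Phi> x = (\<Sum>e\<in>E. s e * ln (sq_gap x e))" for x
  \<comment> \<open>All gaps are at most 1, so each summand is nonpositive and bounds the sum from
    above.\<close>
  have \<Phi>_le: "\<Phi> x \<le> s e * ln (sq_gap x e)" if "x \<in> Ch" "e \<in> E" for x e
  proof -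
    have "s e' * ln (sq_gap x e') \<le> 0" if "e' \<in> E" for e'
      using gap[OF \<open>x \<in> Ch\<close> that] sE[OF that] by (simp add: mult_nonneg_nonpos less_imp_le)
    then have "(\<Sum>e'\<in>E - {e}. s e' * ln (sq_gap x e')) \<le> 0" by (intro sum_nonpos) auto
    then show ?thesis unfolding \<Phi>_def using sum.remove[OF finE that(2), of "\<lambda>e. s e * ln (sq_gap x e)"] by simp
  qed
  have \<Phi>_0: "\<Phi> x \<le> 0" if "x \<in> Ch" for x
    unfolding \<Phi>_def using gap[OF that] sE by (intro sum_nonpos) (simp add: mult_nonneg_nonpos less_imp_le)
  define M where "M = Sup (\<Phi> ` Ch)"
  have bdd: "bdd_above (\<Phi> ` Ch)" using \<Phi>_0 by (intro bdd_aboveI[of _ 0]) auto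
  have "\<exists>x\<in>Ch. M - inverse (real (Suc k)) < \<Phi> x" for k
  proof -
    have "M - inverse (real (Suc k)) < M" by simp
    then show ?thesis unfolding M_def using less_cSup_iff[OF _ bdd] Chne by blast
  qed
  then obtain X where X: "\<And>k. X k \<in> Ch" "\<And>k. M - inverse (real (Suc k)) < \<Phi> (X k)"
    by metis
  obtain r x0 where r: "strict_mono r" "\<forall>i\<in>V. (\<lambda>k. X (r k) i) \<longlonglongrightarrow> x0 i"
    using convergent_subseq_finite[OF finite_V, of X] Ch_bounds[OF X(1)] by blast
  define Y where "Y k = X (r k)" for k
  define x where "x i = (if i \<in> V then x0 i else 0)" for i
  have Y: "Y k \<in> Ch" for k unfolding Y_def by (rule X)
  have lx: "(\<lambda>k. Y k i) \<longlonglongrightarrow> x i" for i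
    using r(2) Y unfolding x_def Y_def Ch_def by (cases "i \<in> V") auto
  have lgap: "(\<lambda>k. sq_gap (Y k) e) \<longlonglongrightarrow> sq_gap x e" if eE: "e \<in> E" for e
  proof -
    obtain i j where e: "e = {i, j}" using edge_cases[of e] eE E_def by blast
    show ?thesis unfolding e sq_gap_pair by (intro tendsto_intros lx)
  qed
  have xgap: "sq_gap x e > 0" if "e \<in> E" for e
  proof -
    \<comment> \<open>\<open>\<Phi>\<close> exceeds M - 1 along the sequence, so by
      \<open>\<Phi>_le\<close> no gap tends to 0: this keeps the limit off the walls.\<close>
    have "exp ((M - 1) / s e) \<le> sq_gap (Y k) e" for k
    proof -
      have "M - 1 \<le> M - inverse (real (Suc (r k)))"
        by (simp add: inverse_le_1_iff)
      also have "\<dots> \<le> \<Phi> (Y k)" using X(2)[of "r k"] unfolding Y_def by simp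
      also have "\<dots> \<le> s e * ln (sq_gap (Y k) e)" by (rule \<Phi>_le[OF Y that])
      finally have "(M - 1) / s e \<le> ln (sq_gap (Y k) e)"
        using sE[OF that] by (simp add: field_simps)
      then show ?thesis using gap(1)[OF Y that] by (metis exp_le_cancel_iff exp_ln)
    qed
    then have "exp ((M - 1) / s e) \<le> sq_gap x e"
      by (intro LIMSEQ_le_const[OF lgap[OF that]]) auto
    then show ?thesis using exp_gt_zero[of "(M - 1) / s e"] by linarith
  qed
  have xa: "x a = 0" using lx[of a] Y unfolding Ch_def by (simp add: LIMSEQ_const_iff)
  have xb: "x b = 1" using lx[of b] Y unfolding Ch_def by (simp add: LIMSEQ_const_iff)
  have "x i < x j" if ij: "(i, j) \<in> ori" for i j
  proof -
    have "x i \<le> x j" using LIMSEQ_le[OF lx lx, of i j] Ch_lt[OF Y ij] by (auto intro: less_imp_le)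
    moreover have "x i \<noteq> x j"
    proof (cases "{i, j} = {a, b}")
      case True
      then show ?thesis using xa xb by (auto simp: doubleton_eq_iff)
    next
      case False
      then show ?thesis using xgap[of "{i, j}"] orient_edge[OF oo ij] unfolding E_def sq_gap_pair by auto
    qed
    ultimately show ?thesis by simp
  qed
  moreover have "x i = 0" if "i \<notin> V" for i using that unfolding x_def by simp
  ultimately have xCh: "x \<in> Ch" unfolding Ch_def using xa xb by blast
  have "(\<lambda>k. \<Phi> (Y k)) \<longlonglongrightarrow> \<Phi> x"
    unfolding \<Phi>_def using xgap by (intro tendsto_sum tendsto_mult tendsto_const tendsto_ln lgap) force+
  moreover have "(\<lambda>k. M - inverse (real (Suc (r k)))) \<longlonglongrightarrow> M - 0"
    using LIMSEQ_subseq_LIMSEQ[OF LIMSEQ_inverse_real_of_nat r(1)]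
    by (intro tendsto_diff tendsto_const) (simp add: comp_def)
  ultimately have "M \<le> \<Phi> x"
    using X(2) unfolding Y_def by (intro LIMSEQ_le[of _ M]) (auto intro: less_imp_le)
  then have max: "\<Phi> y \<le> \<Phi> x" if "y \<in> Ch" for y
    using cSup_upper[OF imageI[OF that] bdd] unfolding M_def by linarith
  have "(\<Sum>j\<in>nbrs H i. s {i, j} / (x i - x j)) = 0" if i: "i \<in> V - {a, b}" for i
  proof -
    have xne: "x i - x j \<noteq> 0" if "j \<in> nbrs H i" for j
      using Ch_ne[OF xCh, of i j] that by (auto simp: nbrs_def)
    let ?upd = "\<lambda>t. x(i := t)"
    let ?E1 = "{e \<in> E. i \<in> e}"
    have E1: "?E1 = (\<lambda>j. {i, j}) ` nbrs H i"
    proof (intro set_eqI iffI)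
      fix e assume e: "e \<in> ?E1"
      then obtain p q where "e = {p, q}" using edge_cases[of e] E_def by blast
      then have "e = {i, p} \<or> e = {i, q}" using e by auto
      then show "e \<in> (\<lambda>j. {i, j}) ` nbrs H i" using e unfolding nbrs_def E_def by auto
    qed (use i in \<open>auto simp: nbrs_def E_def doubleton_eq_iff\<close>)
    have inj: "inj_on (\<lambda>j. {i, j}) (nbrs H i)" by (auto simp: inj_on_def doubleton_eq_iff)
    have rest: "sq_gap (?upd t) e = sq_gap x e" if "i \<notin> e" for t e
      unfolding sq_gap_def using that by (metis fun_upd_image)
    have ni: "j \<noteq> i" if "j \<in> nbrs H i" for j using that adjD by (auto simp: nbrs_def)
    \<comment> \<open>The part of \<open>\<Phi>\<close> that depends on coordinate \<open>i\<close>.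
      The logarithm of the square has derivative \<open>2 / (t - x j)\<close> on either side of
      \<open>x j\<close>.\<close>
    define g where "g t = (\<Sum>j\<in>nbrs H i. s {i, j} * ln ((t - x j)\<^sup>2))" for t
    have \<Phi>_g: "\<Phi> (?upd t) = g t + (\<Sum>e\<in>{e \<in> E. i \<notin> e}. s e * ln (sq_gap x e))" for t
    proof -
      have "\<Phi> (?upd t) = (\<Sum>e\<in>?E1. s e * ln (sq_gap (?upd t) e)) + (\<Sum>e\<in>{e \<in> E. i \<notin> e}. s e * ln (sq_gap (?upd t) e))"
        unfolding \<Phi>_def using finE by (subst sum.union_disjoint[symmetric]) (auto intro!: sum.cong)
      also have "(\<Sum>e\<in>{e \<in> E. i \<notin> e}. s e * ln (sq_gap (?upd t) e)) = (\<Sum>e\<in>{e \<in> E. i \<notin> e}. s e * ln (sq_gap x e))"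
        using rest by (intro sum.cong) auto
      also have "(\<Sum>e\<in>?E1. s e * ln (sq_gap (?upd t) e)) = (\<Sum>j\<in>nbrs H i. s {i, j} * ln (sq_gap (?upd t) {i, j}))"
        unfolding E1 by (simp add: sum.reindex[OF inj])
      also have "\<dots> = g t" unfolding g_def
        using ni by (intro sum.cong refl) (simp add: sq_gap_pair)
      finally show ?thesis .
    qed
    have "eventually (\<lambda>t. \<forall>p\<in>ori. ?upd t (fst p) < ?upd t (snd p)) (at (x i))"
    proof (rule eventually_ball_finite)
      have "ori \<subseteq> V \<times> V" unfolding h(1) arcs_def by auto
      then show "finite ori" using finite_V finite_subset by blast
      show "\<forall>p\<in>ori. \<forall>\<^sub>F t in at (x i). ?upd t (fst p) < ?upd t (snd p)"
      proof
        fix p assume p: "p \<in> ori"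
        have lt: "x (fst p) < x (snd p)" using Ch_lt[OF xCh, of "fst p" "snd p"] p by simp
        have tl: "((\<lambda>t. ?upd t v) \<longlongrightarrow> x v) (at (x i))" for v
          by (cases "v = i") (auto intro: tendsto_eq_intros)
        show "\<forall>\<^sub>F t in at (x i). ?upd t (fst p) < ?upd t (snd p)"
          using order_tendstoD(1)[OF tendsto_diff[OF tl[of "snd p"] tl[of "fst p"]], of 0] lt
          by (simp only: diff_gt_0_iff_gt)
      qed
    qed
    then obtain d where d: "d > 0" "\<And>t. t \<noteq> x i \<Longrightarrow> dist t (x i) < d \<Longrightarrow> \<forall>p\<in>ori. ?upd t (fst p) < ?upd t (snd p)"
      unfolding eventually_at by blast
    have upd: "?upd t \<in> Ch" if "\<bar>x i - t\<bar> < d" for t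
    proof (cases "t = x i")
      case True
      then show ?thesis using xCh by simp
    next
      case False
      then have "\<forall>p\<in>ori. ?upd t (fst p) < ?upd t (snd p)" using d(2)[of t] that by (simp add: dist_real_def abs_minus_commute)
      then have "\<forall>(p, q)\<in>ori. ?upd t p < ?upd t q" by (simp only: case_prod_unfold)
      moreover have "?upd t a = 0" "?upd t b = 1" "\<forall>j. j \<notin> V \<longrightarrow> ?upd t j = 0"
        using xCh i unfolding Ch_def by auto
      ultimately show ?thesis unfolding Ch_def by blast
    qed
    have "g t \<le> g (x i)" if "\<bar>x i - t\<bar> < d" for t
      using max[OF upd[OF that]] \<Phi>_g[of t] \<Phi>_g[of "x i"] by simp
    moreover have "(g has_real_derivative (\<Sum>j\<in>nbrs H i. s {i, j} * (2 / (x i - x j)))) (at (x i))"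
      unfolding g_def
    proof (rule DERIV_sum)
      fix j assume "j \<in> nbrs H i"
      then have "x i - x j \<noteq> 0" by (rule xne)
      moreover from this have "(x i - x j)\<^sup>2 > 0" by simp
      ultimately show "((\<lambda>t. s {i, j} * ln ((t - x j)\<^sup>2)) has_real_derivative s {i, j} * (2 / (x i - x j))) (at (x i))"
        by (auto intro!: derivative_eq_intros simp: field_simps power2_eq_square)
    qed
    ultimately have "(\<Sum>j\<in>nbrs H i. s {i, j} * (2 / (x i - x j))) = 0"
      using DERIV_local_max[OF _ d(1)] by blast
    then have "2 * (\<Sum>j\<in>nbrs H i. s {i, j} / (x i - x j)) = 0"
      by (simp add: sum_distrib_left mult.commute)
    then show ?thesis by simp
  qed
  then have "x \<in> crit s" unfolding crit_def using xCh Ch_ne[OF xCh] unfolding Ch_def by blast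
  then show ?thesis using Ch_arcs[OF xCh] by blast
qed

section \<open>Critical points with equal coordinates\<close>

lemma bij_crit_bipolar:
  assumes "positive s"
  shows "bij_betw (arcs V) (crit s) (bipolar a b)"
  unfolding bij_betw_def
  using crit_unique[OF assms] crit_bipolar[OF assms] crit_exists[OF assms] by (fastforce simp: inj_on_def)

lemma finite_bipolar: "finite (bipolar a b)"
  unfolding bipolar_def using finite_sink_orients[OF finite_V] by simp

definition point :: "(nat set \<Rightarrow> real) \<Rightarrow> (nat \<times> nat) set \<Rightarrow> nat \<Rightarrow> real" where
  "point s ori = (THE x. x \<in> crit s \<and> arcs V x = ori)"

lemma point:
  assumes "positive s" "ori \<in> bipolar a b"
  shows "point s ori \<in> crit s" "arcs V (point s ori) = ori"
    "x \<in> crit s \<Longrightarrow> arcs V x = ori \<Longrightarrow> x = point s ori"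
proof -
  have "\<exists>!x. x \<in> crit s \<and> arcs V x = ori"
    using crit_exists[OF assms] crit_unique[OF assms(1)] by blast
  from theI'[OF this, folded point_def] show "point s ori \<in> crit s" "arcs V (point s ori) = ori" by auto
  then show "x \<in> crit s \<Longrightarrow> arcs V x = ori \<Longrightarrow> x = point s ori"
    using crit_unique[OF assms(1)] by blast
qed

text \<open>Indexed by orientations, not by points, so that collisions at different weights lie in
  one finite set and can be compared by inclusion.\<close>

definition collisions :: "(nat set \<Rightarrow> real) \<Rightarrow> ((nat \<times> nat) set \<times> nat \<times> nat) set" where
  "collisions s = {(ori, p, q). ori \<in> bipolar a b \<and> p \<in> V \<and> q \<in> V \<and> p \<noteq> q \<and> point s ori p = point s ori q}"

lemma finite_collisions: "finite (collisions s)"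
  by (rule finite_subset[of _ "bipolar a b \<times> V \<times> V"])
    (use finite_bipolar finite_V in \<open>auto simp: collisions_def\<close>)

text \<open>The critical point of a fixed chamber depends continuously on the weights: a subsequence
  converges to a critical point in the same chamber, which is unique.\<close>

lemma collisions_closed:
  assumes pos: "\<And>k. positive (S k)" "positive s"
    and lim: "\<And>e. e \<in> H - {{a, b}} \<Longrightarrow> (\<lambda>k. S k e) \<longlonglongrightarrow> s e"
    and col: "\<And>k. c \<in> collisions (S k)"
  shows "c \<in> collisions s"
proof -
  obtain ori p q where c: "c = (ori, p, q)" by (cases c) auto
  have bip: "ori \<in> bipolar a b" and pq: "p \<in> V" "q \<in> V" "p \<noteq> q"
    and eq: "\<And>k. point (S k) ori p = point (S k) ori q"
    using col unfolding c collisions_def by auto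
  note pt = point[OF pos(1) bip]
  obtain r x where r: "strict_mono r" "x \<in> crit s" "\<forall>i. (\<lambda>k. point (S (r k)) ori i) \<longlonglongrightarrow> x i"
    using crit_limit[OF pos lim, of "\<lambda>k. point (S k) ori"] pt(1) by blast
  have "arcs V x = ori"
    using arcs_limit[of "\<lambda>k. point (S (r k)) ori", OF pt(2)] r(2,3) bipolar_orients[OF bip] critD(4)[OF r(2)] by blast
  then have "x = point s ori" using point(3)[OF pos(2) bip] r(2) by blast
  moreover have "x p = x q"
  proof (rule LIMSEQ_unique)
    show "(\<lambda>k. point (S (r k)) ori p) \<longlonglongrightarrow> x p" using r(3) by blast
    show "(\<lambda>k. point (S (r k)) ori p) \<longlonglongrightarrow> x q" unfolding eq using r(3) by blast
  qed
  ultimately show ?thesis unfolding c collisions_def using bip pq by simp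
qed

text \<open>Move \<^term>\<open>x p\<close> and rescale the weights at \<^term>\<open>p\<close> so that every quotient
  \<open>s\<^sub>i\<^sub>j / (x\<^sub>i - x\<^sub>j)\<close> is unchanged.\<close>
lemma perturb:
  assumes pos: "positive s" and bip: "ori \<in> bipolar a b"
    and pq: "p \<in> V" "q \<in> V" "p \<noteq> q" "p \<noteq> a" "p \<noteq> b" and eq: "point s ori p = point s ori q"
  shows "\<exists>S. (\<forall>e. (\<lambda>k. S k e) \<longlonglongrightarrow> s e) \<and>
    (\<forall>\<^sub>F k in sequentially. positive (S k) \<longrightarrow> (ori, p, q) \<notin> collisions (S k))"
proof -
  define x where "x = point s ori"
  have x: "x \<in> crit s" "arcs V x = ori" unfolding x_def using point(1,2)[OF pos bip] by blast+
  define X where "X k = x(p := x p + inverse (real (Suc k)))" for k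
  have lX: "(\<lambda>k. X k i) \<longlonglongrightarrow> x i" for i
  proof (cases "i = p")
    case True
    then show ?thesis unfolding X_def using LIMSEQ_inverse_real_of_nat_add[of "x p"] by simp
  qed (simp add: X_def)
  \<comment> \<open>\<open>the_elem (e - {p})\<close> is the other end of an edge at
    \<open>p\<close>; the factor is the new difference over the old one.\<close>
  define S where "S k e = (if p \<in> e then s e * ((X k p - x (the_elem (e - {p}))) / (x p - x (the_elem (e - {p})))) else s e)" for k e
  have S_edge: "S k {i, j} / (X k i - X k j) = s {i, j} / (x i - x j)"
    if e: "{i, j} \<in> H" "X k i \<noteq> X k j" for k i j
  proof -
    have ij: "i \<noteq> j" "x i \<noteq> x j" using adjD[OF e(1)] critD(4)[OF x(1) e(1)] by auto
    consider "i = p" | "j = p" | "i \<noteq> p" "j \<noteq> p" by blast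
    then show ?thesis
    proof cases
      case 1
      then have "{i, j} - {p} = {j}" using ij by auto
      moreover have "X k j = x j" using 1 ij by (simp add: X_def)
      ultimately show ?thesis using 1 e(2) ij unfolding S_def by simp
    next
      case 2
      then have "{i, j} - {p} = {i}" using ij by auto
      moreover have xi: "X k i = x i" using 2 ij by (simp add: X_def)
      ultimately have "S k {i, j} = s {i, j} * ((X k p - x i) / (x p - x i))"
        using 2 unfolding S_def by simp
      then have "S k {i, j} / (X k i - X k j) = s {i, j} * ((X k p - x i) / (x p - x i)) / (x i - X k p)"
        using 2 xi by simp
      also have "(X k p - x i) / (x p - x i) = (x i - X k p) / (x i - x p)"
        by (metis minus_diff_eq minus_divide_divide)
      also have "s {i, j} * ((x i - X k p) / (x i - x p)) / (x i - X k p) = s {i, j} / (x i - x p)"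
        using 2 xi e(2) by simp
      finally show ?thesis using 2 by simp
    next
      case 3
      then show ?thesis unfolding S_def X_def by simp
    qed
  qed
  have lS: "(\<lambda>k. S k e) \<longlonglongrightarrow> s e" if e: "e \<in> H" for e
  proof (cases "p \<in> e")
    case True
    obtain i j where ij: "e = {i, j}" "i \<noteq> j" using edge_cases[OF e] by blast
    obtain w where w: "e = {p, w}" "w \<noteq> p" using True ij by auto
    then have "e - {p} = {w}" by auto
    then have "S k e = s e * ((X k p - x w) / (x p - x w))" for k using True unfolding S_def by simp
    moreover have ne: "x p - x w \<noteq> 0" using critD(4)[OF x(1), of p w] w e by auto
    moreover have "(\<lambda>k. s e * ((X k p - x w) / (x p - x w))) \<longlonglongrightarrow> s e * ((x p - x w) / (x p - x w))"
      by (intro tendsto_intros lX ne)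
    ultimately show ?thesis by simp
  qed (simp add: S_def)
  \<comment> \<open>On sets that are not edges the formula for \<open>S\<close> has no meaning,
    while convergence is claimed for every \<open>e\<close>.\<close>
  define S' where "S' k e = (if e \<in> H then S k e else s e)" for k e
  have "eventually (\<lambda>k. \<forall>(i, j)\<in>ori. X k i < X k j) sequentially"
  proof (rule eventually_ball_finite)
    have "ori \<subseteq> V \<times> V" unfolding x(2)[symmetric] arcs_def by auto
    then show "finite ori" using finite_V finite_subset by blast
    show "\<forall>e\<in>ori. \<forall>\<^sub>F k in sequentially. case e of (i, j) \<Rightarrow> X k i < X k j"
    proof clarify
      fix i j assume "(i, j) \<in> ori"
      then have "x i < x j" unfolding x(2)[symmetric] arcs_def by auto
      then show "\<forall>\<^sub>F k in sequentially. X k i < X k j"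
        using order_tendstoD(1)[OF tendsto_diff[OF lX[of j] lX[of i]], of 0] by (simp only: diff_gt_0_iff_gt)
    qed
  qed
  then have "\<forall>\<^sub>F k in sequentially. positive (S' k) \<longrightarrow> (ori, p, q) \<notin> collisions (S' k)"
  proof eventually_elim
    case (elim k)
    have lt: "X k i < X k j" if "(i, j) \<in> ori" for i j using elim that by blast
    have ne: "X k i \<noteq> X k j" if "{i, j} \<in> H" for i j
      using orient_total[OF bipolar_orients[OF bip] that] lt by force
    have ar: "arcs V (X k) = ori"
    proof (intro set_eqI iffI; clarify)
      fix i j assume "(i, j) \<in> arcs V (X k)"
      then have "{i, j} \<in> H" "X k i < X k j" unfolding arcs_def by auto
      then show "(i, j) \<in> ori" using orient_total[OF bipolar_orients[OF bip]] lt[of j i] by fastforce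
    next
      fix i j assume "(i, j) \<in> ori"
      then show "(i, j) \<in> arcs V (X k)"
        using lt orient_edge[OF bipolar_orients[OF bip]] adjD unfolding arcs_def by blast
    qed
    have "(\<Sum>j\<in>nbrs H i. S' k {i, j} / (X k i - X k j)) = (\<Sum>j\<in>nbrs H i. s {i, j} / (x i - x j))" for i
      using S_edge ne by (intro sum.cong refl) (auto simp: nbrs_def S'_def)
    then have "X k \<in> crit (S' k)"
      using critD(1,2,3,5)[OF x(1)] ne pq unfolding crit_def by (auto simp: X_def)
    then have pt: "X k = point (S' k) ori" if "positive (S' k)" using point(3)[OF that bip] ar by blast
    have "X k p \<noteq> X k q" using pq eq unfolding X_def x_def by simp
    then show ?case using pt unfolding collisions_def by auto
  qed
  moreover have "(\<lambda>k. S' k e) \<longlonglongrightarrow> s e" for e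
    using lS[of e] unfolding S'_def by (cases "e \<in> H") auto
  ultimately show ?thesis by blast
qed

text \<open>A member of \<open>T\<close> with the fewest collisions has none: \<open>perturb\<close>
  removes one collision at arbitrarily near weights, which stay in \<open>T\<close>, and
  \<open>collisions_closed\<close> prevents new ones. \<open>T\<close> only has to be sequentially
  open.\<close>

lemma collision_free:
  assumes T: "T \<noteq> {}" "\<And>s. s \<in> T \<Longrightarrow> positive s"
    and op: "\<And>s S. s \<in> T \<Longrightarrow> (\<And>e. (\<lambda>k. S k e) \<longlonglongrightarrow> s e) \<Longrightarrow> \<forall>\<^sub>F k in sequentially. S k \<in> T"
  shows "\<exists>s\<in>T. \<forall>x\<in>crit s. inj_on x V"
proof -
  obtain s where s: "s \<in> T" "\<And>s'. s' \<in> T \<Longrightarrow> card (collisions s) \<le> card (collisions s')"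
    using ex_has_least_nat[of "\<lambda>s. s \<in> T" _ "\<lambda>s. card (collisions s)"] T(1) by blast
  note pos = T(2)[OF s(1)]
  have "collisions s = {}"
  proof (rule ccontr)
    assume "collisions s \<noteq> {}"
    then obtain ori p0 q0 where c0: "(ori, p0, q0) \<in> collisions s" by auto
    then have bip: "ori \<in> bipolar a b" unfolding collisions_def by auto
    note cD = critD(1,2)[OF point(1)[OF pos bip]]
    \<comment> \<open>Of two colliding vertices at least one is not pinned, since \<open>a\<close>
      and \<open>b\<close> have different values.\<close>
    obtain p q where c: "(ori, p, q) \<in> collisions s" "p \<noteq> a" "p \<noteq> b"
    proof (cases "p0 = a \<or> p0 = b")
      case True
      then have "q0 \<noteq> a" "q0 \<noteq> b" using c0 cD unfolding collisions_def by auto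
      moreover have "(ori, q0, p0) \<in> collisions s" using c0 unfolding collisions_def by auto
      ultimately show thesis using that by blast
    next
      case False
      then show thesis using that c0 by blast
    qed
    obtain S where S: "\<And>e. (\<lambda>k. S k e) \<longlonglongrightarrow> s e"
      "\<forall>\<^sub>F k in sequentially. positive (S k) \<longrightarrow> (ori, p, q) \<notin> collisions (S k)"
      using perturb[OF pos bip, of p q] c unfolding collisions_def by auto
    have evT: "\<forall>\<^sub>F k in sequentially. S k \<in> T" using op[OF s(1)] S(1) by blast
    have ev: "\<forall>\<^sub>F k in sequentially. \<forall>d \<in> bipolar a b \<times> V \<times> V. d \<notin> collisions s \<longrightarrow> d \<notin> collisions (S k)"
    proof (rule eventually_ball_finite)
      show "finite (bipolar a b \<times> V \<times> V)" using finite_bipolar finite_V by simp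
      show "\<forall>d\<in>bipolar a b \<times> V \<times> V. \<forall>\<^sub>F k in sequentially. d \<notin> collisions s \<longrightarrow> d \<notin> collisions (S k)"
      \<comment> \<open>Otherwise \<open>d\<close> would be a collision along a subsequence, hence
        also at \<open>s\<close>.\<close>
      proof (rule ballI, rule ccontr)
        fix d assume "\<not> (\<forall>\<^sub>F k in sequentially. d \<notin> collisions s \<longrightarrow> d \<notin> collisions (S k))"
        then have "\<not> (\<forall>\<^sub>F k in sequentially. S k \<in> T \<longrightarrow> (d \<notin> collisions s \<longrightarrow> d \<notin> collisions (S k)))"
          using evT eventually_mp[of "\<lambda>k. S k \<in> T" "\<lambda>k. d \<notin> collisions s \<longrightarrow> d \<notin> collisions (S k)"] by blast
        then obtain r where r: "strict_mono (r :: nat \<Rightarrow> nat)"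
          "\<And>k. \<not> (S (r k) \<in> T \<longrightarrow> (d \<notin> collisions s \<longrightarrow> d \<notin> collisions (S (r k))))"
          using not_eventually_sequentiallyD by blast
        have "(\<lambda>k. S (r k) e) \<longlonglongrightarrow> s e" for e
          using LIMSEQ_subseq_LIMSEQ[OF S(1) r(1)] by (simp add: comp_def)
        then have "d \<in> collisions s"
          using r(2) T(2) by (intro collisions_closed[of "\<lambda>k. S (r k)", OF _ pos]) blast+
        then show False using r(2) by blast
      qed
    qed
    have "\<forall>\<^sub>F k in sequentially. S k \<in> T \<and> collisions (S k) \<subset> collisions s"
      using evT ev S(2)
    proof eventually_elim
      case (elim k)
      have "collisions (S k) \<subseteq> bipolar a b \<times> V \<times> V" unfolding collisions_def by auto
      then show ?case using elim c(1) T(2) by blast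
    qed
    then obtain k where "S k \<in> T" "collisions (S k) \<subset> collisions s"
      using eventually_happens'[OF sequentially_bot] by blast
    then show False using s(2) psubset_card_mono[OF finite_collisions] by (metis not_less)
  qed
  then have "inj_on x V" if "x \<in> crit s" for x
  proof -
    have bip: "arcs V x \<in> bipolar a b" using crit_bipolar[OF pos that] .
    then have "x = point s (arcs V x)" using point(3)[OF pos bip that] by simp
    then show ?thesis using \<open>collisions s = {}\<close> bip unfolding collisions_def inj_on_def by force
  qed
  then show ?thesis using s(1) by blast
qed

end

section \<open>The fiber over the moduli space\<close>

text \<open>\<open>generic_on\<close> says nothing about the zero point, hence the extra factor
  \<open>s e\<close> for a coordinate that is not identically zero on \<open>K\<close>.\<close>

lemma generic_on_meet:
  assumes K: "line_closed K" and nz: "s1 \<in> K" "s1 e \<noteq> 0"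
    and "generic_on K P" "generic_on K Q"
  shows "\<exists>s\<in>K. P s \<and> Q s"
proof -
  obtain f s2 where f: "f \<in> polyfun" "s2 \<in> K" "f s2 \<noteq> 0" "\<And>s. s \<in> K \<Longrightarrow> \<exists>v. s v \<noteq> 0 \<Longrightarrow> f s \<noteq> 0 \<Longrightarrow> P s"
    using assms(4) unfolding generic_on_def by blast
  obtain g s3 where g: "g \<in> polyfun" "s3 \<in> K" "g s3 \<noteq> 0" "\<And>s. s \<in> K \<Longrightarrow> \<exists>v. s v \<noteq> 0 \<Longrightarrow> g s \<noteq> 0 \<Longrightarrow> Q s"
    using assms(5) unfolding generic_on_def by blast
  obtain s4 where s4: "s4 \<in> K" "f s4 * g s4 \<noteq> 0"
    using line_closed_mult_nonzero[OF K f(1) g(1) f(2,3) g(2,3)] by blast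
  obtain s where s: "s \<in> K" "f s * g s * s e \<noteq> 0"
    using line_closed_mult_nonzero[OF K polyfun.pf_mult[OF f(1) g(1)] polyfun.pf_var s4 nz] by blast
  then have "\<exists>v. s v \<noteq> 0" "f s \<noteq> 0" "g s \<noteq> 0" by auto
  then show ?thesis using s(1) by (intro bexI[of _ s] conjI f(4) g(4))
qed

locale universal_graph =
  fixes n :: nat and G :: "nat set set" and V H
  assumes n4: "n \<ge> 4" and simple: "simple_graph n G" and univ: "\<forall>i\<in>{1..<n}. {i, n} \<in> G"
    and V_def: "V = {1..<n}" and H_def: "H = {e \<in> G. n \<notin> e}"

sublocale universal_graph \<subseteq> finite_graph V H
proof
  show "finite V" unfolding V_def by simp
  show "H \<subseteq> {{i, j} |i j. i \<in> V \<and> j \<in> V \<and> i \<noteq> j}"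
  proof
    fix e assume e: "e \<in> H"
    then obtain i j where ij: "e = {i, j}" "i \<in> {1..n}" "j \<in> {1..n}" "i \<noteq> j" "n \<notin> e"
      using simple unfolding simple_graph_def H_def by blast
    then have "i \<in> V" "j \<in> V" unfolding V_def by force+
    then show "e \<in> {{i, j} |i j. i \<in> V \<and> j \<in> V \<and> i \<noteq> j}" using ij by blast
  qed
qed

section \<open>The scattering equations with vertex \<open>n\<close> at infinity\<close>

context universal_graph
begin

lemma n_notin_V [simp]: "n \<notin> V" unfolding V_def by simp

lemma verts: "{1..n} = insert n V" unfolding V_def using n4 by auto

lemma G_adj: "{i, j} \<in> G \<Longrightarrow> i \<in> insert n V \<and> j \<in> insert n V \<and> i \<noteq> j"
  using simple unfolding simple_graph_def verts[symmetric] by (fastforce simp: doubleton_eq_iff)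

lemma nbrs_G: "i \<in> V \<Longrightarrow> nbrs G i = insert n (nbrs H i)"
  using univ G_adj unfolding nbrs_def V_def H_def by auto

lemma n_notin_nbrs [simp]: "n \<notin> nbrs H i"
  using nbrs_subset n_notin_V by blast

lemma nbrs_G_n: "nbrs G n = V"
proof -
  have "{n, j} \<in> G" if "j \<in> V" for j
    using univ that unfolding V_def by (simp add: insert_commute)
  then show ?thesis using G_adj[of n] unfolding nbrs_def by auto
qed

text \<open>The equation at \<open>i\<close> determines the weight of \<open>{i, n}\<close>. The
  equation at \<open>n\<close> then says that the total weight of \<open>H\<close> is zero.\<close>

lemma kin_space_iff:
  "s \<in> kin_space n G \<longleftrightarrow> (\<forall>e. e \<notin> G \<longrightarrow> s e = 0) \<and>
    (\<forall>i\<in>V. s {i, n} = - (\<Sum>j\<in>nbrs H i. s {i, j})) \<and> (\<Sum>i\<in>V. \<Sum>j\<in>nbrs H i. s {i, j}) = 0"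
proof -
  have "(\<forall>i\<in>V. (\<Sum>j\<in>nbrs G i. s {i, j}) = 0) \<longleftrightarrow> (\<forall>i\<in>V. s {i, n} = - (\<Sum>j\<in>nbrs H i. s {i, j}))"
    by (intro ball_cong refl) (simp add: nbrs_G eq_neg_iff_add_eq_0)
  moreover have "(\<Sum>j\<in>V. s {n, j}) = - (\<Sum>i\<in>V. \<Sum>j\<in>nbrs H i. s {i, j})"
    if "\<forall>i\<in>V. s {i, n} = - (\<Sum>j\<in>nbrs H i. s {i, j})"
  proof -
    have "(\<Sum>j\<in>V. s {n, j}) = (\<Sum>i\<in>V. - (\<Sum>j\<in>nbrs H i. s {i, j}))"
      using that by (intro sum.cong refl) (simp add: insert_commute)
    then show ?thesis by (simp add: sum_negf)
  qed
  ultimately show ?thesis unfolding kin_space_def verts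
    by (auto simp: nbrs_G_n)
qed

lemma line_closed_kin: "line_closed (kin_space n G)"
  unfolding line_closed_def kin_space_def
  by (auto simp: sum.distrib sum_distrib_left[symmetric] sum_subtractf)

lemma configD:
  assumes "x \<in> config_space n"
  shows "i \<in> insert n V \<Longrightarrow> j \<in> insert n V \<Longrightarrow> i \<noteq> j \<Longrightarrow> x i \<noteq> x j"
    "i \<notin> insert n V \<Longrightarrow> x i = 0"
  using assms unfolding config_space_def verts by auto

text \<open>With \<open>s {i, n}\<close> eliminated,
  \<open>1 / (x i - x j) - 1 / (x i - x n)\<close> is \<open>1 / (z i - z j)\<close> up to a factor
  depending on \<open>i\<close> alone. The equation at \<open>n\<close> is minus the sum of the
  others. Free \<open>c\<close> and \<open>d\<close> leave the normalisation of \<open>z\<close>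
  open.\<close>

lemma scat_eqs_iff:
  assumes s: "s \<in> kin_space n G" and x: "x \<in> config_space n" and c: "c \<noteq> 0"
    and z: "\<And>i. i \<in> V \<Longrightarrow> z i = c / (x i - x n) + d"
  shows "scat_eqs n G s x \<longleftrightarrow> (\<forall>i\<in>V. (\<Sum>j\<in>nbrs H i. s {i, j} / (z i - z j)) = 0)"
proof -
  define E where "E i = (\<Sum>j\<in>nbrs G i. s {i, j} / (x i - x j))" for i
  note kin = s[unfolded kin_space_iff]
  have inv_diff: "1 / (x i - x j) - 1 / (x i - x n) = - (c / (x i - x n)\<^sup>2) * (1 / (z i - z j))"
    if "i \<in> V" "j \<in> V" "i \<noteq> j" for i j
  proof -
    define u v where "u = x i - x n" and "v = x j - x n"
    have ne: "u \<noteq> 0" "v \<noteq> 0" "u - v \<noteq> 0" "v - u \<noteq> 0"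
      using configD(1)[OF x] that n_notin_V unfolding u_def v_def by force+
    have "z i - z j = c / u - c / v"
      unfolding z[OF that(1)] z[OF that(2)] u_def v_def by simp
    also have "\<dots> = c * (v - u) / (u * v)" using ne by (simp add: field_simps)
    finally have "- (c / u\<^sup>2) * (1 / (z i - z j)) = - (v / (u * (v - u)))"
      using ne c by (simp add: power2_eq_square)
    also have "\<dots> = 1 / (u - v) - 1 / u"
      using ne by (simp add: field_simps)
    finally show ?thesis unfolding u_def v_def by simp
  qed
  have E_V: "E i = - (c / (x i - x n)\<^sup>2) * (\<Sum>j\<in>nbrs H i. s {i, j} / (z i - z j))" if i: "i \<in> V" for i
  proof -
    have "E i = s {i, n} / (x i - x n) + (\<Sum>j\<in>nbrs H i. s {i, j} / (x i - x j))"
      unfolding E_def nbrs_G[OF i] by simp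
    also have "s {i, n} = - (\<Sum>j\<in>nbrs H i. s {i, j})" using kin i by blast
    also have "- (\<Sum>j\<in>nbrs H i. s {i, j}) / (x i - x n) + (\<Sum>j\<in>nbrs H i. s {i, j} / (x i - x j)) =
        (\<Sum>j\<in>nbrs H i. s {i, j} * (1 / (x i - x j) - 1 / (x i - x n)))"
      by (simp add: sum_divide_distrib sum_subtractf algebra_simps)
    also have "\<dots> = (\<Sum>j\<in>nbrs H i. s {i, j} * (- (c / (x i - x n)\<^sup>2) * (1 / (z i - z j))))"
    proof (intro sum.cong refl)
      fix j assume "j \<in> nbrs H i"
      then have "j \<in> V" "i \<noteq> j" using adjD[of i j] by (auto simp: nbrs_def)
      then show "s {i, j} * (1 / (x i - x j) - 1 / (x i - x n)) = s {i, j} * (- (c / (x i - x n)\<^sup>2) * (1 / (z i - z j)))"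
        using inv_diff[OF i] by simp
    qed
    also have "\<dots> = - (c / (x i - x n)\<^sup>2) * (\<Sum>j\<in>nbrs H i. s {i, j} / (z i - z j))"
      unfolding sum_distrib_left by (intro sum.cong refl) simp
    finally show ?thesis .
  qed
  have E_n: "E n = - (\<Sum>i\<in>V. E i)"
  proof -
    define F where "F i j = s {i, j} / (x i - x j)" for i j
    have anti: "F j i = - F i j" for i j
      unfolding F_def using div_antisym[of "s {i, j}" "x j" "x i"] by (simp add: insert_commute)
    have "2 * (\<Sum>i\<in>V. \<Sum>j\<in>nbrs H i. 1 * F i j) = (\<Sum>i\<in>V. \<Sum>j\<in>nbrs H i. (1 - 1) * F i j)"
      by (rule sum_antisym) (rule anti)
    then have "(\<Sum>i\<in>V. \<Sum>j\<in>nbrs H i. F i j) = 0" by simp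
    moreover have "(\<Sum>i\<in>V. E i) = (\<Sum>i\<in>V. F i n + (\<Sum>j\<in>nbrs H i. F i j))"
      unfolding E_def F_def by (intro sum.cong refl) (simp add: nbrs_G)
    moreover have "E n = (\<Sum>i\<in>V. F n i)"
      unfolding E_def nbrs_G_n F_def ..
    moreover have "(\<Sum>i\<in>V. F n i) = (\<Sum>i\<in>V. - F i n)"
      by (intro sum.cong refl anti)
    ultimately show ?thesis by (simp add: sum.distrib sum_negf)
  qed
  have "E i = 0 \<longleftrightarrow> (\<Sum>j\<in>nbrs H i. s {i, j} / (z i - z j)) = 0" if "i \<in> V" for i
  proof -
    have "x i - x n \<noteq> 0" using configD(1)[OF x, of i n] that n_notin_V by force
    then show ?thesis unfolding E_V[OF that] using c by simp
  qed
  then show ?thesis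
    unfolding scat_eqs_def verts using E_n unfolding E_def[symmetric] by auto
qed

lemma config_ne:
  assumes x: "x \<in> config_space n" and ab: "a \<in> V" "b \<in> V" "a \<noteq> b"
  shows "x a \<noteq> x n" "x b \<noteq> x n" "x a \<noteq> x b"
proof -
  have "a \<noteq> n" "b \<noteq> n" using ab n_notin_V by metis+
  then show "x a \<noteq> x n" "x b \<noteq> x n" "x a \<noteq> x b"
    using configD(1)[OF x, of a n] configD(1)[OF x, of b n] configD(1)[OF x, of a b] ab by auto
qed

text \<open>The cross ratio sending \<^term>\<open>x a\<close>, \<^term>\<open>x b\<close>, \<^term>\<open>x n\<close> to 0, 1, infinity.\<close>
definition cross_ratio :: "nat \<Rightarrow> nat \<Rightarrow> (nat \<Rightarrow> complex) \<Rightarrow> nat \<Rightarrow> complex" where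
  "cross_ratio a b x i = (if i \<in> V then (x i - x a) * (x b - x n) / ((x i - x n) * (x b - x a)) else 0)"

lemma cross_ratio_affine:
  assumes x: "x \<in> config_space n" and ab: "a \<in> V" "b \<in> V" "a \<noteq> b"
  shows "\<exists>c d. c \<noteq> 0 \<and> (\<forall>i\<in>V. cross_ratio a b x i = c / (x i - x n) + d)"
proof -
  define k where "k = (x b - x n) / (x b - x a)"
  have ne: "x b - x n \<noteq> 0" "x b - x a \<noteq> 0" "x n - x a \<noteq> 0"
    using configD(1)[OF x] ab n_notin_V by force+
  have "cross_ratio a b x i = k * (x n - x a) / (x i - x n) + k" if i: "i \<in> V" for i
  proof -
    have nz: "x i - x n \<noteq> 0" using configD(1)[OF x, of i n] i n_notin_V by force
    have "cross_ratio a b x i = k * ((x i - x a) / (x i - x n))" using i unfolding cross_ratio_def k_def by (simp add: mult.commute)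
    also have "(x i - x a) / (x i - x n) = (x n - x a) / (x i - x n) + 1"
      using nz by (simp add: field_simps)
    finally show ?thesis by (simp add: algebra_simps)
  qed
  moreover have "k * (x n - x a) \<noteq> 0" using ne unfolding k_def by simp
  ultimately show ?thesis by blast
qed

lemma cross_ratio_0_1:
  assumes x: "x \<in> config_space n" and ab: "a \<in> V" "b \<in> V" "a \<noteq> b"
  shows "cross_ratio a b x a = 0" "cross_ratio a b x b = 1"
proof -
  have ne: "x b - x n \<noteq> 0" "x b - x a \<noteq> 0" using configD(1)[OF x] ab n_notin_V by force+
  then show "cross_ratio a b x a = 0" "cross_ratio a b x b = 1"
    using ab unfolding cross_ratio_def by auto
qed

lemma cross_ratio_fiber:
  assumes s: "s \<in> kin_space n G" and ab: "a \<in> V" "b \<in> V" "a \<noteq> b"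
  shows "cross_ratio a b ` fiber n G s = solutions a b s"
proof (intro set_eqI iffI)
  fix z assume "z \<in> cross_ratio a b ` fiber n G s"
  then obtain x where x: "x \<in> config_space n" "scat_eqs n G s x" and z: "z = cross_ratio a b x"
    unfolding fiber_def by blast
  obtain c d where cd: "c \<noteq> 0" "\<And>i. i \<in> V \<Longrightarrow> z i = c / (x i - x n) + d"
    using cross_ratio_affine[OF x(1) ab] z by blast
  have "inj_on z V"
  proof (rule inj_onI, rule ccontr)
    fix i j assume ij: "i \<in> V" "j \<in> V" "z i = z j" "i \<noteq> j"
    have "x i - x n \<noteq> 0" "x j - x n \<noteq> 0" "x i \<noteq> x j"
      using configD(1)[OF x(1)] ij n_notin_V by force+
    then show False using ij cd by (simp add: field_simps)
  qed
  moreover have "z i = 0" if "i \<notin> V" for i using that z unfolding cross_ratio_def by simp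
  ultimately show "z \<in> solutions a b s"
    using cross_ratio_0_1[OF x(1) ab] scat_eqs_iff[OF s x(1) cd] x(2) unfolding solutions_def z by blast
next
  fix z assume "z \<in> solutions a b s"
  then have z: "z a = 0" "z b = 1" "\<And>i. i \<notin> V \<Longrightarrow> z i = 0" "inj_on z V"
    "\<forall>i\<in>V. (\<Sum>j\<in>nbrs H i. s {i, j} / (z i - z j)) = 0" unfolding solutions_def by auto
  \<comment> \<open>Configurations are affine, so \<open>n\<close> has to be brought back from
    infinity: the map z to 1 / (z - w) sends infinity to 0 and keeps all other points
    finite.\<close>
  obtain w where "w \<notin> z ` V"
    using ex_new_if_finite[OF infinite_UNIV_char_0 finite_imageI[OF finite_V]] by blast
  then have w: "z i - w \<noteq> 0" if "i \<in> V" for i using that by auto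
  define x where "x i = (if i \<in> V then 1 / (z i - w) else 0)" for i
  have xn: "x n = 0" unfolding x_def by simp
  have x: "x \<in> config_space n"
    unfolding config_space_def verts
  proof (intro CollectI conjI ballI impI allI)
    fix i j assume "i \<in> insert n V" "j \<in> insert n V" "i \<noteq> j"
    then show "x i \<noteq> x j" using w z(4) xn unfolding x_def by (auto dest: inj_onD)
  qed (simp add: x_def)
  obtain c d where cd: "c \<noteq> 0" "\<And>i. i \<in> V \<Longrightarrow> cross_ratio a b x i = c / (x i - x n) + d"
    using cross_ratio_affine[OF x ab] by blast
  have lin: "cross_ratio a b x i = c * (z i - w) + d" if "i \<in> V" for i
    using cd(2)[OF that] w[OF that] that unfolding xn by (simp add: x_def)
  \<comment> \<open>An affine map of \<open>z\<close> that fixes 0 and 1 is the identity.\<close>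
  have "- c * w + d = 0" "c * (1 - w) + d = 1"
    using lin[OF ab(1)] lin[OF ab(2)] cross_ratio_0_1[OF x ab] z(1,2) by auto
  then have "d = c * w" "c = 1" by (auto simp: algebra_simps)
  then have eq: "cross_ratio a b x i = z i" for i
    using lin[of i] z(3)[of i] by (cases "i \<in> V") (auto simp: cross_ratio_def)
  then have zz: "cross_ratio a b x = z" by (rule ext)
  have "scat_eqs n G s x"
    using scat_eqs_iff[OF s x cd] z(5) unfolding zz by blast
  then have "x \<in> fiber n G s" unfolding fiber_def using x by blast
  then show "z \<in> cross_ratio a b ` fiber n G s" using zz by blast
qed

text \<open>Cross ratios with three reference points are complete invariants. For the converse the
  Moebius map is obtained by solving the equality of cross ratios for \<open>y i\<close>.\<close>

lemma moebius_equiv_iff: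
  assumes ab: "a \<in> V" "b \<in> V" "a \<noteq> b"
  shows "(x, y) \<in> moebius_equiv n \<longleftrightarrow>
    x \<in> config_space n \<and> y \<in> config_space n \<and> cross_ratio a b x = cross_ratio a b y"
proof (intro iffI conjI)
  assume L: "(x, y) \<in> moebius_equiv n"
  then show x: "x \<in> config_space n" and y: "y \<in> config_space n" unfolding moebius_equiv_def by auto
  obtain p q r t where det: "p * t - q * r \<noteq> 0"
    and m: "\<And>i. i \<in> insert n V \<Longrightarrow> r * x i + t \<noteq> 0 \<and> y i = (p * x i + q) / (r * x i + t)"
    using L unfolding moebius_equiv_def verts by blast
  have diff: "y i - y j = (p * t - q * r) * (x i - x j) / ((r * x i + t) * (r * x j + t))"
    if "i \<in> insert n V" "j \<in> insert n V" for i j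
  proof -
    have d: "r * x i + t \<noteq> 0" "r * x j + t \<noteq> 0"
      and e: "y i = (p * x i + q) / (r * x i + t)" "y j = (p * x j + q) / (r * x j + t)"
      using m[OF that(1)] m[OF that(2)] by auto
    have "y i - y j = ((p * x i + q) * (r * x j + t) - (p * x j + q) * (r * x i + t)) / ((r * x i + t) * (r * x j + t))"
      unfolding e by (rule diff_frac_eq[OF d])
    also have "(p * x i + q) * (r * x j + t) - (p * x j + q) * (r * x i + t) = (p * t - q * r) * (x i - x j)"
      by (simp add: algebra_simps)
    finally show ?thesis .
  qed
  show "cross_ratio a b x = cross_ratio a b y"
  proof
    fix i show "cross_ratio a b x i = cross_ratio a b y i"
    proof (cases "i \<in> V")
      case True
      have nz: "r * x i + t \<noteq> 0" "r * x a + t \<noteq> 0" "r * x b + t \<noteq> 0" "r * x n + t \<noteq> 0"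
        using m ab True by auto
      have df: "y i - y a = (p * t - q * r) * (x i - x a) / ((r * x i + t) * (r * x a + t))"
        "y b - y n = (p * t - q * r) * (x b - x n) / ((r * x b + t) * (r * x n + t))"
        "y i - y n = (p * t - q * r) * (x i - x n) / ((r * x i + t) * (r * x n + t))"
        "y b - y a = (p * t - q * r) * (x b - x a) / ((r * x b + t) * (r * x a + t))"
        using diff ab True by auto
      show ?thesis using True unfolding cross_ratio_def df using nz det
        by simp
    qed (simp add: cross_ratio_def)
  qed
next
  assume "x \<in> config_space n \<and> y \<in> config_space n \<and> cross_ratio a b x = cross_ratio a b y"
  then have x: "x \<in> config_space n" and y: "y \<in> config_space n"
    and eq: "\<And>i. cross_ratio a b x i = cross_ratio a b y i" by auto
  \<comment> \<open>Cleared of denominators, the equality reads \<open>\<beta> * (x i - x a) * (y i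
    - y n) = \<alpha> * (y i - y a) * (x i - x n)\<close>; collecting terms in \<open>y i\<close>
    gives \<open>p\<close>, \<open>q\<close>, \<open>r\<close>, \<open>t\<close>.\<close>
  define \<alpha> \<beta> where "\<alpha> = (y b - y n) * (x b - x a)" and "\<beta> = (x b - x n) * (y b - y a)"
  have nz: "\<alpha> \<noteq> 0" "\<beta> \<noteq> 0" "y a - y n \<noteq> 0" "x a - x n \<noteq> 0"
    unfolding \<alpha>_def \<beta>_def using config_ne[OF x ab] config_ne[OF y ab] by auto
  define p q r t where "p = \<alpha> * y a - \<beta> * y n" and "q = \<beta> * y n * x a - \<alpha> * y a * x n"
    and "r = \<alpha> - \<beta>" and "t = \<beta> * x a - \<alpha> * x n"
  have "p * t - q * r = \<alpha> * \<beta> * (y a - y n) * (x a - x n)"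
    unfolding p_def q_def r_def t_def by (simp add: algebra_simps)
  then have det: "p * t - q * r \<noteq> 0" using nz by simp
  have den: "r * x i + t = \<alpha> * (x i - x n) - \<beta> * (x i - x a)" for i
    unfolding r_def t_def by (simp add: algebra_simps)
  have num: "p * x i + q = \<alpha> * y a * (x i - x n) - \<beta> * y n * (x i - x a)" for i
    unfolding p_def q_def by (simp add: algebra_simps)
  have "r * x i + t \<noteq> 0 \<and> y i = (p * x i + q) / (r * x i + t)" if i: "i \<in> insert n V" for i
  proof (cases "i = n")
    case True
    have "x n - x a \<noteq> 0" using nz(4) by auto
    then show ?thesis using nz unfolding den num True by simp
  next
    case False
    then have iV: "i \<in> V" using i by simp
    have "i \<noteq> n" using iV n_notin_V by metis
    then have ne: "x i - x n \<noteq> 0" "y i - y n \<noteq> 0" "x b - x a \<noteq> 0" "y b - y a \<noteq> 0"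
      "x b - x n \<noteq> 0" "y b - y n \<noteq> 0"
      using configD(1)[OF x, of i n] configD(1)[OF y, of i n] config_ne[OF x ab] config_ne[OF y ab] iV by auto
    have cr: "\<beta> * (x i - x a) * (y i - y n) = \<alpha> * (y i - y a) * (x i - x n)"
      using eq[of i] iV ne unfolding cross_ratio_def \<alpha>_def \<beta>_def by (simp add: frac_eq_eq ac_simps)
    have "(r * x i + t) * (y i - y n) = \<alpha> * (x i - x n) * (y i - y n) - \<beta> * (x i - x a) * (y i - y n)"
      unfolding den by (simp add: algebra_simps)
    also have "\<dots> = \<alpha> * (x i - x n) * (y a - y n)"
      unfolding cr by (simp add: algebra_simps)
    finally have "(r * x i + t) * (y i - y n) \<noteq> 0" using nz ne by simp
    then have d: "r * x i + t \<noteq> 0" by auto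
    have "y i * (r * x i + t) - (p * x i + q) = \<alpha> * (y i - y a) * (x i - x n) - \<beta> * (x i - x a) * (y i - y n)"
      unfolding den num by (simp add: algebra_simps)
    also have "\<dots> = 0" unfolding cr by simp
    finally have "y i * (r * x i + t) = p * x i + q" by simp
    then show ?thesis using d by (simp add: eq_divide_eq)
  qed
  then show "(x, y) \<in> moebius_equiv n"
    unfolding moebius_equiv_def verts using x y det by blast
qed

text \<open>The Moebius classes are level sets of \<open>cross_ratio a b\<close>, and each level in
  \<open>solutions a b s\<close> is attained by a fiber point.\<close>

lemma bij_fiber_M0n:
  assumes s: "s \<in> kin_space n G" and ab: "a \<in> V" "b \<in> V" "a \<noteq> b"
  shows "bij_betw (\<lambda>z. {y \<in> config_space n. cross_ratio a b y = z}) (solutions a b s) (fiber_M0n n G s)"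
proof -
  let ?K = "\<lambda>z. {y \<in> config_space n. cross_ratio a b y = z}"
  have im: "moebius_equiv n `` {x} = ?K (cross_ratio a b x)" if "x \<in> fiber n G s" for x
  proof (rule set_eqI)
    fix y
    have "x \<in> config_space n" using that unfolding fiber_def by blast
    then show "y \<in> moebius_equiv n `` {x} \<longleftrightarrow> y \<in> ?K (cross_ratio a b x)"
      unfolding Image_singleton_iff moebius_equiv_iff[OF ab] mem_Collect_eq by metis
  qed
  have "fiber_M0n n G s = (\<lambda>x. moebius_equiv n `` {x}) ` fiber n G s"
    unfolding fiber_M0n_def quotient_def by blast
  also have "\<dots> = (\<lambda>x. ?K (cross_ratio a b x)) ` fiber n G s"
    using im by (rule image_cong[OF refl])
  also have "\<dots> = ?K ` solutions a b s"
    unfolding cross_ratio_fiber[OF s ab, symmetric] image_image ..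
  finally have "fiber_M0n n G s = ?K ` solutions a b s" .
  moreover have "inj_on ?K (solutions a b s)"
  proof (rule inj_onI)
    fix z z' assume z: "z \<in> solutions a b s" "?K z = ?K z'"
    then obtain x where "x \<in> fiber n G s" "z = cross_ratio a b x"
      unfolding cross_ratio_fiber[OF s ab, symmetric] by blast
    then have "x \<in> ?K z" unfolding fiber_def by blast
    then have "x \<in> ?K z'" using z(2) by blast
    then show "z = z'" using \<open>x \<in> ?K z\<close> by blast
  qed
  ultimately show ?thesis unfolding bij_betw_def by blast
qed

text \<open>Otherwise the image is empty, and the constant 1, which vanishes on it, would vanish on
  all configurations.\<close>

lemma dominant_nonzero:
  assumes "scat_dominant n G"
  shows "\<exists>s\<in>kin_space n G. \<exists>e. s e \<noteq> 0"
proof (rule ccontr)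
  assume "\<not> ?thesis"
  then have "\<forall>x\<in>config_space n. (1::complex) = 0"
    using bspec[OF assms[unfolded scat_dominant_def] polyfun.pf_const[of 1]] by blast
  moreover have "(\<lambda>i. if i \<in> {1..n} then of_nat i else 0) \<in> config_space n"
    unfolding config_space_def by auto
  ultimately show False by auto
qed

text \<open>Translating the vertices outside \<^term>\<open>D\<close> preserves the equations.\<close>
lemma solutions_infinite_disconnected:
  assumes D: "D \<subseteq> V" "D \<noteq> V" "\<And>i j. i \<in> D \<Longrightarrow> {i, j} \<in> H \<Longrightarrow> j \<in> D" and ab: "a \<in> D" "b \<in> D"
    and z: "z \<in> solutions a b s"
  shows "infinite (solutions a b s)"
proof
  assume fin: "finite (solutions a b s)"
  have zD: "z a = 0" "z b = 1" "\<And>i. i \<notin> V \<Longrightarrow> z i = 0" "inj_on z V"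
    "\<And>i. i \<in> V \<Longrightarrow> (\<Sum>j\<in>nbrs H i. s {i, j} / (z i - z j)) = 0"
    using z unfolding solutions_def by auto
  obtain v where v: "v \<in> V" "v \<notin> D" using D(1,2) by blast
  define bad where "bad = (\<lambda>(i, j). z j - z i) ` (V \<times> V)"
  have "finite bad" unfolding bad_def using finite_V by simp
  define g where "g \<tau> i = z i + (if i \<in> V - D then \<tau> else 0)" for \<tau> i
  have D': "j \<in> V - D" if "i \<in> V - D" "{i, j} \<in> H" for i j
    using that D(3)[of j i] adjD[OF that(2)] adj_sym by blast
  have "g \<tau> \<in> solutions a b s" if \<tau>: "\<tau> \<notin> bad" for \<tau>
    unfolding solutions_def
  proof (intro CollectI conjI allI impI ballI)
    show "g \<tau> a = 0" "g \<tau> b = 1" using zD ab unfolding g_def by auto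
    show "g \<tau> i = 0" if "i \<notin> V" for i using zD that unfolding g_def by auto
    show "inj_on (g \<tau>) V"
    proof (rule inj_onI)
      fix i j assume ij: "i \<in> V" "j \<in> V" "g \<tau> i = g \<tau> j"
      have "\<tau> \<noteq> z j - z i" "\<tau> \<noteq> z i - z j" using \<tau> ij unfolding bad_def by force+
      then have "z i = z j" using ij unfolding g_def by (auto simp: algebra_simps split: if_splits)
      then show "i = j" using zD(4) ij by (auto dest: inj_onD)
    qed
    fix i assume i: "i \<in> V"
    have "g \<tau> i - g \<tau> j = z i - z j" if "j \<in> nbrs H i" for j
      using that i D(3)[of i j] D'[of i j] unfolding g_def nbrs_def by auto
    then show "(\<Sum>j\<in>nbrs H i. s {i, j} / (g \<tau> i - g \<tau> j)) = 0"
      using zD(5)[OF i] by simp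
  qed
  then have "g ` (- bad) \<subseteq> solutions a b s" by blast
  then have "finite (g ` (- bad))" using fin finite_subset by blast
  moreover have "inj_on g (- bad)"
  proof (rule inj_onI)
    fix \<tau> \<tau>' assume "g \<tau> = g \<tau>'"
    then have "g \<tau> v = g \<tau>' v" by simp
    then show "\<tau> = \<tau>'" using v unfolding g_def by simp
  qed
  ultimately have "finite (- bad)" using finite_imageD by blast
  then have "finite (UNIV :: complex set)"
    using \<open>finite bad\<close> by (metis finite_compl)
  then show False using infinite_UNIV_char_0 by blast
qed

text \<open>A proper closed set with at least two vertices can hold both normalised vertices while
  the rest is translated, which makes the fiber infinite. Since \<open>V\<close> has at least three
  vertices, \<open>C\<close> or its complement is such a set; the pair \<open>a\<close>,
  \<open>b\<close> need not be an edge here.\<close>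

lemma copious_connected:
  assumes cop: "copious n G" and C: "C \<subseteq> V" "C \<noteq> {}" "\<And>i j. i \<in> C \<Longrightarrow> {i, j} \<in> H \<Longrightarrow> j \<in> C"
  shows "C = V"
proof (rule ccontr)
  assume ne: "C \<noteq> V"
  have gen: "generic_on (kin_space n G) (\<lambda>s. fiber n G s \<noteq> {} \<and> finite (fiber_M0n n G s))"
    and dom: "scat_dominant n G" using cop unfolding copious_def by auto
  obtain s1 e where s1: "s1 \<in> kin_space n G" "s1 e \<noteq> 0" using dominant_nonzero[OF dom] by blast
  obtain s where s: "s \<in> kin_space n G" "fiber n G s \<noteq> {}" "finite (fiber_M0n n G s)"
    using generic_on_meet[OF line_closed_kin s1 gen gen] by blast
  have no: "False" if D: "D \<subseteq> V" "D \<noteq> V" "\<And>i j. i \<in> D \<Longrightarrow> {i, j} \<in> H \<Longrightarrow> j \<in> D" "card D \<ge> 2" for D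
  proof -
    obtain a where a: "a \<in> D" using D(4) by fastforce
    have "finite D" using D(1) finite_V finite_subset by blast
    then have "D - {a} \<noteq> {}" using D(4) a by (metis card_Suc_Diff1 card.empty not_less_eq_eq numeral_2_eq_2 le_refl)
    then obtain b where b: "b \<in> D" "a \<noteq> b" by blast
    have abV: "a \<in> V" "b \<in> V" using a b D(1) by auto
    obtain z where "z \<in> solutions a b s"
      using s(2) cross_ratio_fiber[OF s(1) abV b(2)] by blast
    then have "infinite (solutions a b s)"
      by (rule solutions_infinite_disconnected[of D a b z, rotated -1]) (use D a b in blast)+
    then show False using bij_betw_finite[OF bij_fiber_M0n[OF s(1) abV b(2)]] s(3) by blast
  qed
  have cV: "card V \<ge> 3" unfolding V_def using n4 by simp
  show False
  proof (cases "card C \<ge> 2")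
    case True
    show False by (rule no[of C]) (use C ne True in blast)+
  next
    case False
    have "card (V - C) = card V - card C"
      using C(1) finite_V by (intro card_Diff_subset) (auto intro: finite_subset)
    then have "card (V - C) \<ge> 2" using cV False by linarith
    moreover have "j \<in> V - C" if "i \<in> V - C" "{i, j} \<in> H" for i j
      using that C(3)[of j i] adjD[OF that(2)] adj_sym by blast
    ultimately show False using no[of "V - C"] C(1,2) by blast
  qed
qed

end

section \<open>The generic number of solutions\<close>

lemma con_subst:
  assumes "P \<in> constructible" "\<And>v. (\<lambda>x. \<sigma> x v) \<in> polyfun"
  shows "(\<lambda>x. P (\<sigma> x)) \<in> constructible"
  using assms(1)
proof induction
  case (con_eq f)
  have "(\<lambda>x. f (\<sigma> x)) \<in> polyfun" using con_eq assms(2) by (rule polyfun_subst)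
  then show ?case by (rule constructible.con_eq)
next
  case (con_neq f)
  have "(\<lambda>x. f (\<sigma> x)) \<in> polyfun" using con_neq assms(2) by (rule polyfun_subst)
  then show ?case by (rule constructible.con_neq)
next
  case (con_conj P Q)
  then show ?case by (intro constructible.con_conj)
next
  case (con_disj P Q)
  then show ?case by (intro constructible.con_disj)
qed

lemma polyfun_tendsto:
  assumes "f \<in> polyfun" "\<And>v. (\<lambda>k. X k v) \<longlonglongrightarrow> x v"
  shows "(\<lambda>k. f (X k)) \<longlonglongrightarrow> f x"
  using assms(1) by induction (auto intro!: tendsto_intros assms(2))

text \<open>Positive reals are Zariski dense: coordinates are changed one at a time, and a nonzero
  polynomial in one coordinate has only finitely many roots.\<close>

lemma polyfun_nonzero_positive:
  assumes "finite E" "f \<in> polyfun" "f u \<noteq> 0"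
  shows "\<exists>w. f w \<noteq> 0 \<and> (\<forall>e\<in>E. \<exists>r>0. w e = of_real r)"
  using assms(1)
proof (induction E rule: finite_induct)
  case empty
  then show ?case using assms(3) by auto
next
  case (insert e E)
  then obtain w where w: "f w \<noteq> 0" "\<forall>e\<in>E. \<exists>r>0. w e = of_real r" by blast
  obtain d F where F: "\<And>x y. f (x(e := y)) = poly (F x) y"
    using polyfun_poly_family[OF assms(2)] by blast
  have "poly (F w) (w e) \<noteq> 0" using F[of w "w e"] w(1) by simp
  then have "F w \<noteq> 0" by auto
  then have fin: "finite {y. poly (F w) y = 0}" by (rule poly_roots_finite)
  have "infinite (of_real ` {0<..} :: complex set)"
    by (subst finite_image_iff) (auto simp: inj_on_def infinite_Ioi)
  then obtain y where y: "y \<in> of_real ` {0<..}" "poly (F w) y \<noteq> 0"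
    using fin by (metis (mono_tags, lifting) finite_subset mem_Collect_eq subsetI)
  then have "f (w(e := y)) \<noteq> 0" using F by simp
  moreover have "\<forall>e'\<in>insert e E. \<exists>r>0. (w(e := y)) e' = of_real r"
    using w(2) y(1) by auto
  ultimately show ?case by blast
qed

section \<open>A first-order description of the number of solutions\<close>

context finite_graph
begin

text \<open>An existential statement about \<open>N\<close> points, so quantifier elimination
  applies. The negated statement for \<open>Suc N\<close> also excludes infinite solution sets, for
  which \<open>card\<close> would be 0.\<close>

definition many_solutions :: "nat \<Rightarrow> nat \<Rightarrow> nat \<Rightarrow> (nat set \<Rightarrow> complex) \<Rightarrow> bool" where
  "many_solutions a b N s \<longleftrightarrow> (\<exists>z. (\<forall>k<N. z k \<in> solutions a b s) \<and> inj_on z {..<N})"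

lemma exact_solutions:
  "finite (solutions a b s) \<and> card (solutions a b s) = N \<longleftrightarrow>
     many_solutions a b N s \<and> \<not> many_solutions a b (Suc N) s"
proof -
  have le: "M \<le> card (solutions a b s)" if "finite (solutions a b s)" "many_solutions a b M s" for M
  proof -
    obtain z where "\<forall>k<M. z k \<in> solutions a b s" "inj_on z {..<M}"
      using \<open>many_solutions a b M s\<close> unfolding many_solutions_def by blast
    then show ?thesis using card_inj_on_le[of z "{..<M}" "solutions a b s"] that(1) by auto
  qed
  have ex: "many_solutions a b M s" if "finite T" "T \<subseteq> solutions a b s" "card T = M" for T M
  proof -
    obtain z where "bij_betw z {..<M} T"
      using ex_bij_betw_nat_finite[OF \<open>finite T\<close>] \<open>card T = M\<close> by (auto simp: atLeast0LessThan)
    then show ?thesis unfolding many_solutions_def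
      using \<open>T \<subseteq> solutions a b s\<close> by (intro exI[of _ z]) (auto simp: bij_betw_def)
  qed
  show ?thesis
  proof (cases "finite (solutions a b s)")
    case True
    have eq: "many_solutions a b M s \<longleftrightarrow> M \<le> card (solutions a b s)" for M
    proof
      assume "M \<le> card (solutions a b s)"
      then obtain T where "T \<subseteq> solutions a b s" "card T = M" "finite T"
        using obtain_subset_with_card_n by metis
      then show "many_solutions a b M s" using ex by blast
    qed (use le True in blast)
    have "card (solutions a b s) = N \<longleftrightarrow> N \<le> card (solutions a b s) \<and> \<not> Suc N \<le> card (solutions a b s)"
      by linarith
    then show ?thesis unfolding eq using True by blast
  next
    case False
    then obtain T where "T \<subseteq> solutions a b s" "card T = Suc N" "finite T"
      using infinite_arbitrarily_large by metis
    then have "many_solutions a b (Suc N) s" using ex by blast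
    then show ?thesis using False by blast
  qed
qed

text \<open>The edge weights are the variables \<^term>\<open>Inl e\<close> and the coordinates of the
  \<^term>\<open>k\<close>-th solution are the variables \<^term>\<open>Inr (k, i)\<close>; the equations are cleared of denominators.\<close>
definition solution_formula :: "nat \<Rightarrow> nat \<Rightarrow> nat \<Rightarrow> (nat set + nat \<times> nat \<Rightarrow> complex) \<Rightarrow> bool" where
  "solution_formula a b N X \<longleftrightarrow>
    (\<forall>k\<in>{..<N}. X (Inr (k, a)) - 0 = 0 \<and> X (Inr (k, b)) - 1 = 0 \<and>
       (\<forall>p\<in>{p \<in> V \<times> V. fst p \<noteq> snd p}. X (Inr (k, fst p)) - X (Inr (k, snd p)) \<noteq> 0) \<and>
       (\<forall>i\<in>V. (\<Sum>j\<in>nbrs H i. X (Inl {i, j}) * (\<Prod>l\<in>nbrs H i - {j}. X (Inr (k, i)) - X (Inr (k, l)))) = 0)) \<and>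
    (\<forall>p\<in>{p \<in> {..<N} \<times> {..<N}. fst p \<noteq> snd p}. \<exists>i\<in>V. X (Inr (fst p, i)) - X (Inr (snd p, i)) \<noteq> 0)"

lemma con_solution_formula: "solution_formula a b N \<in> constructible"
  unfolding solution_formula_def
  by (intro con_conj con_ball con_bex con_eq con_neq polyfun.pf_var polyfun.pf_const polyfun.pf_mult
      polyfun_sum polyfun_prod polyfun_diff) (auto simp: finite_V)

lemma clear_denominators:
  fixes w :: "nat \<Rightarrow> complex"
  assumes "finite A" "\<And>j. j \<in> A \<Longrightarrow> w j \<noteq> 0"
  shows "(\<Sum>j\<in>A. c j * (\<Prod>l\<in>A - {j}. w l)) = 0 \<longleftrightarrow> (\<Sum>j\<in>A. c j / w j) = 0"
proof -
  have "c j * (\<Prod>l\<in>A - {j}. w l) = (c j / w j) * (\<Prod>l\<in>A. w l)" if "j \<in> A" for j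
    using prod.remove[OF assms(1) that, of w] assms(2)[OF that] by simp
  then have "(\<Sum>j\<in>A. c j * (\<Prod>l\<in>A - {j}. w l)) = (\<Sum>j\<in>A. c j / w j) * (\<Prod>l\<in>A. w l)"
    unfolding sum_distrib_right by (intro sum.cong refl)
  moreover have "(\<Prod>l\<in>A. w l) \<noteq> 0" using assms by simp
  ultimately show ?thesis by simp
qed

text \<open>Puts the quantifier in the form of \<open>con_ex_vars\<close>: finitely many variables
  come from \<open>Z\<close>, the weights from \<open>s\<close>, and all other variables are
  0.\<close>

lemma many_solutions_formula:
  assumes ab: "a \<in> V" "b \<in> V" "a \<noteq> b"
  shows "many_solutions a b N s \<longleftrightarrow>
    (\<exists>Z. solution_formula a b N (\<lambda>v. if v \<in> Inr ` ({..<N} \<times> V) then Z v else case_sum s (\<lambda>_. 0) v))"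
proof
  assume "many_solutions a b N s"
  then obtain z where z: "\<forall>k<N. z k \<in> solutions a b s" "inj_on z {..<N}"
    unfolding many_solutions_def by blast
  define Z where "Z = case_sum s (\<lambda>(k, i). z k i)"
  define X where "X = (\<lambda>v. if v \<in> Inr ` ({..<N} \<times> V) then Z v else case_sum s (\<lambda>_. 0) v)"
  have Xl: "X (Inl e) = s e" for e unfolding X_def by auto
  have Xr: "X (Inr (k, i)) = z k i" if "k < N" "i \<in> V" for k i
    using that unfolding X_def Z_def by auto
  have zD: "z k a = 0" "z k b = 1" "inj_on (z k) V" "\<And>i. i \<notin> V \<Longrightarrow> z k i = 0"
    "\<And>i. i \<in> V \<Longrightarrow> (\<Sum>j\<in>nbrs H i. s {i, j} / (z k i - z k j)) = 0" if "k < N" for k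
    using z(1) that unfolding solutions_def by auto
  have "solution_formula a b N X"
    unfolding solution_formula_def
  proof (intro conjI ballI)
    fix k assume "k \<in> {..<N}"
    then have k: "k < N" by simp
    show "X (Inr (k, a)) - 0 = 0" "X (Inr (k, b)) - 1 = 0" using Xr[OF k] zD[OF k] ab by auto
    show "X (Inr (k, fst p)) - X (Inr (k, snd p)) \<noteq> 0" if "p \<in> {p \<in> V \<times> V. fst p \<noteq> snd p}" for p
      using that Xr[OF k] zD(3)[OF k] by (auto dest: inj_onD)
    show "(\<Sum>j\<in>nbrs H i. X (Inl {i, j}) * (\<Prod>l\<in>nbrs H i - {j}. X (Inr (k, i)) - X (Inr (k, l)))) = 0"
      if i: "i \<in> V" for i
    proof (subst clear_denominators[OF finite_nbrs])
      show "X (Inr (k, i)) - X (Inr (k, j)) \<noteq> 0" if "j \<in> nbrs H i" for j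
        using adjD[of i j] that Xr[OF k] zD(3)[OF k] by (auto simp: nbrs_def dest: inj_onD)
      have "(\<Sum>j\<in>nbrs H i. X (Inl {i, j}) / (X (Inr (k, i)) - X (Inr (k, j)))) =
        (\<Sum>j\<in>nbrs H i. s {i, j} / (z k i - z k j))"
        using nbrs_subset[of i] by (intro sum.cong refl) (auto simp: Xl Xr[OF k] i)
      then show "(\<Sum>j\<in>nbrs H i. X (Inl {i, j}) / (X (Inr (k, i)) - X (Inr (k, j)))) = 0"
        using zD(5)[OF k i] by simp
    qed
  next
    fix p assume p: "p \<in> {p \<in> {..<N} \<times> {..<N}. fst p \<noteq> snd p}"
    then have k: "fst p < N" "snd p < N" by auto
    have "z (fst p) \<noteq> z (snd p)" using p z(2) by (auto dest: inj_onD)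
    then obtain i where i: "z (fst p) i \<noteq> z (snd p) i" by (auto simp: fun_eq_iff)
    then have "i \<in> V" using zD(4)[OF k(1), of i] zD(4)[OF k(2), of i] by force
    then show "\<exists>i\<in>V. X (Inr (fst p, i)) - X (Inr (snd p, i)) \<noteq> 0"
      using i Xr k by (intro bexI[of _ i]) auto
  qed
  then show "\<exists>Z. solution_formula a b N (\<lambda>v. if v \<in> Inr ` ({..<N} \<times> V) then Z v else case_sum s (\<lambda>_. 0) v)"
    unfolding X_def by (rule exI[of _ Z])
next
  assume "\<exists>Z. solution_formula a b N (\<lambda>v. if v \<in> Inr ` ({..<N} \<times> V) then Z v else case_sum s (\<lambda>_. 0) v)"
  then obtain Z where Z: "solution_formula a b N (\<lambda>v. if v \<in> Inr ` ({..<N} \<times> V) then Z v else case_sum s (\<lambda>_. 0) v)"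
    (is "solution_formula a b N ?X") by (elim exE)
  define X where "X = ?X"
  have Xl: "X (Inl e) = s e" for e unfolding X_def by auto
  have X: "solution_formula a b N X" using Z X_def by simp
  define z where "z k i = (if i \<in> V then X (Inr (k, i)) else 0)" for k i
  have zs: "z k \<in> solutions a b s" if k: "k < N" for k
  proof -
    have F: "X (Inr (k, a)) - 0 = 0" "X (Inr (k, b)) - 1 = 0"
      "\<forall>p\<in>{p \<in> V \<times> V. fst p \<noteq> snd p}. X (Inr (k, fst p)) - X (Inr (k, snd p)) \<noteq> 0"
      "\<forall>i\<in>V. (\<Sum>j\<in>nbrs H i. X (Inl {i, j}) * (\<Prod>l\<in>nbrs H i - {j}. X (Inr (k, i)) - X (Inr (k, l)))) = 0"
      using X k unfolding solution_formula_def by auto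
    have inj: "inj_on (z k) V"
    proof (rule inj_onI, rule ccontr)
      fix i j assume "i \<in> V" "j \<in> V" "z k i = z k j" "i \<noteq> j"
      then show False using bspec[OF F(3), of "(i, j)"] unfolding z_def by simp
    qed
    have "(\<Sum>j\<in>nbrs H i. s {i, j} / (z k i - z k j)) = 0" if i: "i \<in> V" for i
    proof -
      have "(\<Sum>j\<in>nbrs H i. X (Inl {i, j}) / (X (Inr (k, i)) - X (Inr (k, j)))) = 0"
      proof (subst clear_denominators[OF finite_nbrs, symmetric])
        show "X (Inr (k, i)) - X (Inr (k, j)) \<noteq> 0" if "j \<in> nbrs H i" for j
          using adjD[of i j] that bspec[OF F(3), of "(i, j)"] by (auto simp: nbrs_def)
      qed (use F(4) i in blast)
      moreover have "(\<Sum>j\<in>nbrs H i. X (Inl {i, j}) / (X (Inr (k, i)) - X (Inr (k, j)))) =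
        (\<Sum>j\<in>nbrs H i. s {i, j} / (z k i - z k j))"
        using nbrs_subset[of i] i unfolding z_def by (intro sum.cong refl) (auto simp: Xl)
      ultimately show ?thesis by simp
    qed
    then show ?thesis unfolding solutions_def using inj F(1,2) ab by (auto simp: z_def)
  qed
  moreover have "inj_on z {..<N}"
  proof (rule inj_onI, rule ccontr)
    fix k l assume kl: "k \<in> {..<N}" "l \<in> {..<N}" "z k = z l" "k \<noteq> l"
    then have "\<exists>i\<in>V. X (Inr (k, i)) - X (Inr (l, i)) \<noteq> 0"
      using bspec[OF X[unfolded solution_formula_def, THEN conjunct2], of "(k, l)"] by simp
    then obtain i where "i \<in> V" "X (Inr (k, i)) - X (Inr (l, i)) \<noteq> 0" by blast
    then have "z k i \<noteq> z l i" unfolding z_def by simp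
    then show False using kl(3) by simp
  qed
  ultimately show "many_solutions a b N s" unfolding many_solutions_def by blast
qed

lemma con_many_solutions:
  assumes ab: "a \<in> V" "b \<in> V" "a \<noteq> b"
  shows "many_solutions a b N \<in> constructible"
proof -
  have "(\<lambda>X. \<exists>Z. solution_formula a b N (\<lambda>v. if v \<in> Inr ` ({..<N} \<times> V) then Z v else X v)) \<in> constructible"
    by (intro con_ex_vars con_solution_formula) (simp add: finite_V)
  moreover have "(\<lambda>s. case_sum s (\<lambda>_. 0) v) \<in> polyfun" for v :: "nat set + nat \<times> nat"
    by (cases v) (auto intro: polyfun.intros)
  ultimately have "(\<lambda>s. \<exists>Z. solution_formula a b N (\<lambda>v. if v \<in> Inr ` ({..<N} \<times> V) then Z v else case_sum s (\<lambda>_. 0) v)) \<in> constructible"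
    by (rule con_subst)
  then show ?thesis unfolding many_solutions_formula[OF ab, symmetric] .
qed

end

section \<open>Free edge weights as coordinates of the kinematic space\<close>

locale universal_connected_graph = universal_graph n G V H + connected_graph V H a b
  for n G V H a b
begin

abbreviation "E \<equiv> H - {{a, b}}"

text \<open>A sum over ordered pairs, which counts each edge twice; so does the total weight that
  has to vanish, hence the division by 2 in \<open>weight_H\<close>.\<close>

definition total :: "(nat set \<Rightarrow> complex) \<Rightarrow> complex" where
  "total u = (\<Sum>i\<in>V. \<Sum>j\<in>nbrs H i. if {i, j} = {a, b} then 0 else u {i, j})"

lemma sum_ab: "(\<Sum>i\<in>V. \<Sum>j\<in>nbrs H i. if {i, j} = {a, b} then c else 0) = 2 * (c :: complex)"
proof -
  have b: "b \<in> nbrs H a" "a \<in> nbrs H b" using ab adj_sym by (auto simp: nbrs_def)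
  have "(\<Sum>j\<in>nbrs H i. if {i, j} = {a, b} then c else 0) = (if i = a then c else 0) + (if i = b then c else 0)" for i
  proof -
    have "({i, j} = {a, b}) \<longleftrightarrow> (i = a \<and> j = b) \<or> (i = b \<and> j = a)" for j
      by (auto simp: doubleton_eq_iff)
    then show ?thesis using b ab_V by (auto simp: sum.delta)
  qed
  then show ?thesis using ab_V finite_V by (simp add: sum.distrib sum.delta)
qed

text \<open>The kinematic space is parametrised by the weights on the edges in \<^term>\<open>E\<close>.\<close>
definition weight_H :: "(nat set \<Rightarrow> complex) \<Rightarrow> nat set \<Rightarrow> complex" where
  "weight_H u e = (if e = {a, b} then - total u / 2 else u e)"

text \<open>Edges at \<open>n\<close> receive the value that the equation at their other end forces;
  \<open>the_elem (e - {n})\<close> is that end.\<close>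

definition weight :: "(nat set \<Rightarrow> complex) \<Rightarrow> nat set \<Rightarrow> complex" where
  "weight u e = (if e \<in> H then weight_H u e
     else if e \<in> G then - (\<Sum>j\<in>nbrs H (the_elem (e - {n})). weight_H u {the_elem (e - {n}), j}) else 0)"

lemma sum_weight_H: "(\<Sum>i\<in>V. \<Sum>j\<in>nbrs H i. weight_H u {i, j}) = 0"
proof -
  have "(\<Sum>i\<in>V. \<Sum>j\<in>nbrs H i. weight_H u {i, j}) =
    (\<Sum>i\<in>V. \<Sum>j\<in>nbrs H i. (if {i, j} = {a, b} then - total u / 2 else 0) + (if {i, j} = {a, b} then 0 else u {i, j}))"
    unfolding weight_H_def by (intro sum.cong refl) auto
  also have "\<dots> = 2 * (- total u / 2) + total u"
    unfolding sum.distrib sum_ab total_def ..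
  finally show ?thesis by simp
qed

lemma weight_edge: "j \<in> nbrs H i \<Longrightarrow> weight u {i, j} = weight_H u {i, j}"
  unfolding weight_def nbrs_def by simp

lemma weight_n:
  assumes "i \<in> V"
  shows "weight u {i, n} = - (\<Sum>j\<in>nbrs H i. weight_H u {i, j})"
proof -
  have "{i, n} \<in> G" "{i, n} \<notin> H" using assms univ unfolding V_def H_def by auto
  moreover have "i \<noteq> n" using assms n_notin_V by metis
  then have "{i, n} - {n} = {i}" by auto
  ultimately show ?thesis unfolding weight_def by simp
qed

lemma weight_kin: "weight u \<in> kin_space n G"
  unfolding kin_space_iff
proof (intro conjI allI impI ballI)
  show "weight u e = 0" if "e \<notin> G" for e
  proof -
    have "e \<notin> H" using that by (simp add: H_def)
    then show ?thesis using that unfolding weight_def by simp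
  qed
  show "weight u {i, n} = - (\<Sum>j\<in>nbrs H i. weight u {i, j})" if "i \<in> V" for i
    unfolding weight_n[OF that] by (simp add: weight_edge)
  show "(\<Sum>i\<in>V. \<Sum>j\<in>nbrs H i. weight u {i, j}) = 0"
    using sum_weight_H[of u] by (simp add: weight_edge)
qed

text \<open>Hence \<open>weight\<close> is a polynomial retraction onto the kinematic space, and a
  function that is nonzero somewhere on this space stays nonzero somewhere after composition with
  \<open>weight\<close>.\<close>

lemma weight_id:
  assumes s: "s \<in> kin_space n G"
  shows "weight s = s"
proof -
  note kin = s[unfolded kin_space_iff]
  have "(\<Sum>i\<in>V. \<Sum>j\<in>nbrs H i. s {i, j}) =
    (\<Sum>i\<in>V. \<Sum>j\<in>nbrs H i. (if {i, j} = {a, b} then s {a, b} else 0) + (if {i, j} = {a, b} then 0 else s {i, j}))"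
    by (intro sum.cong refl) auto
  also have "\<dots> = 2 * s {a, b} + total s"
    unfolding sum.distrib sum_ab total_def ..
  finally have "s {a, b} = - total s / 2" using kin by (simp add: field_simps eq_neg_iff_add_eq_0)
  then have wH: "weight_H s e = s e" for e unfolding weight_H_def by simp
  show ?thesis
  proof
    fix e show "weight s e = s e"
    proof (cases "e \<in> H \<or> e \<notin> G")
      case True
      moreover have "e \<notin> G \<Longrightarrow> e \<notin> H" by (simp add: H_def)
      ultimately show ?thesis using kin wH unfolding weight_def by auto
    next
      case False
      then obtain i j where "e = {i, j}" "i \<in> insert n V" "j \<in> insert n V" "i \<noteq> j" "n \<in> e"
        using simple unfolding simple_graph_def verts H_def by blast
      then obtain i where i: "e = {i, n}" "i \<in> V" by (auto simp: insert_commute)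
      then show ?thesis using weight_n[OF i(2), of s] kin wH by simp
    qed
  qed
qed

lemma polyfun_weight: "(\<lambda>u. weight u e) \<in> polyfun"
proof -
  have tot: "total \<in> polyfun" unfolding total_def
  proof (intro polyfun_sum)
    fix i j show "(\<lambda>u. if {i, j} = {a, b} then 0 else u {i, j}) \<in> polyfun"
      by (cases "{i, j} = {a, b}") (auto intro: polyfun.intros)
  qed
  have "(\<lambda>u. (- 1 / 2) * total u) \<in> polyfun" by (rule polyfun.pf_mult[OF polyfun.pf_const tot])
  then have wH: "(\<lambda>u. weight_H u e) \<in> polyfun" for e
    unfolding weight_H_def by (cases "e = {a, b}") (auto intro: polyfun.intros)
  show ?thesis unfolding weight_def
    by (cases "e \<in> H"; cases "e \<in> G") (auto intro!: wH polyfun_sum polyfun_uminus polyfun.pf_const)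
qed

text \<open>Allows any values off \<open>E\<close>, so that agreement with real weights is only
  needed on \<open>E\<close>.\<close>

lemma weight_cong:
  assumes "\<And>e. e \<in> E \<Longrightarrow> u e = w e"
  shows "weight u = weight w"
proof -
  have "total u = total w" unfolding total_def
    using assms by (intro sum.cong refl) (auto simp: nbrs_def)
  then have "weight_H u e = weight_H w e" if "e \<in> H" for e
    using assms that unfolding weight_H_def by auto
  then show ?thesis unfolding weight_def by (intro ext) (auto simp: nbrs_def intro!: sum.cong)
qed

lemma solutions_weight:
  assumes "positive t" "\<And>x. x \<in> crit t \<Longrightarrow> inj_on x V"
  shows "finite (solutions a b (weight (\<lambda>e. of_real (t e))))"
    and "card (solutions a b (weight (\<lambda>e. of_real (t e)))) = card (bipolar a b)"
proof -
  let ?s = "weight (\<lambda>e. of_real (t e))"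
  have "solutions a b ?s = (\<lambda>x i. of_real (x i)) ` crit t"
  proof (rule solutions_real[OF assms(1) _ _ assms(2)])
    show "?s e = of_real (t e)" if "e \<in> E" for e
      using that unfolding weight_def weight_H_def by simp
    show "(\<Sum>i\<in>V. \<Sum>j\<in>nbrs H i. ?s {i, j}) = 0"
      using weight_kin unfolding kin_space_iff by blast
  qed
  moreover have "inj (\<lambda>(x :: nat \<Rightarrow> real) i. complex_of_real (x i))"
    by (auto simp: inj_def fun_eq_iff)
  moreover have "finite (crit t)" "card (crit t) = card (bipolar a b)"
    using bij_betw_finite[OF bij_crit_bipolar[OF assms(1)]] finite_bipolar
      bij_betw_same_card[OF bij_crit_bipolar[OF assms(1)]] by auto
  ultimately show "finite (solutions a b ?s)" "card (solutions a b ?s) = card (bipolar a b)"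
    by (auto simp: card_image inj_on_def inj_def)
qed

text \<open>The count is generically decided, so one kinematic point off the zero set of
  \<open>f\<close> with the right count fixes the generic value. Such a point is sought among
  weights that are positive, collision free and off that zero set at once.\<close>

lemma generic_solutions:
  "generic_on (kin_space n G) (\<lambda>s. card (fiber_M0n n G s) = card (bipolar a b))"
proof -
  let ?K = "kin_space n G" and ?N = "card (bipolar a b)"
  let ?P = "\<lambda>s. many_solutions a b ?N s \<and> \<not> many_solutions a b (Suc ?N) s"
  have Kne: "?K \<noteq> {}" using weight_kin by blast
  have "generically_decided ?K (many_solutions a b M)" for M
    by (rule constructible_generically_decided[OF con_many_solutions[OF ab_V] line_closed_kin Kne])
  then have "generically_decided ?K ?P"
    by (intro generically_decided_conj generically_decided_not line_closed_kin)
  then obtain f s0 where f: "f \<in> polyfun" "s0 \<in> ?K" "f s0 \<noteq> 0"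
    and dec: "(\<forall>s\<in>?K. f s \<noteq> 0 \<longrightarrow> ?P s) \<or> (\<forall>s\<in>?K. f s \<noteq> 0 \<longrightarrow> \<not> ?P s)"
    unfolding generically_decided_def by blast
  let ?F = "\<lambda>u. f (weight u)"
  have F: "?F \<in> polyfun" by (rule polyfun_subst[OF f(1) polyfun_weight])
  have finE: "finite E" using finite_H by simp
  have "?F s0 \<noteq> 0" using f(3) weight_id[OF f(2)] by simp
  then obtain w where w: "?F w \<noteq> 0" "\<forall>e\<in>E. \<exists>r>0. w e = of_real r"
    using polyfun_nonzero_positive[OF finE F] by blast
  \<comment> \<open>Positivity on \<open>E\<close> and nonvanishing of \<open>f\<close> are both
    open conditions, which is what \<open>collision_free\<close> asks of \<open>T\<close>.\<close>
  define T where "T = {t. positive t \<and> ?F (\<lambda>e. of_real (t e)) \<noteq> 0}"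
  have "(\<lambda>e. Re (w e)) \<in> T"
  proof -
    have re: "Re (w e) > 0 \<and> of_real (Re (w e)) = w e" if "e \<in> E" for e using w(2) that by force
    then have "weight (\<lambda>e. of_real (Re (w e))) = weight w" by (intro weight_cong) blast
    then show ?thesis unfolding T_def positive_def using w(1) re by auto
  qed
  then have "T \<noteq> {}" by blast
  then have "\<exists>t\<in>T. \<forall>x\<in>crit t. inj_on x V"
  proof (rule collision_free)
    show "positive t" if "t \<in> T" for t using that unfolding T_def by blast
    fix t S assume t: "t \<in> T" and S: "\<And>e. (\<lambda>k. S k e) \<longlonglongrightarrow> t e"
    have "(\<lambda>k. ?F (\<lambda>e. of_real (S k e))) \<longlonglongrightarrow> ?F (\<lambda>e. of_real (t e))"
      by (rule polyfun_tendsto[OF F]) (intro tendsto_of_real S)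
    then have ev1: "\<forall>\<^sub>F k in sequentially. ?F (\<lambda>e. of_real (S k e)) \<noteq> 0"
      using t unfolding T_def by (intro tendsto_imp_eventually_ne) auto
    have ev2: "\<forall>\<^sub>F k in sequentially. \<forall>e\<in>E. S k e > 0"
    proof (rule eventually_ball_finite[OF finE], rule ballI)
      fix e assume "e \<in> E"
      then have "t e > 0" using t unfolding T_def positive_def by blast
      then show "\<forall>\<^sub>F k in sequentially. S k e > 0" by (rule order_tendstoD(1)[OF S])
    qed
    show "\<forall>\<^sub>F k in sequentially. S k \<in> T"
      using ev1 ev2 by eventually_elim (simp add: T_def positive_def)
  qed
  then obtain t where t: "t \<in> T" "\<forall>x\<in>crit t. inj_on x V" by blast
  then have "?P (weight (\<lambda>e. of_real (t e)))"
    unfolding exact_solutions[symmetric] using solutions_weight[of t] unfolding T_def by blast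
  then have "\<forall>s\<in>?K. f s \<noteq> 0 \<longrightarrow> ?P s"
    using dec weight_kin t(1) unfolding T_def by blast
  then have "card (fiber_M0n n G s) = ?N" if "s \<in> ?K" "f s \<noteq> 0" for s
    using that exact_solutions[of a b s ?N] bij_betw_same_card[OF bij_fiber_M0n[OF that(1) ab_V]] by simp
  then show ?thesis unfolding generic_on_def using f by blast
qed

text \<open>Two generic values agree at a common nonzero kinematic point; dominance ensures that
  nonzero points exist.\<close>

lemma ml_degree_eq:
  assumes "scat_dominant n G"
  shows "ml_degree n G = card (bipolar a b)"
  unfolding ml_degree_def
proof (rule the_equality)
  show "generic_on (kin_space n G) (\<lambda>s. card (fiber_M0n n G s) = card (bipolar a b))"
    by (rule generic_solutions)
  fix N assume N: "generic_on (kin_space n G) (\<lambda>s. card (fiber_M0n n G s) = N)"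
  obtain s e where "s \<in> kin_space n G" "s e \<noteq> 0" using dominant_nonzero[OF assms] by blast
  from generic_on_meet[OF line_closed_kin this N generic_solutions]
  show "N = card (bipolar a b)" by auto
qed

end

theorem mainTheorem15:
  fixes n :: nat and G :: "nat set set"
  assumes "n \<ge> 4"
    and "simple_graph n G"
    and "copious n G"
    and "\<forall>i\<in>{1..<n}. {i, n} \<in> G"
  defines "H \<equiv> {e \<in> G. n \<notin> e}"
  shows "[:-1, 1:] dvd chrom_poly {1..<n} H \<and>
         int (ml_degree n G) = \<bar>poly (chrom_poly {1..<n} H div [:-1, 1:]) 1\<bar>"
proof -
  interpret universal_graph n G "{1..<n}" H
    using assms by unfold_locales auto
  note conn = copious_connected[OF assms(3)]
  \<comment> \<open>Any edge can serve as \<open>ab\<close>; vertex 1 lies on one, since otherwise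
    \<open>{1}\<close> would be closed under adjacency.\<close>
  have "\<exists>j. {1, j} \<in> H"
  proof (rule ccontr)
    assume "\<nexists>j. {1, j} \<in> H"
    then have "{1} = {1..<n}" using assms(1) by (intro conn) auto
    moreover have "2 \<in> {1..<n}" using assms(1) by simp
    ultimately have "(2::nat) \<in> {1}" by (simp only:)
    then show False by simp
  qed
  then obtain b where b: "{1, b} \<in> H" by blast
  interpret universal_connected_graph n G "{1..<n}" H 1 b
  proof unfold_locales
    show "{1, b} \<in> H" by (rule b)
    show "C = {1..<n}" if "C \<subseteq> {1..<n}" "C \<noteq> {}" "\<And>i j. i \<in> C \<Longrightarrow> {i, j} \<in> H \<Longrightarrow> j \<in> C" for C
      using that by (rule conn)
  qed
  have "\<forall>v\<in>{1..<n} - {b}. \<exists>u\<in>{1..<n}. {v, u} \<in> H"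
    using has_nbr adjD by blast
  note chrom = chrom_poly_bipolar[OF b this]
  have "ml_degree n G = card (bipolar 1 b)"
    using assms(3) unfolding copious_def by (intro ml_degree_eq) simp
  then show ?thesis using chrom by simp
qed

end
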